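(* Let $d\ge3$ and consider the $d$-matrix model described in the context, with leading-order (planar) correlation functions $W^0$. Put $\sigma_i(x)=\sqrt{x^2-\frac{4}{1-\alpha_i^2}}$ with $\sigma_i(x)\sim x$ as $x\to\infty$. Then: 1. For every color $c\in\{1,\dots,d\}$, $y=W_c^0(x)$ satisfies $y^2-(1-\alpha_c^2)\,x\,y+(1-\alpha_c^2)=0$ and $$W_c^0(x)=\frac{1-\alpha_c^2}{2}\bigl(x-\sigma_c(x)\bigr),$$ with cut $\bigl[-2/\sqrt{1-\alpha_c^2},\,2/\sqrt{1-\alpha_c^2}\bigr]$. 2. For every color $i$, $$W^0_{ii}(x_1,x_2)=\frac{x_1x_2-\sigma_i(x_1)\sigma_i(x_2)-\frac{4}{1-\alpha_i^2}}{2(x_1-x_2)^2\sigma_i(x_1)\sigma_i(x_2)}-\frac{\sum_{p\neq i}(\alpha_i\alpha_p)^2}{\sum_{p=1}^d\alpha_p^2-1}\,\frac{W_i^0(x_1)W_i^0(x_2)}{(1-\alpha_i^2)\sigma_i(x_1)\sigma_i(x_2)} .$$ 3. For all colors $i\ne j$, $$W^0_{ij}(x_1,x_2)=-\frac{\alpha_i\alpha_j}{\sum_{p=1}^d\alpha_p^2-1}\,\frac{W_i^0(x_1)W_j^0(x_2)}{\sigma_i(x_1)\sigma_j(x_2)} .$$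
   Context: **Model.** $M_1,\dots,M_d$ are $N\times N$ Hermitian matrices with formal measure $$\prod_{c=1}^d dM_c\ \exp\Bigl(-\tfrac N2\sum_c\operatorname{tr}M_c^2+\operatorname{tr}\sum_{p\ge2}\tfrac{N^{\frac{2-d}{2}p}}{p}\bigl(\sum_c\alpha_c\mathcal M_c\bigr)^p\Bigr),\qquad \mathcal M_c=\mathbb 1^{\otimes(c-1)}\otimes M_c\otimes\mathbb 1^{\otimes(d-c)}.$$ Expectations are formal power series in the parameters $\alpha_1,\dots,\alpha_d$, obtained by expanding everything except the Gaussian weight $e^{-\frac N2\sum_c\operatorname{tr}M_c^2}$. **Planar correlation functions.** For colors $c_1,\dots,c_n\in\{1,\dots,d\}$, $W_{c_1\dots c_n}(x_1,\dots,x_n)=\langle\prod_{j}\operatorname{tr}\frac1{x_j-M_{c_j}}\rangle_{\mathrm{conn}}$ is the joint cumulant, expanded at $x_j=\infty$ as a series in $1/x_j$. It is of the form $N^{2-n}W^0_{c_1\dots c_n}(x_1,\dots,x_n)+{}$(terms of lower order in $N$); $W^0_{c_1\dots c_n}$ denotes the coefficient of $N^{2-n}$. Identities are understood as identities of expansions at $x_j=\infty$, perturbatively in the $\alpha_c$. *)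

theory Defs
  imports
    "HOL-Analysis.Analysis"
    "HOL-Computational_Algebra.Formal_Laurent_Series"
    "HOL-Library.Landau_Symbols"
    "HOL-Library.Disjoint_Sets"
begin

section \<open>Formal power series in finitely many variables\<close>

text \<open>
  A series is the family of its coefficients; the exponent \<open>e :: 'v \<Rightarrow> nat\<close> stands for
  the monomial \<open>\<Prod>v. v ^ e v\<close>.
\<close>

typedef ('v, 'a) mps = "UNIV :: (('v \<Rightarrow> nat) \<Rightarrow> 'a) set"
  morphisms mps_coeff Mps ..

lemma mps_coeff_Mps [simp]: "mps_coeff (Mps f) = f"
  by (simp add: Mps_inverse)

lemma mps_eqI: "(\<And>e. mps_coeff f e = mps_coeff g e) \<Longrightarrow> f = g"
  by (metis ext mps_coeff_inverse)

lemma finite_atMost_exponent [simp]: "finite {..(e :: 'v::finite \<Rightarrow> nat)}"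
proof -
  have "{..e} \<subseteq> PiE UNIV (\<lambda>v. {..e v})"
    by (auto simp: le_fun_def)
  then show ?thesis
    by (rule finite_subset) (intro finite_PiE, auto)
qed

instantiation mps :: (finite, comm_ring_1) comm_ring_1
begin

definition "0 = Mps (\<lambda>_. 0)"
definition "1 = Mps (\<lambda>e. if e = (\<lambda>_. 0) then 1 else 0)"
definition "f + g = Mps (\<lambda>e. mps_coeff f e + mps_coeff g e)"
definition "f - g = Mps (\<lambda>e. mps_coeff f e - mps_coeff g e)"
definition "- f = Mps (\<lambda>e. - mps_coeff f e)"
definition "f * g = Mps (\<lambda>e. \<Sum>a\<in>{..e}. mps_coeff f a * mps_coeff g (\<lambda>v. e v - a v))"

instance
proof
  fix f g h :: "('a, 'b) mps"
  show "f + g + h = f + (g + h)" "f + g = g + f" "0 + f = f" "- f + f = 0" "f - g = f + - g"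
    by (simp_all add: plus_mps_def zero_mps_def uminus_mps_def minus_mps_def algebra_simps
        mps_coeff_inverse)
  show "(0::('a, 'b) mps) \<noteq> 1"
  proof
    assume "(0::('a, 'b) mps) = 1"
    then have "mps_coeff (0::('a, 'b) mps) (\<lambda>_. 0) = mps_coeff 1 (\<lambda>_. 0)" by simp
    then show False by (simp add: zero_mps_def one_mps_def)
  qed
  show "(f + g) * h = f * h + g * h"
    by (simp add: plus_mps_def times_mps_def algebra_simps sum.distrib)
  show "f * g = g * f"
  proof (rule mps_eqI)
    fix e :: "'a \<Rightarrow> nat"
    show "mps_coeff (f * g) e = mps_coeff (g * f) e"
      unfolding times_mps_def mps_coeff_Mps
      by (rule sum.reindex_bij_witness[where i = "\<lambda>a v. e v - a v" and j = "\<lambda>a v. e v - a v"])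
         (auto simp: le_fun_def mult.commute)
  qed
  show "1 * f = f"
  proof (rule mps_eqI)
    fix e :: "'a \<Rightarrow> nat"
    have "mps_coeff (1 * f) e
        = (\<Sum>a\<in>{..e}. if a = (\<lambda>_. 0) then mps_coeff f (\<lambda>v. e v - a v) else 0)"
      unfolding times_mps_def one_mps_def mps_coeff_Mps by (rule sum.cong) auto
    also have "\<dots> = mps_coeff f e"
      by (subst sum.delta) (auto simp: le_fun_def)
    finally show "mps_coeff (1 * f) e = mps_coeff f e" .
  qed
  show "f * g * h = f * (g * h)"
  proof (rule mps_eqI)
    fix e :: "'a \<Rightarrow> nat"
    have "mps_coeff (f * g * h) e = (\<Sum>(a, b)\<in>(SIGMA a:{..e}. {..a}).
        mps_coeff f b * mps_coeff g (\<lambda>v. a v - b v) * mps_coeff h (\<lambda>v. e v - a v))"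
      unfolding times_mps_def mps_coeff_Mps
      by (simp add: sum.Sigma sum_distrib_right)
    also have "\<dots> = (\<Sum>(b, c)\<in>(SIGMA b:{..e}. {..(\<lambda>v. e v - b v)}).
        mps_coeff f b * (mps_coeff g c * mps_coeff h (\<lambda>v. e v - b v - c v)))"
      by (rule sum.reindex_bij_witness[where
            i = "\<lambda>(b, c). (\<lambda>v. b v + c v, b)" and j = "\<lambda>(a, b). (b, \<lambda>v. a v - b v)"])
         (auto simp: le_fun_def fun_eq_iff mult.assoc le_diff_conv2 add.commute diff_le_mono
            intro: order_trans)
    also have "\<dots> = mps_coeff (f * (g * h)) e"
      unfolding times_mps_def mps_coeff_Mps
      by (simp add: sum.Sigma sum_distrib_left)
    finally show "mps_coeff (f * g * h) e = mps_coeff (f * (g * h)) e" .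
  qed
qed

end

text \<open>
  Inverses of units; a non-unit has inverse \<open>0\<close>.  With this instance, division of Laurent
  series over the ring of power series is the ring-theoretic one whenever the leading
  coefficient of the denominator is a unit.
\<close>

instantiation mps :: (finite, comm_ring_1) inverse
begin

definition "inverse (f :: ('a, 'b) mps) = (if f dvd 1 then THE g. f * g = 1 else 0)"
definition "(f :: ('a, 'b) mps) div g = f * inverse g"

instance ..

end

lemma mps_inverse_eqI:
  fixes f g :: "('v::finite, 'a::comm_ring_1) mps"
  assumes "f * g = 1"
  shows "inverse f = g"
proof -
  have "h = g" if "f * h = 1" for h
  proof -
    have "h = h * (f * g)" using assms by simp
    also have "\<dots> = f * h * g" by (simp only: ac_simps)
    finally show ?thesis using that by simp
  qed
  then have "(THE g. f * g = 1) = g"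
    using assms by blast
  moreover have "f dvd 1" using dvd_triv_left[of f g] assms by simp
  ultimately show ?thesis by (simp add: inverse_mps_def)
qed

definition mps_const :: "'a \<Rightarrow> ('v::finite, 'a::comm_ring_1) mps" where
  "mps_const c = Mps (\<lambda>e. if e = (\<lambda>_. 0) then c else 0)"

definition mps_var :: "'v \<Rightarrow> ('v::finite, 'a::comm_ring_1) mps" where
  "mps_var i = Mps (\<lambda>e. if e = (\<lambda>v. if v = i then 1 else 0) then 1 else 0)"

text \<open>
  The sum \<open>\<Sum>n. F n\<close> for families in which \<open>F n\<close> has no terms of total degree below \<open>n\<close>,
  so that only finitely many \<open>n\<close> contribute to each coefficient.
\<close>

definition mps_sum :: "(nat \<Rightarrow> ('v::finite, 'a::comm_ring_1) mps) \<Rightarrow> ('v, 'a) mps" where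
  "mps_sum F = Mps (\<lambda>e. \<Sum>n \<le> (\<Sum>v\<in>UNIV. e v). mps_coeff (F n) e)"

text \<open>Only meaningful for series without constant term.\<close>

definition mps_exp :: "('v::finite, 'a::field_char_0) mps \<Rightarrow> ('v, 'a) mps" where
  "mps_exp f = mps_sum (\<lambda>n. mps_const (1 / fact n) * f ^ n)"

text \<open>Numerical value \<open>w\<close> of a series at the real point \<open>a\<close>.\<close>

definition mps_has_value ::
    "('v::finite, complex) mps \<Rightarrow> ('v \<Rightarrow> real) \<Rightarrow> complex \<Rightarrow> bool" where
  "mps_has_value f a w \<longleftrightarrow>
     ((\<lambda>e. mps_coeff f e * (\<Prod>v\<in>UNIV. complex_of_real (a v) ^ e v)) has_sum w) UNIV"


section \<open>Matrices over a finite index set\<close>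

definition mat_mult ::
    "'i set \<Rightarrow> ('i \<Rightarrow> 'i \<Rightarrow> 'a::comm_ring_1) \<Rightarrow> ('i \<Rightarrow> 'i \<Rightarrow> 'a) \<Rightarrow> 'i \<Rightarrow> 'i \<Rightarrow> 'a" where
  "mat_mult S A B = (\<lambda>i j. \<Sum>k\<in>S. A i k * B k j)"

primrec mat_pow :: "'i set \<Rightarrow> ('i \<Rightarrow> 'i \<Rightarrow> 'a::comm_ring_1) \<Rightarrow> nat \<Rightarrow> 'i \<Rightarrow> 'i \<Rightarrow> 'a" where
  "mat_pow S A 0 = (\<lambda>i j. if i = j then 1 else 0)"
| "mat_pow S A (Suc n) = mat_mult S A (mat_pow S A n)"

definition mat_trace :: "'i set \<Rightarrow> ('i \<Rightarrow> 'i \<Rightarrow> 'a::comm_ring_1) \<Rightarrow> 'a" where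
  "mat_trace S A = (\<Sum>i\<in>S. A i i)"


section \<open>The matrix model\<close>

text \<open>
  The colors are the elements of a finite type \<open>'d\<close>, so \<open>d = CARD('d)\<close>.  A \<open>d\<close>-tuple of
  Hermitian \<open>N \<times> N\<close> matrices is given by its real coordinates: the diagonal entries are
  \<open>X (c, i, i)\<close>, and for \<open>i < j\<close> the real and imaginary part of the \<open>(i, j)\<close> entry are
  \<open>X (c, i, j)\<close> and \<open>X (c, j, i)\<close>.  The measure \<open>\<Prod>c. dM\<^sub>c\<close> is Lebesgue measure in these
  coordinates.
\<close>

type_synonym 'd coords = "'d \<times> nat \<times> nat \<Rightarrow> real"

definition herm :: "'d coords \<Rightarrow> 'd \<Rightarrow> nat \<Rightarrow> nat \<Rightarrow> complex" where
  "herm X c i j =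
     (if i = j then complex_of_real (X (c, i, i))
      else if i < j then Complex (X (c, i, j)) (X (c, j, i))
      else Complex (X (c, j, i)) (- X (c, i, j)))"

definition flat_measure :: "nat \<Rightarrow> ('d::finite) coords measure" where
  "flat_measure N = PiM (UNIV \<times> {..<N} \<times> {..<N}) (\<lambda>_. lborel)"

definition gauss_weight :: "nat \<Rightarrow> ('d::finite) coords \<Rightarrow> real" where
  "gauss_weight N X =
     exp (- (real N / 2) * (\<Sum>c\<in>UNIV. Re (mat_trace {..<N} (mat_pow {..<N} (herm X c) 2))))"

definition gauss_expect :: "nat \<Rightarrow> (('d::finite) coords \<Rightarrow> complex) \<Rightarrow> complex" where
  "gauss_expect N f =
     (LINT X | flat_measure N. complex_of_real (gauss_weight N X) * f X) /
     complex_of_real (LINT X | (flat_measure N :: 'd coords measure). gauss_weight N X)"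

text \<open>
  The factor of color \<open>c\<close> of the tensor product carries the matrix \<open>M\<close>, all others the
  identity; indices of the tensor product are functions from colors to \<open>{..<N}\<close>.
\<close>

definition tensor_index :: "nat \<Rightarrow> ('d::finite \<Rightarrow> nat) set" where
  "tensor_index N = PiE UNIV (\<lambda>_. {..<N})"

definition tensor_embed ::
    "'d::finite \<Rightarrow> (nat \<Rightarrow> nat \<Rightarrow> complex) \<Rightarrow> ('d \<Rightarrow> nat) \<Rightarrow> ('d \<Rightarrow> nat) \<Rightarrow> complex" where
  "tensor_embed c M I J =
     (\<Prod>b\<in>UNIV. if b = c then M (I b) (J b) else if I b = J b then 1 else 0)"

definition interaction :: "nat \<Rightarrow> ('d::finite) coords \<Rightarrow> ('d, complex) mps" where
  "interaction N X =
     mat_trace (tensor_index N) (\<lambda>I J. mps_sum (\<lambda>p. if p < 2 then 0 else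
       mps_const (complex_of_real
         (real N powr ((2 - real CARD('d)) / 2 * real p) / real p)) *
       mat_pow (tensor_index N)
         (\<lambda>I J. \<Sum>c\<in>UNIV. mps_var c * mps_const (tensor_embed c (herm X c) I J)) p I J))"

text \<open>
  Expectations in the interacting model: the Gaussian expectation is applied to each
  coefficient of the expansion in the parameters.
\<close>

definition gauss_expect_mps ::
    "nat \<Rightarrow> (('d::finite) coords \<Rightarrow> ('d, complex) mps) \<Rightarrow> ('d, complex) mps" where
  "gauss_expect_mps N F = Mps (\<lambda>e. gauss_expect N (\<lambda>X. mps_coeff (F X) e))"

definition model_expect ::
    "nat \<Rightarrow> (('d::finite) coords \<Rightarrow> complex) \<Rightarrow> ('d, complex) mps" where
  "model_expect N f =
     gauss_expect_mps N (\<lambda>X. mps_const (f X) * mps_exp (interaction N X)) /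
     gauss_expect_mps N (\<lambda>X. mps_exp (interaction N X))"


section \<open>Correlation functions\<close>

text \<open>
  Since \<open>tr (1 / (x - M)) = (\<Sum>k. tr (M ^ k) / x ^ (k + 1))\<close> at \<open>x = \<infinity>\<close>, for
  \<open>cs = [(c\<^sub>1, k\<^sub>1), \<dots>, (c\<^sub>n, k\<^sub>n)]\<close> the joint cumulant of the traces \<open>tr (M\<^bsub>c\<^sub>j\<^esub> ^ k\<^sub>j)\<close> is the
  coefficient of \<open>\<Prod>j. x\<^sub>j ^ (- k\<^sub>j - 1)\<close> in the correlation function of colors \<open>c\<^sub>1, \<dots>, c\<^sub>n\<close>.
\<close>

definition trace_power :: "nat \<Rightarrow> 'd \<times> nat \<Rightarrow> ('d::finite) coords \<Rightarrow> complex" where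
  "trace_power N = (\<lambda>(c, k) X. mat_trace {..<N} (mat_pow {..<N} (herm X c) k))"

definition cumulant :: "nat \<Rightarrow> ('d::finite \<times> nat) list \<Rightarrow> ('d, complex) mps" where
  "cumulant N cs =
     (\<Sum>P | partition_on {..<length cs} P.
        mps_const ((-1) ^ (card P - 1) * fact (card P - 1)) *
        (\<Prod>B\<in>P. model_expect N (\<lambda>X. \<Prod>j\<in>B. trace_power N (cs ! j) X)))"

text \<open>The coefficient of \<open>N powr r\<close> in a sequence of the form
  \<open>w * N powr r + (terms of lower order in N)\<close>.\<close>

definition leading_coeff :: "real \<Rightarrow> (nat \<Rightarrow> complex) \<Rightarrow> complex" where
  "leading_coeff r f =
     (THE w. (\<lambda>N. f N - w * complex_of_real (real N powr r))
               \<in> o(\<lambda>N. complex_of_real (real N powr r)))"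

definition planar_cumulant :: "('d::finite \<times> nat) list \<Rightarrow> ('d, complex) mps" where
  "planar_cumulant cs =
     Mps (\<lambda>e. leading_coeff (2 - real (length cs)) (\<lambda>N. mps_coeff (cumulant N cs) e))"

text \<open>
  Functions of one variable \<open>x\<close> are Laurent series in \<open>1 / x\<close> (which is \<open>fls_X\<close>), with
  coefficients in the ring of power series in the parameters.  Functions of two variables
  are Laurent series in \<open>1 / x\<^sub>2\<close> whose coefficients are Laurent series in \<open>1 / x\<^sub>1\<close>.
\<close>

type_synonym 'd fun1 = "('d, complex) mps fls"
type_synonym 'd fun2 = "('d, complex) mps fls fls"

definition W1 :: "'d::finite \<Rightarrow> 'd fun1" where
  "W1 c = fls_X * fps_to_fls (Abs_fps (\<lambda>k. planar_cumulant [(c, k)]))"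

definition W2 :: "'d::finite \<Rightarrow> 'd \<Rightarrow> 'd fun2" where
  "W2 i j = fls_X * fps_to_fls (Abs_fps (\<lambda>l.
     fls_X * fps_to_fls (Abs_fps (\<lambda>k. planar_cumulant [(i, k), (j, l)]))))"

abbreviation (input) var_x :: "('d::finite) fun1" where
  "var_x \<equiv> fls_X_inv"

abbreviation scalar1 :: "('d::finite, complex) mps \<Rightarrow> 'd fun1" where
  "scalar1 \<equiv> fls_const"

abbreviation scalar2 :: "('d::finite, complex) mps \<Rightarrow> 'd fun2" where
  "scalar2 s \<equiv> fls_const (fls_const s)"

text \<open>\<open>in_x1 f\<close> is \<open>f(x\<^sub>1)\<close> and \<open>in_x2 f\<close> is \<open>f(x\<^sub>2)\<close>.\<close>

abbreviation in_x1 :: "('d::finite) fun1 \<Rightarrow> 'd fun2" where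
  "in_x1 \<equiv> fls_const"

definition in_x2 :: "('d::finite) fun1 \<Rightarrow> 'd fun2" where
  "in_x2 f = Abs_fls (\<lambda>n. fls_const (fls_nth f n))"

text \<open>The second line of the condition says \<open>s(x) \<sim> x\<close> as \<open>x \<rightarrow> \<infinity>\<close>.\<close>

definition sigma :: "'d::finite \<Rightarrow> 'd fun1" where
  "sigma i = (THE s. s ^ 2 = var_x ^ 2 - scalar1 (4 / (1 - mps_var i ^ 2)) \<and>
                     (\<forall>n < -1. fls_nth s n = 0) \<and> fls_nth s (-1) = 1)"


section \<open>Cuts\<close>

text \<open>
  \<open>[u, v]\<close> is the cut of \<open>F\<close>: it is holomorphic off this interval and its boundary values
  from above and below differ at each interior point.
\<close>

definition has_cut :: "(complex \<Rightarrow> complex) \<Rightarrow> real \<Rightarrow> real \<Rightarrow> bool" where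
  "has_cut F u v \<longleftrightarrow>
     F holomorphic_on (- (complex_of_real ` {u..v})) \<and>
     (\<forall>t\<in>{u<..<v}. \<exists>l m.
        ((\<lambda>h. F (Complex t h)) \<longlongrightarrow> l) (at_right 0) \<and>
        ((\<lambda>h. F (Complex t h)) \<longlongrightarrow> m) (at_left 0) \<and> l \<noteq> m)"

text \<open>
  At parameter values \<open>a\<close> for which every coefficient of \<open>f\<close> converges, \<open>F\<close> is the function
  whose expansion at infinity is \<open>f\<close>, on the disc \<open>norm x > R\<close> around infinity.
\<close>

definition has_expansion ::
    "('d::finite) fun1 \<Rightarrow> ('d \<Rightarrow> real) \<Rightarrow> real \<Rightarrow> (complex \<Rightarrow> complex) \<Rightarrow> bool" where
  "has_expansion f a R F \<longleftrightarrow> (\<forall>n<0. fls_nth f n = 0) \<and>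
     (\<exists>w. (\<forall>n. mps_has_value (fls_nth f (int n)) a (w n)) \<and>
          (\<forall>x. norm x > R \<longrightarrow> (\<lambda>n. w n / x ^ n) sums F x))"

end

theory Submission
  imports Defs "HOL-Probability.Distributions" "HOL-Library.Multiset"
begin

text \<open>
  Integration by parts against the Gaussian weight yields loop equations for the mixed moments of
  the normalized traces \<open>tr (M\<^sub>c ^ k) / N\<close>.  They determine the coefficients of all moments by
  induction on the order in the parameters and then on the total degree of the traces, and \<open>N\<close>
  enters only through \<open>1 / N\<^sup>2\<close> and through the couplings, of which those of degree above two tend
  to \<open>0\<close> when \<open>d \<ge> 3\<close>.  So all moments converge.  The rescaled covariances
  \<open>N\<^sup>2 (\<langle>f g\<rangle> - \<langle>f\<rangle> \<langle>g\<rangle>)\<close> with a fixed trace \<open>g\<close> satisfy loop equations of the same shape, with the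
  moments as inhomogeneity, so they converge too and no higher cumulants are needed.

  In the limit the moments factorize and the covariance with a fixed trace is a derivation.  This
  leaves a quadratic equation for the one-point function and a linear equation for the two-point
  function, in which the factor of \<open>W\<^sub>i\<^sub>j\<close> is \<open>(1 - \<alpha>\<^sub>i\<^sup>2) \<sigma>\<^sub>i(x\<^sub>1)\<close> and the colors are coupled only
  through the covariances of \<open>\<Sum>c. \<alpha>\<^sub>c tr M\<^sub>c\<close>.
\<close>

section \<open>Power series in finitely many variables\<close>

text \<open>The quadratic part of the interaction, which survives the limit, explains the constants
  of the result. Its equal-color part tr M_c^2 rescales the variance of color c by 1 / (1 -
  \<alpha>_c^2). Its mixed part is a product of two traces of first powers, so it perturbs the
  linear system for the covariances of these traces by a matrix of rank one; eliminating the single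
  unknown behind that matrix is what divides by \<open>norm2 - 1\<close>.

  The coupling terms of a loop equation may raise the weight of the traces. They are harmless
  because each carries at least two parameters and so lowers the order; this is why every induction
  runs over the order first.

  Scalars are power series in several parameters, and denominators are cancelled as units: their
  lowest coefficients have nonzero constant term. The closing algebra therefore lives in an
  arbitrary commutative ring, where each inverse is a variable given by its defining
  equation.\<close>

abbreviation tdeg :: "('v::finite \<Rightarrow> nat) \<Rightarrow> nat" where
  "tdeg e \<equiv> sum e UNIV"

lemma mps_coeff_zero [simp]: "mps_coeff 0 e = 0"
  by (simp add: zero_mps_def)

lemma mps_coeff_one: "mps_coeff 1 e = (if e = (\<lambda>_. 0) then 1 else 0)"
  by (simp add: one_mps_def)

lemma mps_coeff_add [simp]: "mps_coeff (f + g) e = mps_coeff f e + mps_coeff g e"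
  by (simp add: plus_mps_def)

lemma mps_coeff_diff [simp]: "mps_coeff (f - g) e = mps_coeff f e - mps_coeff g e"
  by (simp add: minus_mps_def)

lemma mps_coeff_uminus [simp]: "mps_coeff (- f) e = - mps_coeff f e"
  by (simp add: uminus_mps_def)

lemma mps_coeff_mult:
  "mps_coeff (f * g) e = (\<Sum>a\<in>{..e}. mps_coeff f a * mps_coeff g (\<lambda>v. e v - a v))"
  by (simp add: times_mps_def)

lemma mps_coeff_sum [simp]: "mps_coeff (sum F A) e = (\<Sum>x\<in>A. mps_coeff (F x) e)"
  by (induction A rule: infinite_finite_induct) auto

lemma mps_coeff_mult_0 [simp]:
  fixes f g :: "('v::finite, 'a::comm_ring_1) mps"
  shows "mps_coeff (f * g) (\<lambda>_. 0) = mps_coeff f (\<lambda>_. 0) * mps_coeff g (\<lambda>_. 0)"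
proof -
  have "{..(\<lambda>_. 0 :: nat)} = {(\<lambda>_::'v. 0)}"
    by (auto simp: le_fun_def)
  then show ?thesis by (simp add: mps_coeff_mult)
qed

lemma mps_coeff_const: "mps_coeff (mps_const c) e = (if e = (\<lambda>_. 0) then c else 0)"
  by (simp add: mps_const_def)

lemma mps_coeff_const_mult [simp]: "mps_coeff (mps_const c * f) e = c * mps_coeff f e"
proof -
  have "mps_coeff (mps_const c * f) e
      = (\<Sum>a\<in>{..e}. if a = (\<lambda>_. 0) then c * mps_coeff f (\<lambda>v. e v - a v) else 0)"
    unfolding mps_coeff_mult mps_coeff_const by (rule sum.cong) auto
  also have "\<dots> = c * mps_coeff f e"
    by (subst sum.delta) (auto simp: le_fun_def)
  finally show ?thesis .
qed

lemma mps_const_1 [simp]: "mps_const 1 = 1"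
  by (rule mps_eqI) (simp add: mps_coeff_const mps_coeff_one)

lemma mps_const_0 [simp]: "mps_const 0 = 0"
  by (rule mps_eqI) (simp add: mps_coeff_const)

lemma mps_const_mult: "mps_const (a * b) = mps_const a * mps_const b"
  by (rule mps_eqI) (simp add: mps_coeff_const)

lemma mps_const_add: "mps_const (a + b) = mps_const a + mps_const b"
  by (rule mps_eqI) (simp add: mps_coeff_const)

lemma mps_const_uminus: "mps_const (- a) = - mps_const a"
  by (rule mps_eqI) (simp add: mps_coeff_const)

lemma mps_const_of_nat: "mps_const (of_nat n) = of_nat n"
  by (induction n) (simp_all add: mps_const_add)

lemma mps_const_numeral: "mps_const (numeral n) = numeral n"
  by (metis mps_const_of_nat of_nat_numeral)

lemma mps_coeff_var:
  "mps_coeff (mps_var i) e = (if e = (\<lambda>_. 0)(i := 1) then 1 else 0)"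
proof -
  have "(\<lambda>_. 0)(i := 1) = (\<lambda>v. if v = i then 1 else (0::nat))" by auto
  then show ?thesis by (simp only: mps_var_def mps_coeff_Mps)
qed

lemma mps_coeff_var_mult:
  "mps_coeff (mps_var i * f) e = (if e i = 0 then 0 else mps_coeff f (e(i := e i - 1)))"
proof -
  have "mps_coeff (mps_var i * f) e
      = (\<Sum>a\<in>{..e}. if a = (\<lambda>_. 0)(i := 1) then mps_coeff f (\<lambda>v. e v - a v) else 0)"
    unfolding mps_coeff_mult mps_coeff_var by (rule sum.cong) auto
  also have "\<dots> = (if (\<lambda>_. 0)(i := 1) \<le> e
      then mps_coeff f (\<lambda>v. e v - ((\<lambda>_. 0)(i := 1)) v) else 0)"
    by (subst sum.delta) auto
  also have "(\<lambda>_. 0)(i := 1) \<le> e \<longleftrightarrow> e i \<noteq> 0"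
    by (auto simp: le_fun_def)
  also have "(\<lambda>v. e v - ((\<lambda>_. 0)(i := 1)) v) = e(i := e i - 1)"
    by (auto simp: fun_eq_iff)
  finally show ?thesis by simp
qed

lemma tdeg_fun_upd: "e i \<noteq> 0 \<Longrightarrow> Suc (tdeg (e(i := e i - 1))) = tdeg (e :: 'v::finite \<Rightarrow> nat)"
proof -
  assume "e i \<noteq> 0"
  moreover have "sum (e(i := e i - 1)) (UNIV - {i}) = sum e (UNIV - {i})"
    by (rule sum.cong) auto
  ultimately show ?thesis by (simp add: sum.remove[of UNIV i])
qed

lemma tdeg_diff: "a \<le> e \<Longrightarrow> tdeg (\<lambda>v. e v - a v) + tdeg a = tdeg (e :: 'v::finite \<Rightarrow> nat)"
  by (simp add: sum.distrib[symmetric] le_fun_def)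

lemma tdeg_mono: "a \<le> e \<Longrightarrow> tdeg a \<le> tdeg (e :: 'v::finite \<Rightarrow> nat)"
  by (simp add: sum_mono le_fun_def)

lemma tdeg_eq_0_iff: "tdeg (e :: 'v::finite \<Rightarrow> nat) = 0 \<longleftrightarrow> e = (\<lambda>_. 0)"
  by (auto simp: fun_eq_iff)

lemma mps_coeff_power_eq_0:
  assumes "mps_coeff f (\<lambda>_. 0) = 0" "tdeg e < n"
  shows "mps_coeff (f ^ n) e = 0"
  using assms(2)
proof (induction n arbitrary: e)
  case (Suc n)
  have "mps_coeff f a * mps_coeff (f ^ n) (\<lambda>v. e v - a v) = 0" if "a \<le> e" for a
  proof (cases "a = (\<lambda>_. 0)")
    case False
    then have "tdeg a > 0" using tdeg_eq_0_iff by (metis gr0I)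
    then have "tdeg (\<lambda>v. e v - a v) < n"
      using tdeg_diff[OF that] Suc.prems by linarith
    then show ?thesis using Suc.IH by simp
  qed (simp add: assms(1))
  then show ?case by (simp add: mps_coeff_mult)
qed simp

text \<open>For a single coefficient the formal sum may be replaced by any sufficiently long partial
  sum, so that identities of finite sums apply.\<close>

lemma mps_coeff_mps_sum:
  assumes "\<And>n. tdeg e < n \<Longrightarrow> mps_coeff (F n) e = 0" "tdeg e \<le> M"
  shows "mps_coeff (mps_sum F) e = mps_coeff (\<Sum>n\<le>M. F n) e"
proof -
  have "(\<Sum>n\<le>tdeg e. mps_coeff (F n) e) = (\<Sum>n\<le>M. mps_coeff (F n) e)"
    using assms by (intro sum.mono_neutral_left) auto
  then show ?thesis by (simp add: mps_sum_def)
qed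

lemma mps_coeff_mult_cong:
  assumes "\<And>a. a \<le> e \<Longrightarrow> mps_coeff f a = mps_coeff f' a"
    and "\<And>a. a \<le> e \<Longrightarrow> mps_coeff g a = mps_coeff g' a"
  shows "mps_coeff (f * g) e = mps_coeff (f' * g') e"
  unfolding mps_coeff_mult by (intro sum.cong refl) (auto simp: assms le_fun_def)

text \<open>Geometric series: dividing \<open>f\<close> by its constant term gives
  \<open>1 - h\<close> with \<open>h\<close> free of a constant term, and the powers of
  \<open>h\<close> sum to its inverse.\<close>

lemma mps_unitI:
  fixes f :: "('v::finite, 'a::field) mps"
  assumes "mps_coeff f (\<lambda>_. 0) \<noteq> 0"
  shows "f * inverse f = 1"
proof -
  define c where "c = mps_coeff f (\<lambda>_. 0)"
  define h where "h = 1 - mps_const (1 / c) * f"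
  define g where "g = mps_sum (\<lambda>n. h ^ n)"
  have h0: "mps_coeff h (\<lambda>_. 0) = 0"
    using assms by (simp add: h_def c_def mps_coeff_one mps_coeff_const)
  have "(1 - h) * g = 1"
  proof (rule mps_eqI)
    fix e :: "'v \<Rightarrow> nat"
    have "mps_coeff ((1 - h) * g) e = mps_coeff ((1 - h) * (\<Sum>n\<le>tdeg e. h ^ n)) e"
      unfolding g_def
      by (intro mps_coeff_mult_cong mps_coeff_mps_sum)
         (auto intro: mps_coeff_power_eq_0 h0 tdeg_mono)
    also have "(1 - h) * (\<Sum>n\<le>tdeg e. h ^ n) = 1 - h ^ Suc (tdeg e)"
      by (metis lessThan_Suc_atMost one_diff_power_eq)
    finally show "mps_coeff ((1 - h) * g) e = mps_coeff 1 e"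
      using mps_coeff_power_eq_0[OF h0, of e "Suc (tdeg e)"] by (simp del: power_Suc)
  qed
  then have "f * (mps_const (1 / c) * g) = 1"
    by (simp add: h_def ac_simps)
  then show ?thesis using mps_inverse_eqI by metis
qed

lemma mps_coeff_exp:
  assumes "mps_coeff f (\<lambda>_. 0) = 0" "tdeg e \<le> M"
  shows "mps_coeff (mps_exp f) e = mps_coeff (\<Sum>n\<le>M. mps_const (1 / fact n) * f ^ n) e"
  unfolding mps_exp_def
  by (rule mps_coeff_mps_sum) (use assms in \<open>auto intro: mps_coeff_power_eq_0\<close>)

subsection \<open>Weighted shifts\<close>

text \<open>\<open>mps_shift w G\<close> is \<open>\<Sum>u. w u * monomial u * G u\<close>.\<close>

definition mps_shift ::
    "(('v \<Rightarrow> nat) \<Rightarrow> 'a) \<Rightarrow> (('v \<Rightarrow> nat) \<Rightarrow> ('v, 'a) mps) \<Rightarrow> ('v::finite, 'a::comm_ring_1) mps" where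
  "mps_shift w G = Mps (\<lambda>e. \<Sum>u\<in>{..e}. w u * mps_coeff (G u) (\<lambda>v. e v - u v))"

lemma mps_coeff_shift:
  "mps_coeff (mps_shift w G) e = (\<Sum>u\<in>{..e}. w u * mps_coeff (G u) (\<lambda>v. e v - u v))"
  by (simp add: mps_shift_def)

text \<open>Lets the coupling term of a loop equation be divided by the partition function or
  multiplied by a fixed moment. The reindexing is that of associativity of the product.\<close>

lemma mult_mps_shift: "h * mps_shift w G = mps_shift w (\<lambda>u. h * G u)"
proof (rule mps_eqI)
  fix e :: "'a \<Rightarrow> nat"
  have "mps_coeff (mps_shift w G * h) e = (\<Sum>(a, b)\<in>(SIGMA a:{..e}. {..a}).
      w b * mps_coeff (G b) (\<lambda>v. a v - b v) * mps_coeff h (\<lambda>v. e v - a v))"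
    unfolding mps_coeff_mult mps_coeff_shift
    by (simp add: sum.Sigma sum_distrib_right)
  also have "\<dots> = (\<Sum>(b, c)\<in>(SIGMA b:{..e}. {..(\<lambda>v. e v - b v)}).
      w b * (mps_coeff (G b) c * mps_coeff h (\<lambda>v. e v - b v - c v)))"
    by (rule sum.reindex_bij_witness[where
          i = "\<lambda>(b, c). (\<lambda>v. b v + c v, b)" and j = "\<lambda>(a, b). (b, \<lambda>v. a v - b v)"])
       (auto simp: le_fun_def fun_eq_iff mult.assoc le_diff_conv2 add.commute diff_le_mono
          intro: order_trans)
  also have "\<dots> = mps_coeff (mps_shift w (\<lambda>u. G u * h)) e"
    unfolding mps_coeff_mult mps_coeff_shift
    by (simp add: sum.Sigma sum_distrib_left)
  finally show "mps_coeff (h * mps_shift w G) e = mps_coeff (mps_shift w (\<lambda>u. h * G u)) e"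
    by (simp only: mult.commute)
qed

lemma mps_shift_diff: "mps_shift w G - mps_shift w H = mps_shift w (\<lambda>u. G u - H u)"
  by (rule mps_eqI) (simp add: mps_coeff_shift sum_subtractf algebra_simps)

text \<open>
  Restricted to weights supported on \<open>u = \<delta>\<^sub>c + \<delta>\<^sub>b\<close>, where the factor \<open>u c\<close> of the derivative
  turns the weight \<open>1 / \<Prod>v. u v!\<close> into \<open>1\<close> for all \<open>b\<close>, including \<open>b = c\<close>.
\<close>

lemma mps_shift_quadratic:
  fixes c :: "'v::finite" and G :: "_ \<Rightarrow> ('v, 'a::field_char_0) mps"
  defines "q \<equiv> \<lambda>b v. (if v = c then 1 else 0) + (if v = b then 1 else 0 :: nat)"
  assumes "\<And>u. w u = (if tdeg u = 2 then 1 / (\<Prod>v\<in>UNIV. fact (u v)) else 0)"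
  shows "mps_shift (\<lambda>u. w u * of_nat (u c)) G = (\<Sum>b\<in>UNIV. mps_var c * mps_var b * G (q b))"
proof (rule mps_eqI)
  fix e :: "'v \<Rightarrow> nat"
  have inj: "inj q"
  proof (rule injI, rule ccontr)
    fix a b assume "q a = q b" "a \<noteq> b"
    then have "q a a = q b a" by simp
    then show False using \<open>a \<noteq> b\<close> by (simp add: q_def)
  qed
  have wq: "w (q b) * of_nat (q b c) = 1" for b
  proof (cases "b = c")
    case True
    then have q: "q b v = (if v = c then 2 else 0)" for v by (simp add: q_def)
    have "(\<Prod>v\<in>UNIV. fact (q b v) :: 'a) = (\<Prod>v\<in>UNIV. if v = c then 2 else 1)"
      by (rule prod.cong) (auto simp: q)
    then show ?thesis by (simp add: assms(2) q)
  next
    case False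
    have "(\<Prod>v\<in>UNIV. fact (q b v) :: 'a) = 1"
      using False by (intro prod.neutral) (auto simp: q_def)
    moreover have "tdeg (q b) = 2"
      by (simp add: q_def sum.distrib)
    ultimately show ?thesis using False by (simp add: assms(2)) (simp add: q_def)
  qed
  \<comment> \<open>Lowering the exponent of \<open>c\<close> by one leaves total degree one, that
    is, a single color \<open>b\<close>.\<close>
  have supp: "u \<in> range q" if "tdeg u = 2" "u c \<noteq> 0" for u
  proof -
    define u' where "u' = u(c := u c - 1)"
    have "tdeg u' = 1" using tdeg_fun_upd[of u c] that by (simp add: u'_def)
    then obtain b where b: "u' b = Suc 0" "\<And>v. v \<noteq> b \<Longrightarrow> u' v = 0"
      using sum_eq_Suc0_iff[of UNIV u'] by auto
    have "u = q b"
    proof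
      fix v
      have "u v = (if v = c then 1 else 0) + u' v" using that by (simp add: u'_def)
      then show "u v = q b v" using b by (cases "v = b") (auto simp: q_def)
    qed
    then show ?thesis by simp
  qed
  have "mps_coeff (mps_shift (\<lambda>u. w u * of_nat (u c)) G) e
      = (\<Sum>u\<in>{..e} \<inter> range q. w u * of_nat (u c) * mps_coeff (G u) (\<lambda>v. e v - u v))"
    unfolding mps_coeff_shift
    using supp by (intro sum.mono_neutral_right) (auto simp: assms(2))
  also have "{..e} \<inter> range q = q ` {b. q b \<le> e}" by auto
  also have "(\<Sum>u\<in>q ` {b. q b \<le> e}. w u * of_nat (u c) * mps_coeff (G u) (\<lambda>v. e v - u v))
      = (\<Sum>b\<in>{b. q b \<le> e}. mps_coeff (G (q b)) (\<lambda>v. e v - q b v))"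
    using inj by (subst sum.reindex) (auto simp: inj_on_def wq)
  also have "\<dots> = (\<Sum>b\<in>UNIV. if q b \<le> e then mps_coeff (G (q b)) (\<lambda>v. e v - q b v) else 0)"
    by (simp add: sum.If_cases)
  also have "\<dots> = (\<Sum>b\<in>UNIV. mps_coeff (mps_var c * (mps_var b * G (q b))) e)"
  proof (rule sum.cong[OF refl])
    fix b
    show "(if q b \<le> e then mps_coeff (G (q b)) (\<lambda>v. e v - q b v) else 0)
        = mps_coeff (mps_var c * (mps_var b * G (q b))) e"
    proof (cases "q b \<le> e")
      case True
      then have "q b c \<le> e c" "q b b \<le> e b" by (auto simp: le_fun_def)
      moreover have "(\<lambda>v. e v - q b v) = (e(c := e c - 1))(b := (e(c := e c - 1)) b - 1)"
        by (auto simp: fun_eq_iff q_def)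
      ultimately show ?thesis using True
        by (auto simp: mps_coeff_var_mult q_def split: if_splits)
    next
      case False
      have "e c = 0 \<or> (e(c := e c - 1)) b = 0"
      proof (rule ccontr)
        assume *: "\<not> ?thesis"
        have "q b v \<le> e v" for v using * by (auto simp: q_def split: if_splits)
        then show False using False by (simp add: le_fun_def)
      qed
      then show ?thesis using False by (auto simp: mps_coeff_var_mult)
    qed
  qed
  finally show "mps_coeff (mps_shift (\<lambda>u. w u * of_nat (u c)) G) e
      = mps_coeff (\<Sum>b\<in>UNIV. mps_var c * mps_var b * G (q b)) e"
    by (simp add: mult.assoc)
qed

subsection \<open>Equality up to a total degree\<close>

definition mps_eq_upto :: "nat \<Rightarrow> ('v::finite, 'a) mps \<Rightarrow> ('v, 'a) mps \<Rightarrow> bool" where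
  "mps_eq_upto n f g \<longleftrightarrow> (\<forall>e. tdeg e \<le> n \<longrightarrow> mps_coeff f e = mps_coeff g e)"

lemma mps_eq_upto_refl [simp]: "mps_eq_upto n f f"
  by (simp add: mps_eq_upto_def)

lemma mps_eq_upto_all: "(\<And>n. mps_eq_upto n f g) \<Longrightarrow> f = g"
  by (rule mps_eqI) (auto simp: mps_eq_upto_def)

lemma mps_eq_upto_trans [trans]:
  "mps_eq_upto n f g \<Longrightarrow> mps_eq_upto n g h \<Longrightarrow> mps_eq_upto n f h"
  by (simp add: mps_eq_upto_def)

lemma mps_eq_upto_sym: "mps_eq_upto n f g \<Longrightarrow> mps_eq_upto n g f"
  by (simp add: mps_eq_upto_def)

lemma mps_eq_upto_add:
  "mps_eq_upto n f f' \<Longrightarrow> mps_eq_upto n g g' \<Longrightarrow> mps_eq_upto n (f + g) (f' + g')"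
  by (simp add: mps_eq_upto_def)

lemma mps_eq_upto_sum:
  "(\<And>x. x \<in> A \<Longrightarrow> mps_eq_upto n (F x) (G x)) \<Longrightarrow> mps_eq_upto n (sum F A) (sum G A)"
  by (simp add: mps_eq_upto_def)

lemma mps_eq_upto_mult:
  assumes "mps_eq_upto n f f'" "mps_eq_upto n g g'"
  shows "mps_eq_upto n (f * g) (f' * g')"
  unfolding mps_eq_upto_def
proof (intro allI impI)
  fix e :: "'a \<Rightarrow> nat" assume e: "tdeg e \<le> n"
  show "mps_coeff (f * g) e = mps_coeff (f' * g') e"
    by (rule mps_coeff_mult_cong)
       (use assms e in \<open>auto simp: mps_eq_upto_def dest!: tdeg_mono\<close>)
qed

text \<open>A parameter raises the degree, so agreement in strictly lower orders is enough. This
  feeds the outer induction on the order.\<close>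

lemma mps_eq_upto_var_mult:
  assumes "\<And>m. m < n \<Longrightarrow> mps_eq_upto m f g"
  shows "mps_eq_upto n (mps_var i * f) (mps_var i * g)"
  unfolding mps_eq_upto_def mps_coeff_var_mult
proof (intro allI impI if_cong refl)
  fix e :: "'a \<Rightarrow> nat" assume "tdeg e \<le> n" "\<not> e i = 0"
  then have "tdeg (e(i := e i - 1)) < n" using tdeg_fun_upd[of e i] by linarith
  then show "mps_coeff f (e(i := e i - 1)) = mps_coeff g (e(i := e i - 1))"
    using assms by (auto simp: mps_eq_upto_def)
qed

section \<open>Gaussian integration by parts\<close>

text \<open>Unnormalized, because the total mass cancels in the quotient
  \<open>gauss_expect\<close>.\<close>

definition gauss_moment :: "real \<Rightarrow> nat \<Rightarrow> real" where
  "gauss_moment s n = (LINT x|lborel. exp (- x\<^sup>2 / (2 * s)) * x ^ n)"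

lemma exp_eq_normal_density:
  assumes "s > 0"
  shows "exp (- x\<^sup>2 / (2 * s)) * y = sqrt (2 * pi * s) * (normal_density 0 (sqrt s) x * y)"
  using assms by (simp add: normal_density_def real_sqrt_mult)

lemma gauss_moment_integrable:
  assumes "s > 0"
  shows "integrable lborel (\<lambda>x::real. exp (- x\<^sup>2 / (2 * s)) * x ^ n)"
  unfolding exp_eq_normal_density[OF assms]
  using integrable_normal_moment[of "sqrt s" 0 n] assms by (intro integrable_mult_right) simp

text \<open>Integration by parts in one variable, read off from the closed forms of the normal
  moments. At \<open>n = 0\<close> the factor \<open>n\<close> neutralizes the truncated
  \<open>n - 1\<close>.\<close>

lemma gauss_moment_Suc:
  assumes "s > 0"
  shows "gauss_moment s (Suc n) = s * n * gauss_moment s (n - 1)"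
proof -
  have nd: "gauss_moment s m = sqrt (2 * pi * s) * (LINT x|lborel. normal_density 0 (sqrt s) x * x ^ m)" for m
    unfolding gauss_moment_def exp_eq_normal_density[OF assms] by simp
  have odd: "gauss_moment s (2 * k + 1) = 0" for k
    unfolding nd using integral_normal_moment_odd[of "sqrt s" 0 k] assms by simp
  have even: "gauss_moment s (2 * k) = sqrt (2 * pi * s) * (fact (2 * k) / ((2 / s) ^ k * fact k))" for k
    unfolding nd using integral_normal_moment_even[of "sqrt s" 0 k] assms by simp
  show ?thesis
  proof (cases "even n")
    case True
    then obtain k where n: "n = 2 * k" by (auto elim: evenE)
    show ?thesis
    proof (cases k)
      case (Suc l)
      then have "n - 1 = 2 * l + 1" using n by simp
      then show ?thesis using odd n by simp
    qed (use odd[of 0] n in simp)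
  next
    case False
    then obtain k where n: "n = 2 * k + 1" by (auto elim: oddE)
    have "fact (2 * Suc k) = 2 * real (Suc k) * ((2 * k + 1) * fact (2 * k))"
      by (simp add: algebra_simps)
    moreover have "Suc n = 2 * Suc k" using n by simp
    ultimately have "gauss_moment s (Suc n)
        = sqrt (2 * pi * s) * (2 * real (Suc k) * ((2 * k + 1) * fact (2 * k)) / ((2 / s) ^ Suc k * fact (Suc k)))"
      using even[of "Suc k"] by simp
    also have "\<dots> = s * (2 * k + 1) * (sqrt (2 * pi * s) * (fact (2 * k) / ((2 / s) ^ k * fact k)))"
      using assms by (simp add: divide_simps del: fact_Suc of_nat_Suc) (simp add: algebra_simps)
    also have "\<dots> = s * n * gauss_moment s (2 * k)"
      unfolding even n by simp
    finally show ?thesis by (simp add: n)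
  qed
qed

lemma gauss_moment_0_pos: "s > 0 \<Longrightarrow> gauss_moment s 0 > 0"
  unfolding gauss_moment_def exp_eq_normal_density by simp

section \<open>Gaussian densities and polynomial derivatives in several variables\<close>

definition gauss_density :: "'w set \<Rightarrow> ('w \<Rightarrow> real) \<Rightarrow> ('w \<Rightarrow> real) \<Rightarrow> real" where
  "gauss_density V s X = (\<Prod>w\<in>V. exp (- (X w)\<^sup>2 / (2 * s w)))"

abbreviation lborel_coords :: "'w set \<Rightarrow> ('w \<Rightarrow> real) measure" where
  "lborel_coords V \<equiv> PiM V (\<lambda>_. lborel)"

lemma gauss_density_monomial:
  assumes "finite V" "\<And>w. w \<in> V \<Longrightarrow> s w > 0"
  shows "integrable (lborel_coords V) (\<lambda>X. gauss_density V s X * (\<Prod>w\<in>V. X w ^ n w))"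
    and "(LINT X|lborel_coords V. gauss_density V s X * (\<Prod>w\<in>V. X w ^ n w))
      = (\<Prod>w\<in>V. gauss_moment (s w) (n w))"
proof -
  interpret product_sigma_finite "\<lambda>_. lborel :: real measure" ..
  have *: "gauss_density V s X * (\<Prod>w\<in>V. X w ^ n w)
      = (\<Prod>w\<in>V. exp (- (X w)\<^sup>2 / (2 * s w)) * X w ^ n w)" for X
    by (simp add: gauss_density_def prod.distrib)
  show "integrable (lborel_coords V) (\<lambda>X. gauss_density V s X * (\<Prod>w\<in>V. X w ^ n w))"
    unfolding * using assms
    by (intro product_integrable_prod[where f = "\<lambda>w x. exp (- x\<^sup>2 / (2 * s w)) * x ^ n w"]
        gauss_moment_integrable)
  show "(LINT X|lborel_coords V. gauss_density V s X * (\<Prod>w\<in>V. X w ^ n w))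
      = (\<Prod>w\<in>V. gauss_moment (s w) (n w))"
    unfolding * gauss_moment_def using assms
    by (intro product_integral_prod[where f = "\<lambda>w x. exp (- x\<^sup>2 / (2 * s w)) * x ^ n w"]
        gauss_moment_integrable)
qed

text \<open>
  \<open>poly_deriv V a f g\<close>: \<open>f\<close> is a polynomial in the coordinates \<open>V\<close> and \<open>g\<close> is its derivative
  in the complex direction \<open>a\<close>.
\<close>

inductive poly_deriv ::
    "'w set \<Rightarrow> ('w \<Rightarrow> complex) \<Rightarrow> (('w \<Rightarrow> real) \<Rightarrow> complex) \<Rightarrow> (('w \<Rightarrow> real) \<Rightarrow> complex) \<Rightarrow> bool"
  for V :: "'w set" and a :: "'w \<Rightarrow> complex" where
  const: "poly_deriv V a (\<lambda>X. z) (\<lambda>X. 0)"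
| coord: "w \<in> V \<Longrightarrow> poly_deriv V a (\<lambda>X. complex_of_real (X w)) (\<lambda>X. a w)"
| add: "poly_deriv V a f f' \<Longrightarrow> poly_deriv V a g g' \<Longrightarrow>
    poly_deriv V a (\<lambda>X. f X + g X) (\<lambda>X. f' X + g' X)"
| mult: "poly_deriv V a f f' \<Longrightarrow> poly_deriv V a g g' \<Longrightarrow>
    poly_deriv V a (\<lambda>X. f X * g X) (\<lambda>X. f' X * g X + f X * g' X)"

lemma poly_deriv_sum:
  "(\<And>x. x \<in> A \<Longrightarrow> poly_deriv V a (f x) (f' x)) \<Longrightarrow>
    poly_deriv V a (\<lambda>X. \<Sum>x\<in>A. f x X) (\<lambda>X. \<Sum>x\<in>A. f' x X)"
  by (induction A rule: infinite_finite_induct)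
     (auto intro: poly_deriv.const poly_deriv.add)

lemma poly_deriv_cmult:
  "poly_deriv V a f f' \<Longrightarrow> poly_deriv V a (\<lambda>X. z * f X) (\<lambda>X. z * f' X)"
  using poly_deriv.mult[OF poly_deriv.const[of V a z]] by simp

context
  fixes V :: "'w set" and s :: "'w \<Rightarrow> real" and a :: "'w \<Rightarrow> complex"
  assumes V: "finite V" and s: "\<And>w. w \<in> V \<Longrightarrow> s w > 0"
begin

private abbreviation "\<L> \<equiv> lborel_coords V"
private abbreviation "W X \<equiv> complex_of_real (gauss_density V s X)"
private abbreviation "mon (n :: 'w \<Rightarrow> nat) X \<equiv> \<Prod>w\<in>V. complex_of_real (X w) ^ n w"
text \<open>\<open>mon'\<close> is the derivative of the monomial in direction \<open>a\<close>;
  \<open>field\<close> is minus the derivative of the logarithm of the density in that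
  direction.\<close>

private abbreviation "mon' (n :: 'w \<Rightarrow> nat) X \<equiv> \<Sum>v\<in>V. a v * of_nat (n v) * mon (n(v := n v - 1)) X"
private abbreviation "field X \<equiv> \<Sum>w\<in>V. a w / of_real (s w) * of_real (X w)"

text \<open>The arbitrary monomial in front makes the induction over polynomials close: a coordinate
  factor of \<open>f\<close> is absorbed by raising an exponent. Integrability is carried along
  because integrals of sums have to be split.\<close>

private definition "ibp f g \<longleftrightarrow>
  (\<forall>n. integrable (\<L>) (\<lambda>X. W X * mon n X * f X) \<and>
       integrable (\<L>) (\<lambda>X. W X * mon n X * g X) \<and>
       (LINT X|\<L>. W X * mon n X * (field X * f X)) =
       (LINT X|\<L>. W X * mon' n X * f X + W X * mon n X * g X))"

private lemma ibpD:
  assumes "ibp f g"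
  shows "\<And>n. integrable (\<L>) (\<lambda>X. W X * mon n X * f X)"
    and "\<And>n. integrable (\<L>) (\<lambda>X. W X * mon n X * g X)"
    and "\<And>n. (LINT X|\<L>. W X * mon n X * (field X * f X)) =
       (LINT X|\<L>. W X * mon' n X * f X + W X * mon n X * g X)"
  using assms unfolding ibp_def by blast+

private lemma mon_coord: "v \<in> V \<Longrightarrow> mon n X * of_real (X v) = mon (n(v := Suc (n v))) X"
  using V by (simp add: prod.remove[of V v] ac_simps)

private lemma mon'_coord:
  assumes v: "v \<in> V"
  shows "mon' (n(v := Suc (n v))) X = mon' n X * of_real (X v) + mon n X * a v"
proof -
  have rest: "a w * of_nat ((n(v := Suc (n v))) w) * mon ((n(v := Suc (n v)))(w := (n(v := Suc (n v))) w - 1)) X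
      = a w * of_nat (n w) * mon (n(w := n w - 1)) X * of_real (X v)" if "w \<in> V - {v}" for w
  proof -
    have "(n(v := Suc (n v)))(w := (n(v := Suc (n v))) w - 1)
        = (n(w := n w - 1))(v := Suc ((n(w := n w - 1)) v))"
      using that by auto
    then show ?thesis using that mon_coord[OF v, where n = "n(w := n w - 1)" and X = X] by (simp add: mult.assoc)
  qed
  have at_v: "of_nat (n v) * mon n X = of_nat (n v) * mon (n(v := n v - 1)) X * of_real (X v)"
  proof (cases "n v = 0")
    case False
    then have "n(v := n v - 1, v := Suc ((n(v := n v - 1)) v)) = n" by auto
    then show ?thesis
      using mon_coord[OF v, where n = "n(v := n v - 1)" and X = X] by (simp only: mult.assoc)
  qed simp
  have "mon' (n(v := Suc (n v))) X = a v * of_nat (Suc (n v)) * mon n X +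
      (\<Sum>w\<in>V - {v}. a w * of_nat (n w) * mon (n(w := n w - 1)) X * of_real (X v))"
    unfolding sum.remove[OF V v] by (simp only: rest cong: sum.cong) simp
  also have "a v * of_nat (Suc (n v)) * mon n X
      = a v * of_nat (n v) * mon (n(v := n v - 1)) X * of_real (X v) + mon n X * a v"
    using at_v by (simp add: algebra_simps)
  finally show ?thesis
    unfolding sum.remove[OF V v] by (simp add: sum_distrib_right distrib_right)
qed

private lemma field_integrable:
  assumes "\<And>n. integrable (\<L>) (\<lambda>X. W X * mon n X * f X)"
  shows "integrable (\<L>) (\<lambda>X. W X * mon n X * (field X * f X))"
proof -
  have "integrable (\<L>) (\<lambda>X. \<Sum>w\<in>V. (a w / of_real (s w)) * (W X * mon (n(w := Suc (n w))) X * f X))"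
    using assms by (intro Bochner_Integration.integrable_sum integrable_mult_right)
  also have "(\<lambda>X. \<Sum>w\<in>V. (a w / of_real (s w)) * (W X * mon (n(w := Suc (n w))) X * f X))
      = (\<lambda>X. W X * mon n X * (field X * f X))"
  proof
    fix X
    have "(a w / of_real (s w)) * (W X * mon (n(w := Suc (n w))) X * f X)
        = W X * mon n X * (a w / of_real (s w) * of_real (X w) * f X)" if "w \<in> V" for w
      using mon_coord[OF that, where n = n and X = X] by (simp add: ac_simps)
    then show "(\<Sum>w\<in>V. (a w / of_real (s w)) * (W X * mon (n(w := Suc (n w))) X * f X))
        = W X * mon n X * (field X * f X)"
      by (simp only: sum_distrib_left sum_distrib_right cong: sum.cong)
  qed
  finally show ?thesis .
qed

private lemma mon'_integrable:
  assumes "\<And>n. integrable (\<L>) (\<lambda>X. W X * mon n X * f X)"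
  shows "integrable (\<L>) (\<lambda>X. W X * mon' n X * f X)"
proof -
  have "integrable (\<L>) (\<lambda>X. \<Sum>v\<in>V. (a v * of_nat (n v)) * (W X * mon (n(v := n v - 1)) X * f X))"
    using assms by (intro Bochner_Integration.integrable_sum integrable_mult_right)
  then show ?thesis
    by (simp add: sum_distrib_left sum_distrib_right ac_simps)
qed

private lemma mon_has_integral:
  "integrable (\<L>) (\<lambda>X. W X * mon n X)"
  "(LINT X|\<L>. W X * mon n X) = of_real (\<Prod>w\<in>V. gauss_moment (s w) (n w))"
proof -
  have *: "(\<lambda>X. W X * mon n X) = (\<lambda>X. complex_of_real (gauss_density V s X * (\<Prod>w\<in>V. X w ^ n w)))"
    by simp
  show "integrable (\<L>) (\<lambda>X. W X * mon n X)"
    unfolding * by (intro integrable_of_real gauss_density_monomial V s)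
  show "(LINT X|\<L>. W X * mon n X) = of_real (\<Prod>w\<in>V. gauss_moment (s w) (n w))"
    unfolding * integral_complex_of_real
    by (rule arg_cong[where f = of_real], rule gauss_density_monomial(2)[OF V s])
qed

private lemma ibp_one: "ibp (\<lambda>_. 1) (\<lambda>_. 0)"
  unfolding ibp_def
proof (intro allI conjI)
  fix n
  show "integrable (\<L>) (\<lambda>X. W X * mon n X * 1)"
    using mon_has_integral by simp
  show "integrable (\<L>) (\<lambda>X. W X * mon n X * 0)"
    by simp
  have "(LINT X|\<L>. W X * mon n X * (field X * 1))
      = (LINT X|\<L>. (\<Sum>w\<in>V. a w / of_real (s w) * (W X * mon (n(w := Suc (n w))) X)))"
  proof (rule Bochner_Integration.integral_cong[OF refl])
    fix X
    have "(a w / of_real (s w)) * (W X * mon (n(w := Suc (n w))) X)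
        = W X * mon n X * (a w / of_real (s w) * of_real (X w))" if "w \<in> V" for w
      using mon_coord[OF that, where n = n and X = X] by (simp add: ac_simps)
    then show "W X * mon n X * (field X * 1)
        = (\<Sum>w\<in>V. a w / of_real (s w) * (W X * mon (n(w := Suc (n w))) X))"
      by (simp only: sum_distrib_left mult_1_right cong: sum.cong)
  qed
  also have "\<dots> = (\<Sum>w\<in>V. a w / of_real (s w) * of_real (\<Prod>v\<in>V. gauss_moment (s v) ((n(w := Suc (n w))) v)))"
    by (subst Bochner_Integration.integral_sum)
       (auto intro!: integrable_mult_right mon_has_integral simp: mon_has_integral simp del: fun_upd_apply)
  \<comment> \<open>The moment recursion acts in the single coordinate \<open>w\<close>; the
    variance it produces cancels the denominator of \<open>field\<close>.\<close>
  also have "\<dots> = (\<Sum>w\<in>V. a w * of_nat (n w) * of_real (\<Prod>v\<in>V. gauss_moment (s v) ((n(w := n w - 1)) v)))"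
  proof (rule sum.cong[OF refl])
    fix w assume w: "w \<in> V"
    show "a w / of_real (s w) * of_real (\<Prod>v\<in>V. gauss_moment (s v) ((n(w := Suc (n w))) v))
        = a w * of_nat (n w) * of_real (\<Prod>v\<in>V. gauss_moment (s v) ((n(w := n w - 1)) v))"
    proof -
      have "(\<Prod>v\<in>V - {w}. gauss_moment (s v) ((n(w := k)) v)) = (\<Prod>v\<in>V - {w}. gauss_moment (s v) (n v))" for k
        by (rule prod.cong) auto
      then show ?thesis
        using s[OF w] unfolding prod.remove[OF V w] by (simp add: gauss_moment_Suc)
    qed
  qed
  also have "\<dots> = (LINT X|\<L>. (\<Sum>w\<in>V. a w * of_nat (n w) * (W X * mon (n(w := n w - 1)) X)))"
    by (subst Bochner_Integration.integral_sum)
       (auto intro!: integrable_mult_right mon_has_integral simp: mon_has_integral simp del: fun_upd_apply)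
  also have "\<dots> = (LINT X|\<L>. W X * mon' n X * 1 + W X * mon n X * 0)"
    by (simp add: sum_distrib_left ac_simps)
  finally show "(LINT X|\<L>. W X * mon n X * (field X * 1))
      = (LINT X|\<L>. W X * mon' n X * 1 + W X * mon n X * 0)" .
qed

text \<open>The accumulated factor \<open>h\<close> turns the product case into two uses of the
  induction hypothesis: first \<open>f\<close> is absorbed into \<open>h\<close>, then
  \<open>g\<close>.\<close>

private lemma poly_deriv_ibp:
  assumes "poly_deriv V a f f'" "ibp h h'"
  shows "ibp (\<lambda>X. h X * f X) (\<lambda>X. h' X * f X + h X * f' X)"
  using assms
proof (induction arbitrary: h h')
  case (const z)
  note h = ibpD[OF const]
  show ?case
    unfolding ibp_def
  proof (intro allI conjI)
    fix n
    show "integrable (\<L>) (\<lambda>X. W X * mon n X * (h X * z))"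
      unfolding mult.assoc[symmetric] by (intro integrable_mult_left) (simp only: h mult.assoc[symmetric])
    have "integrable (\<L>) (\<lambda>X. W X * mon n X * h' X * z)"
      by (intro integrable_mult_left h)
    then show "integrable (\<L>) (\<lambda>X. W X * mon n X * (h' X * z + h X * 0))"
      by (simp add: mult.assoc)
    have "(LINT X|\<L>. W X * mon n X * (field X * (h X * z)))
        = (LINT X|\<L>. W X * mon n X * (field X * h X) * z)"
      by (simp only: mult.assoc)
    also have "\<dots> = (LINT X|\<L>. (W X * mon' n X * h X + W X * mon n X * h' X) * z)"
      by (simp only: integral_mult_left_zero h(3))
    finally show "(LINT X|\<L>. W X * mon n X * (field X * (h X * z)))
        = (LINT X|\<L>. W X * mon' n X * (h X * z) + W X * mon n X * (h' X * z + h X * 0))"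
      by (simp add: algebra_simps)
  qed
next
  case (coord v)
  note h = ibpD[OF coord(2)]
  have up: "W X * mon n X * (g X * of_real (X v)) = W X * mon (n(v := Suc (n v))) X * g X" for n X g
  proof -
    have "W X * mon n X * (g X * of_real (X v)) = W X * (mon n X * of_real (X v)) * g X"
      by (simp only: mult_ac)
    then show ?thesis by (simp only: mon_coord[OF coord(1)])
  qed
  have up2: "W X * mon n X * (field X * (h X * of_real (X v))) = W X * mon (n(v := Suc (n v))) X * (field X * h X)" for n X
    using up[of X n "\<lambda>X. field X * h X"] by (simp only: mult.assoc)
  show ?case
    unfolding ibp_def
  proof (intro allI conjI)
    fix n
    show "integrable (\<L>) (\<lambda>X. W X * mon n X * (h X * of_real (X v)))"
      unfolding up by (rule h)
    show "integrable (\<L>) (\<lambda>X. W X * mon n X * (h' X * of_real (X v) + h X * a v))"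
      unfolding distrib_left up mult.assoc[of "W _ * mon _ _" "h _" "a v", symmetric]
      by (intro Bochner_Integration.integrable_add integrable_mult_left h)
    show "(LINT X|\<L>. W X * mon n X * (field X * (h X * of_real (X v))))
        = (LINT X|\<L>. W X * mon' n X * (h X * of_real (X v)) +
            W X * mon n X * (h' X * of_real (X v) + h X * a v))"
      unfolding up2 h(3) mon'_coord[OF coord(1)] distrib_left up
      by (intro Bochner_Integration.integral_cong refl) (simp add: algebra_simps del: fun_upd_apply)
  qed
next
  case (add f f' g g')
  note 1 = ibpD[OF add.IH(1)[OF add.prems]]
  note 2 = ibpD[OF add.IH(2)[OF add.prems]]
  show ?case
    unfolding ibp_def
  proof (intro allI conjI)
    fix n
    show "integrable (\<L>) (\<lambda>X. W X * mon n X * (h X * (f X + g X)))"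
      unfolding distrib_left by (intro Bochner_Integration.integrable_add 1(1) 2(1))
    have "integrable (\<L>) (\<lambda>X. W X * mon n X * (h' X * f X + h X * f' X)
        + W X * mon n X * (h' X * g X + h X * g' X))"
      by (intro Bochner_Integration.integrable_add 1(2) 2(2))
    then show "integrable (\<L>) (\<lambda>X. W X * mon n X * (h' X * (f X + g X) + h X * (f' X + g' X)))"
      by (simp add: algebra_simps)
    have "(LINT X|\<L>. W X * mon n X * (field X * (h X * (f X + g X))))
        = (LINT X|\<L>. W X * mon n X * (field X * (h X * f X)) + W X * mon n X * (field X * (h X * g X)))"
      by (simp only: distrib_left)
    also have "\<dots> = (LINT X|\<L>. W X * mon' n X * (h X * f X) + W X * mon n X * (h' X * f X + h X * f' X))
        + (LINT X|\<L>. W X * mon' n X * (h X * g X) + W X * mon n X * (h' X * g X + h X * g' X))"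
      by (subst Bochner_Integration.integral_add)
         (intro field_integrable 1(1) 2(1) refl | simp only: 1(3) 2(3))+
    also have "\<dots> = (LINT X|\<L>. (W X * mon' n X * (h X * f X) + W X * mon n X * (h' X * f X + h X * f' X))
        + (W X * mon' n X * (h X * g X) + W X * mon n X * (h' X * g X + h X * g' X)))"
      by (intro Bochner_Integration.integral_add[symmetric] Bochner_Integration.integrable_add
          mon'_integrable 1 2)
    also have "\<dots> = (LINT X|\<L>. W X * mon' n X * (h X * (f X + g X)) +
            W X * mon n X * (h' X * (f X + g X) + h X * (f' X + g' X)))"
      by (simp only: distrib_left add_ac)
    finally show "(LINT X|\<L>. W X * mon n X * (field X * (h X * (f X + g X))))
        = (LINT X|\<L>. W X * mon' n X * (h X * (f X + g X)) +
            W X * mon n X * (h' X * (f X + g X) + h X * (f' X + g' X)))" .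
  qed
next
  case (mult f f' g g')
  have "ibp (\<lambda>X. h X * f X * g X) (\<lambda>X. (h' X * f X + h X * f' X) * g X + h X * f X * g' X)"
    by (intro mult.IH mult.prems)
  then show ?case by (simp add: algebra_simps)
qed

lemma gauss_integrable_poly:
  assumes "poly_deriv V a f f'"
  shows "integrable (lborel_coords V) (\<lambda>X. W X * f X)" "integrable (lborel_coords V) (\<lambda>X. W X * f' X)"
proof -
  have "ibp f f'" using poly_deriv_ibp[OF assms ibp_one] by simp
  from ibpD(1,2)[OF this, of "\<lambda>_. 0"] show "integrable (lborel_coords V) (\<lambda>X. W X * f X)" "integrable (lborel_coords V) (\<lambda>X. W X * f' X)"
    by simp_all
qed

lemma gauss_integration_by_parts:
  assumes "poly_deriv V a f f'"
  shows "(LINT X|lborel_coords V. W X * ((\<Sum>w\<in>V. a w / of_real (s w) * of_real (X w)) * f X))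
    = (LINT X|lborel_coords V. W X * f' X)"
proof -
  have "ibp f f'" using poly_deriv_ibp[OF assms ibp_one] by simp
  from ibpD(3)[OF this, of "\<lambda>_. 0"] show ?thesis by simp
qed

lemma gauss_density_integral_pos: "(LINT X|lborel_coords V. gauss_density V s X) > 0"
  using gauss_density_monomial(2)[OF V s, where n = "\<lambda>_. 0"] gauss_moment_0_pos s
  by (simp add: prod_pos)

end

section \<open>Integration by parts for traces\<close>

subsection \<open>Matrix powers\<close>

lemma mat_pow_add:
  assumes "finite S" "i \<in> S"
  shows "(\<Sum>k\<in>S. mat_pow S A m i k * mat_pow S A n k j) = mat_pow S A (m + n) i j"
  using assms(2)
proof (induction m arbitrary: i)
  case 0
  have "(\<Sum>k\<in>S. (if i = k then 1 else 0) * mat_pow S A n k j)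
      = (\<Sum>k\<in>S. if i = k then mat_pow S A n k j else 0)"
    by (rule sum.cong) auto
  then show ?case using 0 assms(1) by simp
next
  case (Suc m)
  have "(\<Sum>k\<in>S. mat_pow S A (Suc m) i k * mat_pow S A n k j)
      = (\<Sum>k\<in>S. \<Sum>l\<in>S. A i l * (mat_pow S A m l k * mat_pow S A n k j))"
    by (simp add: mat_mult_def sum_distrib_right mult.assoc)
  also have "\<dots> = (\<Sum>l\<in>S. A i l * (\<Sum>k\<in>S. mat_pow S A m l k * mat_pow S A n k j))"
    by (subst sum.swap) (simp add: sum_distrib_left)
  also have "\<dots> = mat_pow S A (Suc m + n) i j"
    by (simp add: mat_mult_def Suc.IH)
  finally show ?case .
qed

lemma mat_trace_pow_add:
  assumes "finite S"
  shows "(\<Sum>i\<in>S. \<Sum>j\<in>S. mat_pow S A m j i * mat_pow S A n i j) = mat_trace S (mat_pow S A (m + n))"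
  by (subst sum.swap) (simp add: mat_trace_def mat_pow_add[OF assms])

subsection \<open>The Gaussian weight\<close>

definition coord_set :: "nat \<Rightarrow> ('d::finite \<times> nat \<times> nat) set" where
  "coord_set N = UNIV \<times> {..<N} \<times> {..<N}"

text \<open>In tr M^2 the square of a diagonal coordinate occurs once and that of an off-diagonal
  one twice, so the weight exp (- N/2 tr M^2) gives these two variances.\<close>

definition coord_var :: "nat \<Rightarrow> 'd \<times> nat \<times> nat \<Rightarrow> real" where
  "coord_var N = (\<lambda>(c, i, j). if i = j then 1 / real N else 1 / (2 * real N))"

lemma finite_coord_set [simp]: "finite (coord_set N)"
  by (simp add: coord_set_def)

lemma coord_var_pos: "N > 0 \<Longrightarrow> coord_var N w > 0"
  by (auto simp: coord_var_def split: prod.split)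

lemma flat_measure_eq: "flat_measure N = lborel_coords (coord_set N)"
  by (simp add: flat_measure_def coord_set_def)

lemma gauss_weight_eq:
  assumes "N > 0"
  shows "gauss_weight N X = gauss_density (coord_set N) (coord_var N) X"
proof -
  define q where "q c i j = (if i = j then 1 else 2) * (X (c, i, j))\<^sup>2" for c i j
  \<comment> \<open>Halving the diagonal makes the squared modulus of the (i, j) entry equal to
    \<open>r c i j + r c j i\<close> in all cases, including \<open>i = j\<close>.\<close>
  define r where "r c i j = (if i = j then 1 / 2 else 1) * (X (c, i, j))\<^sup>2" for c i j
  have tr: "Re (mat_trace {..<N} (mat_pow {..<N} (herm X c) 2)) = (\<Sum>i<N. \<Sum>j<N. q c i j)" for c
  proof -
    have pow2: "mat_pow {..<N} (herm X c) 2 i i = (\<Sum>j<N. herm X c i j * herm X c j i)" if "i < N" for i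
    proof -
      have "mat_pow {..<N} (herm X c) 1 j i = herm X c j i" if "j < N" for j
      proof -
        have "(\<Sum>k<N. herm X c j k * (if k = i then 1 else 0)) = (\<Sum>k<N. if k = i then herm X c j k else 0)"
          by (rule sum.cong) auto
        then show ?thesis using \<open>i < N\<close> by (simp add: mat_mult_def)
      qed
      then show ?thesis by (simp add: numeral_2_eq_2 mat_mult_def)
    qed
    have "Re (mat_trace {..<N} (mat_pow {..<N} (herm X c) 2))
        = (\<Sum>i<N. \<Sum>j<N. Re (herm X c i j * herm X c j i))"
      by (simp add: mat_trace_def pow2)
    also have "\<dots> = (\<Sum>i<N. \<Sum>j<N. r c i j + r c j i)"
      by (intro sum.cong refl) (auto simp: herm_def r_def power2_eq_square)
    also have "\<dots> = (\<Sum>i<N. \<Sum>j<N. r c i j) + (\<Sum>i<N. \<Sum>j<N. r c j i)"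
      by (simp add: sum.distrib)
    also have "(\<Sum>i<N. \<Sum>j<N. r c j i) = (\<Sum>i<N. \<Sum>j<N. r c i j)"
      by (rule sum.swap)
    finally show ?thesis
      by (simp add: q_def r_def sum.distrib[symmetric] if_distrib[of "\<lambda>x. x * _"] cong: if_cong)
         (intro sum.cong refl, auto)
  qed
  have "gauss_weight N X = exp (\<Sum>c\<in>UNIV. \<Sum>i<N. \<Sum>j<N. - (real N / 2) * q c i j)"
    by (simp add: gauss_weight_def tr sum_distrib_left)
  also have "(\<Sum>c\<in>UNIV. \<Sum>i<N. \<Sum>j<N. - (real N / 2) * q c i j)
      = (\<Sum>(c, i, j)\<in>coord_set N. - (real N / 2) * q c i j)"
    by (simp add: coord_set_def sum.cartesian_product)
  also have "\<dots> = (\<Sum>w\<in>coord_set N. - (X w)\<^sup>2 / (2 * coord_var N w))"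
    by (rule sum.cong) (auto simp: q_def coord_var_def)
  finally show ?thesis by (simp add: gauss_density_def exp_sum)
qed

section \<open>Linearity and normalization of the Gaussian expectation\<close>

definition gauss_integrable :: "nat \<Rightarrow> (('d::finite) coords \<Rightarrow> complex) \<Rightarrow> bool" where
  "gauss_integrable N f \<longleftrightarrow>
     integrable (flat_measure N) (\<lambda>X. complex_of_real (gauss_weight N X) * f X)"

lemma gauss_expect_add:
  "gauss_integrable N f \<Longrightarrow> gauss_integrable N g \<Longrightarrow>
    gauss_expect N (\<lambda>X. f X + g X) = gauss_expect N f + gauss_expect N g"
  by (simp add: gauss_expect_def gauss_integrable_def distrib_left add_divide_distrib)

lemma gauss_expect_cmult: "gauss_expect N (\<lambda>X. z * f X) = z * gauss_expect N f"
proof -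
  have "gauss_expect N (\<lambda>X. z * f X) =
    (LINT X | flat_measure N. z * (complex_of_real (gauss_weight N X) * f X)) /
     complex_of_real (LINT X | (flat_measure N :: 'a coords measure). gauss_weight N X)"
    unfolding gauss_expect_def by (simp only: mult.left_commute)
  then show ?thesis by (simp add: gauss_expect_def)
qed

lemma gauss_integrable_add:
  "gauss_integrable N f \<Longrightarrow> gauss_integrable N g \<Longrightarrow> gauss_integrable N (\<lambda>X. f X + g X)"
  by (simp add: gauss_integrable_def distrib_left)

lemma gauss_integrable_sum:
  "(\<And>x. x \<in> A \<Longrightarrow> gauss_integrable N (f x)) \<Longrightarrow> gauss_integrable N (\<lambda>X. \<Sum>x\<in>A. f x X)"
  by (simp add: gauss_integrable_def sum_distrib_left)

lemma gauss_expect_sum: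
  "(\<And>x. x \<in> A \<Longrightarrow> gauss_integrable N (f x)) \<Longrightarrow>
    gauss_expect N (\<lambda>X. \<Sum>x\<in>A. f x X) = (\<Sum>x\<in>A. gauss_expect N (f x))"
  by (simp add: gauss_expect_def gauss_integrable_def sum_distrib_left
      Bochner_Integration.integral_sum sum_divide_distrib)

lemma gauss_expect_sum_sum:
  assumes "\<And>x y. x \<in> A \<Longrightarrow> y \<in> B \<Longrightarrow> gauss_integrable N (f x y)"
  shows "gauss_expect N (\<lambda>X. \<Sum>x\<in>A. \<Sum>y\<in>B. f x y X) = (\<Sum>x\<in>A. \<Sum>y\<in>B. gauss_expect N (f x y))"
  using assms by (subst gauss_expect_sum) (auto intro!: gauss_integrable_sum gauss_expect_sum sum.cong)

lemma gauss_expect_one: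
  assumes "N > 0"
  shows "gauss_expect N (\<lambda>X :: ('d::finite) coords. 1) = 1"
proof -
  have "(LINT X | (flat_measure N :: 'd coords measure). gauss_weight N X) > 0"
    unfolding gauss_weight_eq[OF assms] flat_measure_eq
    by (intro gauss_density_integral_pos finite_coord_set coord_var_pos assms)
  then show ?thesis
    by (simp add: gauss_expect_def integral_complex_of_real)
qed

subsection \<open>Derivatives with respect to matrix entries\<close>

text \<open>
  In the direction \<open>entry_dir N c i j\<close> the derivative is \<open>1 / N\<close> times the formal derivative with
  respect to the \<open>(j, i)\<close> entry of the matrix of color \<open>c\<close>, so that integration by parts
  against the \<open>(i, j)\<close> entry produces it.
\<close>

definition entry_dir :: "nat \<Rightarrow> 'd \<Rightarrow> nat \<Rightarrow> nat \<Rightarrow> 'd \<times> nat \<times> nat \<Rightarrow> complex" where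
  "entry_dir N c i j w =
     (if w = (c, i, j) then
        (if i = j then 1 / of_nat N else if i < j then 1 / (2 * of_nat N) else - \<i> / (2 * of_nat N))
      else if w = (c, j, i) then (if i < j then \<i> / (2 * of_nat N) else 1 / (2 * of_nat N))
      else 0)"

abbreviation "entry_deriv N c i j \<equiv> poly_deriv (coord_set N) (entry_dir N c i j)"

text \<open>Each component of the direction is the variance of a coordinate times its coefficient in
  the (i, j) entry; dividing by the variance recovers the entry.\<close>

lemma entry_dir_field:
  assumes "i < N" "j < N"
  shows "(\<Sum>w\<in>coord_set N. entry_dir N c i j w / of_real (coord_var N w) * of_real (X w)) = herm X c i j"
proof -
  have "(\<Sum>w\<in>coord_set N. entry_dir N c i j w / of_real (coord_var N w) * of_real (X w))
      = (\<Sum>w\<in>{(c, i, j), (c, j, i)}. entry_dir N c i j w / of_real (coord_var N w) * of_real (X w))"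
    using assms by (intro sum.mono_neutral_right) (auto simp: entry_dir_def coord_set_def)
  also have "\<dots> = herm X c i j"
    using assms by (cases i j rule: linorder_cases)
      (auto simp: entry_dir_def coord_var_def herm_def Complex_eq)
  finally show ?thesis .
qed

text \<open>This encodes the propagator: the entries (i, j) and (k, l) are contracted with weight
  1/N exactly if k = j and l = i. For i \<noteq> j the derivative of the (i, j) entry itself
  vanishes because the contributions of its real and imaginary part cancel.\<close>

lemma entry_deriv_herm:
  assumes "i < N" "j < N" "k < N" "l < N"
  shows "entry_deriv N c i j (\<lambda>X. herm X c' k l)
    (\<lambda>X. if c' = c \<and> k = j \<and> l = i then 1 / of_nat N else 0)"
proof -
  have coord: "entry_deriv N c i j (\<lambda>X. of_real (X (c', m, n))) (\<lambda>X. entry_dir N c i j (c', m, n))"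
    if "m < N" "n < N" for m n
    using that by (intro poly_deriv.coord) (simp add: coord_set_def)
  show ?thesis
  proof (cases k l rule: linorder_cases)
    case less
    have "entry_deriv N c i j (\<lambda>X. of_real (X (c', k, l)) + \<i> * of_real (X (c', l, k)))
        (\<lambda>X. entry_dir N c i j (c', k, l) + \<i> * entry_dir N c i j (c', l, k))"
      using assms by (intro poly_deriv.add poly_deriv_cmult coord)
    then show ?thesis
      using less by (auto simp: herm_def Complex_eq entry_dir_def split: if_splits)
  next
    case equal
    then show ?thesis
      using coord[of k k] assms by (auto simp: herm_def entry_dir_def split: if_splits)
  next
    case greater
    have "entry_deriv N c i j (\<lambda>X. of_real (X (c', l, k)) + (- \<i>) * of_real (X (c', k, l)))
        (\<lambda>X. entry_dir N c i j (c', l, k) + (- \<i>) * entry_dir N c i j (c', k, l))"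
      using assms by (intro poly_deriv.add poly_deriv_cmult coord)
    then show ?thesis
      using greater by (auto simp: herm_def Complex_eq entry_dir_def split: if_splits)
  qed
qed

abbreviation "herm_pow N X c n \<equiv> mat_pow {..<N} (herm X c) n"

lemma entry_deriv_herm_pow:
  assumes "i < N" "j < N" "k < N" "l < N"
  shows "entry_deriv N c i j (\<lambda>X. herm_pow N X c' n k l)
    (\<lambda>X. if c' = c then (\<Sum>p<n. herm_pow N X c p k j * herm_pow N X c (n - 1 - p) i l) / of_nat N else 0)"
  using assms(3)
proof (induction n arbitrary: k)
  case 0
  then show ?case
    using poly_deriv.const[of "coord_set N" "entry_dir N c i j" 1]
      poly_deriv.const[of "coord_set N" "entry_dir N c i j" 0] by (cases "k = l") (simp_all cong: if_cong)
next
  case (Suc n)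
  have "entry_deriv N c i j (\<lambda>X. \<Sum>m<N. herm X c' k m * herm_pow N X c' n m l)
    (\<lambda>X. \<Sum>m<N. (if c' = c \<and> k = j \<and> m = i then 1 / of_nat N else 0) * herm_pow N X c' n m l +
      herm X c' k m * (if c' = c then (\<Sum>p<n. herm_pow N X c p m j * herm_pow N X c (n - 1 - p) i l) / of_nat N else 0))"
    using assms Suc.prems by (intro poly_deriv_sum poly_deriv.mult entry_deriv_herm Suc.IH) auto
  also have "(\<lambda>X. \<Sum>m<N. (if c' = c \<and> k = j \<and> m = i then 1 / of_nat N else 0) * herm_pow N X c' n m l +
      herm X c' k m * (if c' = c then (\<Sum>p<n. herm_pow N X c p m j * herm_pow N X c (n - 1 - p) i l) / of_nat N else 0))
    = (\<lambda>X. if c' = c then (\<Sum>p<Suc n. herm_pow N X c p k j * herm_pow N X c (Suc n - 1 - p) i l) / of_nat N else 0)"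
  proof
    fix X :: "'a coords"
    have "(\<Sum>m<N. (if k = j \<and> m = i then 1 / of_nat N else 0) * herm_pow N X c n m l)
        = (\<Sum>m<N. if m = i then (if k = j then herm_pow N X c n m l / of_nat N else 0) else 0)"
      by (rule sum.cong) auto
    also have "\<dots> = (if k = j then 1 else 0) * herm_pow N X c n i l / of_nat N"
      using assms by simp
    finally have 1: "(\<Sum>m<N. (if k = j \<and> m = i then 1 / of_nat N else 0) * herm_pow N X c n m l)
      = (if k = j then 1 else 0) * herm_pow N X c n i l / of_nat N" .
    have "(\<Sum>m<N. herm X c k m * ((\<Sum>p<n. herm_pow N X c p m j * herm_pow N X c (n - 1 - p) i l) / of_nat N))
        = (\<Sum>m<N. \<Sum>p<n. herm X c k m * herm_pow N X c p m j * herm_pow N X c (n - 1 - p) i l / of_nat N)"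
      by (simp add: sum_divide_distrib sum_distrib_left mult.assoc)
    also have "\<dots> = (\<Sum>p<n. herm_pow N X c (Suc p) k j * herm_pow N X c (n - 1 - p) i l / of_nat N)"
      by (subst sum.swap) (simp add: mat_mult_def sum_distrib_right sum_divide_distrib)
    finally have 2: "(\<Sum>m<N. herm X c k m * ((\<Sum>p<n. herm_pow N X c p m j * herm_pow N X c (n - 1 - p) i l) / of_nat N))
        = (\<Sum>p<n. herm_pow N X c (Suc p) k j * herm_pow N X c (n - 1 - p) i l / of_nat N)" .
    show "(\<Sum>m<N. (if c' = c \<and> k = j \<and> m = i then 1 / of_nat N else 0) * herm_pow N X c' n m l +
      herm X c' k m * (if c' = c then (\<Sum>p<n. herm_pow N X c p m j * herm_pow N X c (n - 1 - p) i l) / of_nat N else 0))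
    = (if c' = c then (\<Sum>p<Suc n. herm_pow N X c p k j * herm_pow N X c (Suc n - 1 - p) i l) / of_nat N else 0)"
    proof (cases "c' = c")
      case True
      have "(\<Sum>p<Suc n. herm_pow N X c p k j * herm_pow N X c (Suc n - 1 - p) i l) / of_nat N
          = (if k = j then 1 else 0) * herm_pow N X c n i l / of_nat N +
            (\<Sum>p<n. herm_pow N X c (Suc p) k j * herm_pow N X c (n - 1 - p) i l / of_nat N)"
        unfolding sum.lessThan_Suc_shift
        by (simp add: add_divide_distrib sum_divide_distrib del: mat_pow.simps(2))
      then show ?thesis
        using True 1 2 by (simp add: sum.distrib del: mat_pow.simps(2) sum.lessThan_Suc)
    qed simp
  qed
  finally show ?case by (simp add: mat_mult_def)
qed

lemma entry_deriv_trace_power: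
  assumes "i < N" "j < N"
  shows "entry_deriv N c i j (trace_power N (c', n))
    (\<lambda>X. if c' = c then of_nat n / of_nat N * herm_pow N X c (n - 1) i j else 0)"
proof -
  have "entry_deriv N c i j (\<lambda>X. \<Sum>k<N. herm_pow N X c' n k k)
    (\<lambda>X. \<Sum>k<N. if c' = c then (\<Sum>p<n. herm_pow N X c p k j * herm_pow N X c (n - 1 - p) i k) / of_nat N else 0)"
    using assms by (intro poly_deriv_sum entry_deriv_herm_pow) auto
  also have "(\<lambda>X. \<Sum>k<N. if c' = c then (\<Sum>p<n. herm_pow N X c p k j * herm_pow N X c (n - 1 - p) i k) / of_nat N else 0)
    = (\<lambda>X. if c' = c then of_nat n / of_nat N * herm_pow N X c (n - 1) i j else 0)"
  proof
    fix X :: "'a coords"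
    have "(\<Sum>k<N. (\<Sum>p<n. herm_pow N X c p k j * herm_pow N X c (n - 1 - p) i k))
        = (\<Sum>p<n. \<Sum>k<N. herm_pow N X c (n - 1 - p) i k * herm_pow N X c p k j)"
      by (subst sum.swap) (simp add: mult.commute)
    also have "\<dots> = (\<Sum>p<n. herm_pow N X c (n - 1) i j)"
      using assms by (intro sum.cong refl) (simp add: mat_pow_add)
    finally show "(\<Sum>k<N. if c' = c then (\<Sum>p<n. herm_pow N X c p k j * herm_pow N X c (n - 1 - p) i k) / of_nat N else 0)
      = (if c' = c then of_nat n / of_nat N * herm_pow N X c (n - 1) i j else 0)"
      by (simp add: sum_divide_distrib[symmetric])
  qed
  finally show ?thesis
    by (simp add: trace_power_def mat_trace_def)
qed

lemma entry_integration_by_parts: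
  assumes "i < N" "j < N" "entry_deriv N c i j f f'"
  shows "gauss_expect N (\<lambda>X. herm X c i j * f X) = gauss_expect N f'"
proof -
  have N: "N > 0" using assms by simp
  show ?thesis
    unfolding gauss_expect_def flat_measure_eq gauss_weight_eq[OF N]
    using gauss_integration_by_parts[where s = "coord_var N", OF finite_coord_set coord_var_pos[OF N] assms(3)]
    by (simp only: entry_dir_field[OF assms(1,2)])
qed

lemma entry_deriv_integrable:
  assumes "N > 0" "entry_deriv N c i j f f'"
  shows "gauss_integrable N f" "gauss_integrable N f'"
  unfolding gauss_integrable_def flat_measure_eq gauss_weight_eq[OF assms(1)]
  using gauss_integrable_poly[where s = "coord_var N", OF finite_coord_set coord_var_pos[OF assms(1)] assms(2)] by auto

subsection \<open>The loop derivation\<close>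

definition ntrace :: "nat \<Rightarrow> 'd \<times> nat \<Rightarrow> ('d::finite) coords \<Rightarrow> complex" where
  "ntrace N v X = trace_power N v X / of_nat N"

lemma ntrace_0: "N > 0 \<Longrightarrow> ntrace N (c, 0) X = 1"
  by (simp add: ntrace_def trace_power_def mat_trace_def)

text \<open>
  \<open>loop_deriv N c k f g\<close>: \<open>g\<close> is the derivative of \<open>f\<close> along the vector field \<open>M ^ k\<close> in the
  matrix \<open>M\<close> of color \<open>c\<close>; the factor \<open>N\<close> cancels the \<open>1 / N\<close> contained in \<open>entry_deriv\<close>.
\<close>

definition loop_deriv :: "nat \<Rightarrow> 'd \<Rightarrow> nat \<Rightarrow> (('d::finite) coords \<Rightarrow> complex) \<Rightarrow> ('d coords \<Rightarrow> complex) \<Rightarrow> bool" where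
  "loop_deriv N c k f g \<longleftrightarrow> (\<exists>f'.
     (\<forall>i<N. \<forall>j<N. entry_deriv N c i j f (f' i j)) \<and>
     g = (\<lambda>X. of_nat N * (\<Sum>i<N. \<Sum>j<N. herm_pow N X c k j i * f' i j X)))"

lemma loop_deriv_const: "loop_deriv N c k (\<lambda>X. z) (\<lambda>X. 0)"
  unfolding loop_deriv_def by (rule exI[of _ "\<lambda>_ _ _. 0"]) (auto intro: poly_deriv.const)

lemma loop_deriv_add:
  assumes "loop_deriv N c k f f'" "loop_deriv N c k g g'"
  shows "loop_deriv N c k (\<lambda>X. f X + g X) (\<lambda>X. f' X + g' X)"
proof -
  obtain F where F: "\<forall>i<N. \<forall>j<N. entry_deriv N c i j f (F i j)"
    "f' = (\<lambda>X. of_nat N * (\<Sum>i<N. \<Sum>j<N. herm_pow N X c k j i * F i j X))"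
    using assms(1) unfolding loop_deriv_def by blast
  obtain G where G: "\<forall>i<N. \<forall>j<N. entry_deriv N c i j g (G i j)"
    "g' = (\<lambda>X. of_nat N * (\<Sum>i<N. \<Sum>j<N. herm_pow N X c k j i * G i j X))"
    using assms(2) unfolding loop_deriv_def by blast
  show ?thesis
    unfolding loop_deriv_def
    by (rule exI[of _ "\<lambda>i j X. F i j X + G i j X"])
       (use F G in \<open>auto intro!: poly_deriv.add simp: fun_eq_iff distrib_left sum.distrib\<close>)
qed

lemma loop_deriv_mult:
  assumes "loop_deriv N c k f f'" "loop_deriv N c k g g'"
  shows "loop_deriv N c k (\<lambda>X. f X * g X) (\<lambda>X. f' X * g X + f X * g' X)"
proof -
  obtain F where F: "\<forall>i<N. \<forall>j<N. entry_deriv N c i j f (F i j)"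
    "f' = (\<lambda>X. of_nat N * (\<Sum>i<N. \<Sum>j<N. herm_pow N X c k j i * F i j X))"
    using assms(1) unfolding loop_deriv_def by blast
  obtain G where G: "\<forall>i<N. \<forall>j<N. entry_deriv N c i j g (G i j)"
    "g' = (\<lambda>X. of_nat N * (\<Sum>i<N. \<Sum>j<N. herm_pow N X c k j i * G i j X))"
    using assms(2) unfolding loop_deriv_def by blast
  have "\<forall>i<N. \<forall>j<N. entry_deriv N c i j (\<lambda>X. f X * g X) (\<lambda>X. F i j X * g X + f X * G i j X)"
    using F G by (auto intro!: poly_deriv.mult)
  moreover have "f' X * g X + f X * g' X
      = of_nat N * (\<Sum>i<N. \<Sum>j<N. herm_pow N X c k j i * (F i j X * g X + f X * G i j X))" for X
    unfolding F(2) G(2) distrib_left sum.distrib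
    by (simp add: sum_distrib_left sum_distrib_right ac_simps)
  ultimately show ?thesis
    unfolding loop_deriv_def by (intro exI[of _ "\<lambda>i j X. F i j X * g X + f X * G i j X"] conjI ext)
qed

lemma loop_deriv_sum:
  "(\<And>x. x \<in> A \<Longrightarrow> loop_deriv N c k (f x) (f' x)) \<Longrightarrow>
    loop_deriv N c k (\<lambda>X. \<Sum>x\<in>A. f x X) (\<lambda>X. \<Sum>x\<in>A. f' x X)"
  by (induction A rule: infinite_finite_induct)
     (auto intro: loop_deriv_const loop_deriv_add)

lemma loop_deriv_cmult:
  "loop_deriv N c k f f' \<Longrightarrow> loop_deriv N c k (\<lambda>X. z * f X) (\<lambda>X. z * f' X)"
  using loop_deriv_mult[OF loop_deriv_const[of N c k z]] by simp

text \<open>By cyclicity every position of the differentiated factor gives the same trace, hence the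
  factor \<open>of_nat l\<close>. The exponent \<open>k + l - 1\<close> is truncated only for
  \<open>k = l = 0\<close>, where that factor is zero.\<close>

lemma loop_deriv_ntrace:
  assumes "N > 0"
  shows "loop_deriv N c k (ntrace N (c', l))
    (\<lambda>X. if c' = c then of_nat l * ntrace N (c, k + l - 1) X else 0)"
proof -
  define D :: "nat \<Rightarrow> nat \<Rightarrow> 'a coords \<Rightarrow> complex" where
    "D i j X = (if c' = c then of_nat l / of_nat N * herm_pow N X c (l - 1) i j else 0)" for i j X
  have D: "entry_deriv N c i j (ntrace N (c', l)) (\<lambda>X. 1 / of_nat N * D i j X)" if "i < N" "j < N" for i j
    using poly_deriv_cmult[OF entry_deriv_trace_power[OF that, of c c' l], of "1 / of_nat N"]
    by (simp add: ntrace_def[abs_def] D_def)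
  have "(if c' = c then of_nat l * ntrace N (c, k + l - 1) X else 0)
      = of_nat N * (\<Sum>i<N. \<Sum>j<N. herm_pow N X c k j i * (1 / of_nat N * D i j X))" for X
  proof (cases "c' = c \<and> l > 0")
    case True
    have "of_nat N * (\<Sum>i<N. \<Sum>j<N. herm_pow N X c k j i * (1 / of_nat N * D i j X))
        = of_nat l / of_nat N * (\<Sum>i<N. \<Sum>j<N. herm_pow N X c k j i * herm_pow N X c (l - 1) i j)"
      using True assms by (simp add: D_def sum_distrib_left ac_simps)
    also have "\<dots> = of_nat l / of_nat N * mat_trace {..<N} (herm_pow N X c (k + (l - 1)))"
      by (simp add: mat_trace_pow_add)
    finally show ?thesis using True by (simp add: ntrace_def trace_power_def)
  qed (auto simp: D_def)
  then show ?thesis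
    unfolding loop_deriv_def
    by (intro exI[of _ "\<lambda>i j X. 1 / of_nat N * D i j X"] conjI ext allI impI) (rule D)
qed

lemma loop_deriv_integrable: "loop_deriv N c k f g \<Longrightarrow> N > 0 \<Longrightarrow> gauss_integrable N f"
  unfolding loop_deriv_def using entry_deriv_integrable(1) by blast

lemma trace_power_Suc:
  "trace_power N (c, Suc k) X = (\<Sum>i<N. \<Sum>j<N. herm X c i j * herm_pow N X c k j i)"
  by (simp add: trace_power_def mat_trace_def mat_mult_def)

text \<open>One factor of M^(k+1) is integrated by parts against the remaining M^k and
  \<open>f\<close>. A derivative hitting M^k cuts the trace into two, which has order one after
  normalization; a derivative hitting \<open>f\<close> costs 1/N^2. The integrability claims serve
  to split expectations of sums later.\<close>

lemma gauss_loop_equation: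
  assumes N: "N > 0" and f: "loop_deriv N c k f g"
  shows "gauss_integrable N (\<lambda>X. ntrace N (c, p) X * ntrace N (c, q) X * f X)"
    and "gauss_integrable N g"
    and "gauss_expect N (\<lambda>X. ntrace N (c, Suc k) X * f X)
      = (\<Sum>p<k. gauss_expect N (\<lambda>X. ntrace N (c, p) X * ntrace N (c, k - 1 - p) X * f X))
        + 1 / (of_nat N)\<^sup>2 * gauss_expect N g"
proof -
  obtain F where F: "\<And>i j. i < N \<Longrightarrow> j < N \<Longrightarrow> entry_deriv N c i j f (F i j)"
    and g: "g = (\<lambda>X. of_nat N * (\<Sum>i<N. \<Sum>j<N. herm_pow N X c k j i * F i j X))"
    using f unfolding loop_deriv_def by blast
  define P where "P i j X = (\<Sum>p<k. herm_pow N X c p j j * herm_pow N X c (k - 1 - p) i i) / of_nat N"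
    for i j and X :: "'a coords"
  have prod: "entry_deriv N c i j (\<lambda>X. herm_pow N X c k j i * f X)
      (\<lambda>X. P i j X * f X + herm_pow N X c k j i * F i j X)" if "i < N" "j < N" for i j
    unfolding P_def
    using poly_deriv.mult[OF entry_deriv_herm_pow[OF that that(2,1), of c c k] F[OF that]] by simp
  have int_sum: "gauss_integrable N (\<lambda>X. P i j X * f X + herm_pow N X c k j i * F i j X)"
    if "i < N" "j < N" for i j
    using entry_deriv_integrable(2)[OF N prod[OF that]] .
  have cdiv: "loop_deriv N c k (\<lambda>X. ntrace N (c, p) X * ntrace N (c, q) X * f X)
    (\<lambda>X. ((if c = c then of_nat p * ntrace N (c, k + p - 1) X else 0) * ntrace N (c, q) X +
          ntrace N (c, p) X * (if c = c then of_nat q * ntrace N (c, k + q - 1) X else 0)) * f X +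
          ntrace N (c, p) X * ntrace N (c, q) X * g X)" for p q
    by (intro loop_deriv_mult loop_deriv_ntrace N f)
  show int_tr: "gauss_integrable N (\<lambda>X. ntrace N (c, p) X * ntrace N (c, q) X * f X)" for p q
    using loop_deriv_integrable[OF cdiv N] .
  define T where "T X = of_nat N * (\<Sum>p<k. ntrace N (c, p) X * ntrace N (c, k - 1 - p) X * f X)"
    for X :: "'a coords"
  have int_T: "gauss_integrable N (\<lambda>X. (- 1) * T X)"
    unfolding T_def gauss_integrable_def
    using gauss_integrable_sum[of "{..<k}" N "\<lambda>p X. ntrace N (c, p) X * ntrace N (c, k - 1 - p) X * f X"] int_tr
    unfolding gauss_integrable_def by (simp add: mult.left_commute[of "complex_of_real _"])
  have sum_eq: "(\<Sum>i<N. \<Sum>j<N. P i j X * f X + herm_pow N X c k j i * F i j X)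
      = T X + 1 / of_nat N * g X" for X
  proof -
    have "(\<Sum>i<N. \<Sum>j<N. P i j X) = (\<Sum>p<k. \<Sum>i<N. \<Sum>j<N. herm_pow N X c p j j * herm_pow N X c (k - 1 - p) i i / of_nat N)"
      unfolding P_def sum_divide_distrib by (subst sum.swap[of _ _ "{..<k}"], subst sum.swap[of _ _ "{..<k}"]) simp
    also have "\<dots> = (\<Sum>p<k. mat_trace {..<N} (herm_pow N X c p) * mat_trace {..<N} (herm_pow N X c (k - 1 - p)) / of_nat N)"
      unfolding mat_trace_def sum_product
      by (subst sum.swap[of _ "{..<N}" "{..<N}"]) (simp add: sum_divide_distrib)
    also have "\<dots> = of_nat N * (\<Sum>p<k. ntrace N (c, p) X * ntrace N (c, k - 1 - p) X)"
      using N by (simp add: ntrace_def trace_power_def sum_distrib_left)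
    finally show ?thesis
      using N by (simp add: T_def g sum.distrib sum_distrib_right[symmetric])
  qed
  \<comment> \<open>Integration by parts only yields integrability of the complete derivative; that
    of \<open>g\<close> follows by subtracting the part made of traces.\<close>
  have int_S: "gauss_integrable N (\<lambda>X. T X + 1 / of_nat N * g X)"
    unfolding sum_eq[symmetric] using int_sum by (intro gauss_integrable_sum) auto
  have "gauss_integrable N (\<lambda>X. (T X + 1 / of_nat N * g X) + (- 1) * T X)"
    by (rule gauss_integrable_add[OF int_S int_T])
  then have int_g': "gauss_integrable N (\<lambda>X. 1 / of_nat N * g X)" by simp
  then show int_g: "gauss_integrable N g"
    using integrable_mult_right[of "of_nat N" "flat_measure N" "\<lambda>X. complex_of_real (gauss_weight N X) * (1 / of_nat N * g X)"] N
    by (simp add: gauss_integrable_def)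
  have "of_nat N * gauss_expect N (\<lambda>X. ntrace N (c, Suc k) X * f X)
      = gauss_expect N (\<lambda>X. \<Sum>i<N. \<Sum>j<N. herm X c i j * (herm_pow N X c k j i * f X))"
    unfolding gauss_expect_cmult[symmetric] using N
    by (simp add: ntrace_def trace_power_Suc sum_distrib_right mult.assoc)
  also have "\<dots> = (\<Sum>i<N. \<Sum>j<N. gauss_expect N (\<lambda>X. herm X c i j * (herm_pow N X c k j i * f X)))"
  proof -
    have *: "gauss_integrable N (\<lambda>X. herm X c i j * (herm_pow N X c k j i * f X))" if "i < N" "j < N" for i j
      using entry_deriv_integrable(1)[OF N poly_deriv.mult[OF entry_deriv_herm[OF that that, of c c] prod[OF that]]] .
    show ?thesis
      by (intro gauss_expect_sum_sum *) auto
  qed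
  also have "\<dots> = (\<Sum>i<N. \<Sum>j<N. gauss_expect N (\<lambda>X. P i j X * f X + herm_pow N X c k j i * F i j X))"
    by (intro sum.cong refl entry_integration_by_parts prod) auto
  also have "\<dots> = gauss_expect N (\<lambda>X. \<Sum>i<N. \<Sum>j<N. P i j X * f X + herm_pow N X c k j i * F i j X)"
    by (intro gauss_expect_sum_sum[symmetric] int_sum) auto
  also have "\<dots> = gauss_expect N (\<lambda>X. T X + 1 / of_nat N * g X)"
    by (simp only: sum_eq)
  also have "\<dots> = gauss_expect N T + 1 / of_nat N * gauss_expect N g"
  proof -
    have "gauss_integrable N (\<lambda>X. T X)"
      using int_T by (simp add: gauss_integrable_def)
    then show ?thesis using int_g' by (simp only: gauss_expect_add gauss_expect_cmult)
  qed
  also have "gauss_expect N T = of_nat N * (\<Sum>p<k. gauss_expect N (\<lambda>X. ntrace N (c, p) X * ntrace N (c, k - 1 - p) X * f X))"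
    unfolding T_def gauss_expect_cmult by (subst gauss_expect_sum) (auto intro: int_tr)
  finally show "gauss_expect N (\<lambda>X. ntrace N (c, Suc k) X * f X)
      = (\<Sum>p<k. gauss_expect N (\<lambda>X. ntrace N (c, p) X * ntrace N (c, k - 1 - p) X * f X))
        + 1 / (of_nat N)\<^sup>2 * gauss_expect N g"
    using N by (simp add: field_simps power2_eq_square)
qed

section \<open>The interaction\<close>

abbreviation multinomial :: "('d::finite \<Rightarrow> nat) \<Rightarrow> complex" where
  "multinomial u \<equiv> fact (tdeg u) / (\<Prod>v\<in>UNIV. fact (u v))"

text \<open>Pascal's rule for multinomial coefficients: words in the colors are sorted by their
  first letter.\<close>

lemma sum_multinomial:
  assumes "tdeg u = Suc p"
  shows "(\<Sum>c\<in>UNIV. if u c = 0 then 0 else multinomial (u(c := u c - 1))) = multinomial (u :: 'd::finite \<Rightarrow> nat)"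
proof -
  have "(if u c = 0 then 0 else multinomial (u(c := u c - 1)))
      = fact p / (\<Prod>v\<in>UNIV. fact (u v)) * of_nat (u c)" for c
  proof (cases "u c")
    case (Suc n)
    have "tdeg (u(c := u c - 1)) = p"
      using tdeg_fun_upd[of u c] Suc assms by simp
    moreover have "(\<Prod>v\<in>UNIV - {c}. fact ((u(c := u c - 1)) v) :: complex) = (\<Prod>v\<in>UNIV - {c}. fact (u v))"
      by (rule prod.cong) auto
    moreover have "(\<Prod>v\<in>UNIV. fact (u v) :: complex) = of_nat (Suc n) * fact n * (\<Prod>v\<in>UNIV - {c}. fact (u v))"
      using Suc by (simp add: prod.remove[of UNIV c])
    moreover have "(\<Prod>v\<in>UNIV. fact ((u(c := u c - 1)) v) :: complex)
        = fact n * (\<Prod>v\<in>UNIV - {c}. fact ((u(c := u c - 1)) v))"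
      using Suc by (simp add: prod.remove[of UNIV c])
    ultimately show ?thesis
      using Suc by (simp del: of_nat_Suc fun_upd_apply)
  qed simp
  then have "(\<Sum>c\<in>UNIV. if u c = 0 then 0 else multinomial (u(c := u c - 1)))
      = fact p / (\<Prod>v\<in>UNIV. fact (u v)) * of_nat (tdeg u)"
    by (simp add: sum_distrib_left)
  then show ?thesis by (simp add: assms del: of_nat_Suc)
qed

text \<open>Embedded matrices of different colors act on different tensor factors and commute, so
  every word with \<open>u b\<close> letters of each color \<open>b\<close> has these
  entries.\<close>

definition tensor_power ::
    "nat \<Rightarrow> ('d::finite \<Rightarrow> nat \<Rightarrow> nat \<Rightarrow> complex) \<Rightarrow> ('d \<Rightarrow> nat) \<Rightarrow> ('d \<Rightarrow> nat) \<Rightarrow> ('d \<Rightarrow> nat) \<Rightarrow> complex" where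
  "tensor_power N M u I J = (\<Prod>b\<in>UNIV. mat_pow {..<N} (M b) (u b) (I b) (J b))"

lemma sum_tensor_index:
  "(\<Sum>I\<in>tensor_index N. \<Prod>b\<in>UNIV. f b (I b)) = (\<Prod>b\<in>UNIV. \<Sum>k<N. f b k)"
  for f :: "'d::finite \<Rightarrow> nat \<Rightarrow> complex"
  unfolding tensor_index_def by (rule prod_sum_PiE[symmetric]) auto

lemma tensor_embed_mult_power:
  assumes "I \<in> tensor_index N" "u c \<noteq> 0"
  shows "(\<Sum>K\<in>tensor_index N. tensor_embed c (M c) I K * tensor_power N M (u(c := u c - 1)) K J)
    = tensor_power N M u I J"
proof -
  have "(\<Sum>K\<in>tensor_index N. tensor_embed c (M c) I K * tensor_power N M (u(c := u c - 1)) K J)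
    = (\<Sum>K\<in>tensor_index N. \<Prod>b\<in>UNIV. (if b = c then M c (I b) (K b) else if I b = K b then 1 else 0) *
        mat_pow {..<N} (M b) ((u(c := u c - 1)) b) (K b) (J b))"
    by (simp add: tensor_embed_def tensor_power_def prod.distrib del: fun_upd_apply)
  also have "\<dots> = (\<Prod>b\<in>UNIV. \<Sum>k<N. (if b = c then M c (I b) k else if I b = k then 1 else 0) *
        mat_pow {..<N} (M b) ((u(c := u c - 1)) b) k (J b))"
    by (rule sum_tensor_index)
  also have "\<dots> = tensor_power N M u I J"
    unfolding tensor_power_def
  proof (rule prod.cong[OF refl])
    fix b
    have Ib: "I b < N" using assms(1) by (auto simp: tensor_index_def PiE_def)
    show "(\<Sum>k<N. (if b = c then M c (I b) k else if I b = k then 1 else 0) *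
        mat_pow {..<N} (M b) ((u(c := u c - 1)) b) k (J b)) = mat_pow {..<N} (M b) (u b) (I b) (J b)"
    proof (cases "b = c")
      case True
      then have "mat_pow {..<N} (M b) (u b) = mat_mult {..<N} (M c) (mat_pow {..<N} (M c) (u c - 1))"
        using assms(2) by (cases "u c") auto
      then show ?thesis using True by (simp add: mat_mult_def)
    next
      case False
      then have "(\<Sum>k<N. (if b = c then M c (I b) k else if I b = k then 1 else 0) *
        mat_pow {..<N} (M b) ((u(c := u c - 1)) b) k (J b))
        = (\<Sum>k<N. if I b = k then mat_pow {..<N} (M b) (u b) k (J b) else 0)"
        by (intro sum.cong) auto
      then show ?thesis using Ib by simp
    qed
  qed
  finally show ?thesis .
qed

text \<open>The multinomial theorem for the commuting embedded matrices, proved by peeling off the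
  first letter of a word.\<close>

lemma mps_coeff_mat_pow_tensor:
  fixes M :: "'d::finite \<Rightarrow> nat \<Rightarrow> nat \<Rightarrow> complex"
  defines "A \<equiv> \<lambda>I J. \<Sum>c\<in>UNIV. mps_var c * mps_const (tensor_embed c (M c) I J)"
  assumes "I \<in> tensor_index N" "J \<in> tensor_index N"
  shows "mps_coeff (mat_pow (tensor_index N) A p I J) u
    = (if tdeg u = p then multinomial u * tensor_power N M u I J else 0)"
  using assms(2)
proof (induction p arbitrary: I u)
  case 0
  have "(\<Prod>b\<in>UNIV. if I b = J b then 1 else 0 :: complex) = (if I = J then 1 else 0)"
    by (cases "I = J") (auto simp: fun_eq_iff)
  then show ?case
    by (auto simp: mps_coeff_one tdeg_eq_0_iff tensor_power_def)
next
  case (Suc p)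
  have fin: "finite (tensor_index N :: ('d \<Rightarrow> nat) set)"
    by (auto simp: tensor_index_def intro!: finite_PiE)
  have "mps_coeff (mat_pow (tensor_index N) A (Suc p) I J) u
      = (\<Sum>K\<in>tensor_index N. \<Sum>c\<in>UNIV.
          mps_coeff (mps_var c * (mps_const (tensor_embed c (M c) I K) * mat_pow (tensor_index N) A p K J)) u)"
    by (simp add: mat_mult_def A_def sum_distrib_right mult.assoc)
  also have "\<dots> = (\<Sum>K\<in>tensor_index N. \<Sum>c\<in>UNIV.
      if u c = 0 then 0 else tensor_embed c (M c) I K *
        (if tdeg (u(c := u c - 1)) = p then multinomial (u(c := u c - 1)) *
          tensor_power N M (u(c := u c - 1)) K J else 0))"
    by (intro sum.cong refl) (simp add: mps_coeff_var_mult Suc.IH del: fun_upd_apply)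
  also have "\<dots> = (\<Sum>c\<in>UNIV. if u c = 0 then 0 else if tdeg u = Suc p then
      multinomial (u(c := u c - 1)) * (\<Sum>K\<in>tensor_index N. tensor_embed c (M c) I K *
          tensor_power N M (u(c := u c - 1)) K J) else 0)"
  proof (subst sum.swap, rule sum.cong[OF refl])
    fix c
    have "tdeg (u(c := u c - 1)) = p \<longleftrightarrow> tdeg u = Suc p" if "u c \<noteq> 0"
      using tdeg_fun_upd[of u c] that by auto
    then show "(\<Sum>K\<in>tensor_index N. if u c = 0 then 0 else tensor_embed c (M c) I K *
        (if tdeg (u(c := u c - 1)) = p then multinomial (u(c := u c - 1)) *
          tensor_power N M (u(c := u c - 1)) K J else 0))
        = (if u c = 0 then 0 else if tdeg u = Suc p then
      multinomial (u(c := u c - 1)) * (\<Sum>K\<in>tensor_index N. tensor_embed c (M c) I K *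
          tensor_power N M (u(c := u c - 1)) K J) else 0)"
      by (simp add: sum_distrib_left mult.left_commute del: fun_upd_apply)
  qed
  also have "\<dots> = (\<Sum>c\<in>UNIV. if tdeg u = Suc p then
      (if u c = 0 then 0 else multinomial (u(c := u c - 1))) * tensor_power N M u I J else 0)"
    by (intro sum.cong refl) (simp add: tensor_embed_mult_power[OF Suc.prems] del: fun_upd_apply One_nat_def)
  also have "\<dots> = (if tdeg u = Suc p then multinomial u * tensor_power N M u I J else 0)"
    using sum_multinomial[of u p] by (simp add: sum_distrib_right[symmetric] del: fun_upd_apply)
  finally show ?case .
qed

text \<open>
  The weight of \<open>N\<^sup>2 \<Prod>b. ntrace N (b, u b)\<close> in the interaction.  For three or more colors all
  weights of total degree above \<open>2\<close> vanish as \<open>N \<rightarrow> \<infinity>\<close>.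
\<close>

definition coupling :: "nat \<Rightarrow> ('d::finite \<Rightarrow> nat) \<Rightarrow> complex" where
  "coupling N u = (if tdeg u < 2 then 0 else
     of_real (real N powr ((2 - real CARD('d)) / 2 * (real (tdeg u) - 2))) *
     fact (tdeg u - 1) / (\<Prod>v\<in>UNIV. fact (u v)))"

text \<open>Power counting: the trace over the tensor product is a product of d traces and
  contributes N^d. With the prefactor N^((2-d)p/2) this is N^2 times a power of N whose exponent is
  proportional to p - 2. The division by p turns the p! of the multinomial coefficient into (p -
  1)!.\<close>

lemma coeff_interaction:
  fixes X :: "('d::finite) coords"
  assumes "N > 0"
  shows "mps_coeff (interaction N X) u
    = (of_nat N)\<^sup>2 * coupling N u * (\<Prod>b\<in>UNIV. ntrace N (b, u b) X)"
proof -
  define z where "z p = complex_of_real (real N powr ((2 - real CARD('d)) / 2 * real p) / real p)" for p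
  define A :: "('d \<Rightarrow> nat) \<Rightarrow> ('d \<Rightarrow> nat) \<Rightarrow> ('d, complex) mps" where
    "A = (\<lambda>I J. \<Sum>c\<in>UNIV. mps_var c * mps_const (tensor_embed c (herm X c) I J))"
  have "mps_coeff (interaction N X) u
      = (\<Sum>I\<in>tensor_index N. \<Sum>n\<le>tdeg u. if n < 2 then 0 else z n * mps_coeff (mat_pow (tensor_index N) A n I I) u)"
    unfolding interaction_def mat_trace_def mps_coeff_sum mps_sum_def mps_coeff_Mps
    by (intro sum.cong refl) (auto simp: z_def A_def)
  also have "\<dots> = (\<Sum>I\<in>tensor_index N. if tdeg u < 2 then 0 else z (tdeg u) * (multinomial u * tensor_power N (herm X) u I I))"
  proof (rule sum.cong[OF refl])
    fix I :: "'d \<Rightarrow> nat" assume I: "I \<in> tensor_index N"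
    have "(\<Sum>n\<le>tdeg u. if n < 2 then 0 else z n * mps_coeff (mat_pow (tensor_index N) A n I I) u)
        = (\<Sum>n\<le>tdeg u. if n = tdeg u then if tdeg u < 2 then 0 else
             z (tdeg u) * (multinomial u * tensor_power N (herm X) u I I) else 0)"
      unfolding A_def by (intro sum.cong refl) (auto simp: mps_coeff_mat_pow_tensor[OF I I])
    then show "(\<Sum>n\<le>tdeg u. if n < 2 then 0 else z n * mps_coeff (mat_pow (tensor_index N) A n I I) u)
        = (if tdeg u < 2 then 0 else z (tdeg u) * (multinomial u * tensor_power N (herm X) u I I))"
      by simp
  qed
  also have "\<dots> = (if tdeg u < 2 then 0 else z (tdeg u) * multinomial u * (\<Prod>b\<in>UNIV. trace_power N (b, u b) X))"
  proof -
    have "(\<Sum>I\<in>tensor_index N. tensor_power N (herm X) u I I) = (\<Prod>b\<in>UNIV. trace_power N (b, u b) X)"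
      unfolding tensor_power_def trace_power_def mat_trace_def
      by (simp add: sum_tensor_index[where f = "\<lambda>b k. mat_pow {..<N} (herm X b) (u b) k k"])
    moreover have "(\<Sum>I\<in>tensor_index N. y * (m * tensor_power N (herm X) u I I))
        = y * m * (\<Sum>I\<in>tensor_index N. tensor_power N (herm X) u I I)" for y m
      by (simp only: mult.assoc sum_distrib_left)
    ultimately show ?thesis by (cases "tdeg u < 2") (simp_all only: if_True if_False sum.neutral_const)
  qed
  also have "\<dots> = (of_nat N)\<^sup>2 * coupling N u * (\<Prod>b\<in>UNIV. ntrace N (b, u b) X)"
  proof (cases "tdeg u < 2")
    case False
    define p where "p = tdeg u"
    have tr: "(\<Prod>b\<in>UNIV. trace_power N (b, u b) X) = of_nat N ^ CARD('d) * (\<Prod>b\<in>UNIV. ntrace N (b, u b) X)"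
      using assms by (simp add: ntrace_def prod_dividef)
    have "real N powr ((2 - real CARD('d)) / 2 * real p) * real N ^ CARD('d)
        = real N powr ((2 - real CARD('d)) / 2 * real p + real CARD('d))"
      using assms by (simp add: powr_add powr_realpow)
    also have "(2 - real CARD('d)) / 2 * real p + real CARD('d) = 2 + (2 - real CARD('d)) / 2 * (real p - 2)"
      by (simp add: field_simps)
    also have "real N powr \<dots> = (real N)\<^sup>2 * real N powr ((2 - real CARD('d)) / 2 * (real p - 2))"
      using assms by (simp add: powr_add)
    finally have "complex_of_real (real N powr ((2 - real CARD('d)) / 2 * real p) * real N ^ CARD('d))
        = complex_of_real ((real N)\<^sup>2 * real N powr ((2 - real CARD('d)) / 2 * (real p - 2)))"
      by (rule arg_cong)
    then have N: "complex_of_real (real N powr ((2 - real CARD('d)) / 2 * real p)) * of_nat N ^ CARD('d)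
        = (of_nat N)\<^sup>2 * of_real (real N powr ((2 - real CARD('d)) / 2 * (real p - 2)))"
      by (simp only: of_real_mult of_real_power of_real_of_nat_eq)
    have "p > 0" using False unfolding p_def[symmetric] by (rule contrapos_np) simp
    then have "fact p = of_nat p * (fact (p - 1) :: complex)"
      by (rule fact_reduce)
    then have fct: "complex_of_real (1 / real p) * fact p = fact (p - 1)"
      using \<open>p > 0\<close> by simp
    have zp: "z p = complex_of_real (real N powr ((2 - real CARD('d)) / 2 * real p)) * complex_of_real (1 / real p)"
      unfolding z_def of_real_mult[symmetric] by simp
    have "z p * multinomial u * (of_nat N ^ CARD('d) * (\<Prod>b\<in>UNIV. ntrace N (b, u b) X))
        = (complex_of_real (real N powr ((2 - real CARD('d)) / 2 * real p)) * of_nat N ^ CARD('d)) *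
          (complex_of_real (1 / real p) * fact p) / (\<Prod>v\<in>UNIV. fact (u v)) * (\<Prod>b\<in>UNIV. ntrace N (b, u b) X)"
      unfolding zp p_def[symmetric]
      by (simp only: times_divide_eq_left times_divide_eq_right mult_ac)
    also have "\<dots> = (of_nat N)\<^sup>2 * coupling N u * (\<Prod>b\<in>UNIV. ntrace N (b, u b) X)"
      unfolding N fct coupling_def p_def[symmetric] using False
      by (simp only: p_def[symmetric] if_False times_divide_eq_left times_divide_eq_right mult_ac)
    finally show ?thesis
      unfolding tr p_def[symmetric] using False by (simp only: p_def[symmetric] if_False)
  qed (simp add: coupling_def)
  finally show ?thesis .
qed

lemma coeff_interaction_0: "N > 0 \<Longrightarrow> mps_coeff (interaction N X) (\<lambda>_. 0) = 0"
  by (simp add: coeff_interaction coupling_def)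

text \<open>With at least three colors the exponent (2-d)/2 (p-2) is negative for p > 2. With two
  colors it would vanish and couplings of every degree would survive.\<close>

lemma coupling_tendsto:
  assumes "CARD('d) \<ge> 3"
  shows "(\<lambda>N. coupling N (u :: 'd::finite \<Rightarrow> nat)) \<longlonglongrightarrow>
    (if tdeg u = 2 then 1 / (\<Prod>v\<in>UNIV. fact (u v)) else 0)"
proof -
  consider "tdeg u < 2" | "tdeg u = 2" | "tdeg u > 2" by (rule linorder_cases)
  then show ?thesis
  proof cases
    case 1
    then show ?thesis by (simp add: coupling_def)
  next
    case 2
    have "\<forall>\<^sub>F N in sequentially. coupling N u = 1 / (\<Prod>v\<in>UNIV. fact (u v))"
      using eventually_gt_at_top[of 0] by eventually_elim (simp add: coupling_def 2)
    then show ?thesis using 2 by (simp add: tendsto_eventually)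
  next
    case 3
    define r where "r = (2 - real CARD('d)) / 2 * (real (tdeg u) - 2)"
    define K :: complex where "K = fact (tdeg u - 1) / (\<Prod>v\<in>UNIV. fact (u v))"
    have "real (tdeg u) > 2" using 3 by (simp only: of_nat_less_iff[symmetric] of_nat_numeral)
    moreover have "real CARD('d) > 2" using assms by simp
    ultimately have "r < 0" unfolding r_def by (intro mult_neg_pos) (simp_all only: diff_gt_0_iff_gt divide_neg_pos diff_less_0_iff_less zero_less_numeral)
    then have "(\<lambda>N. real N powr r) \<longlonglongrightarrow> 0"
      by (rule tendsto_neg_powr[OF _ filterlim_real_sequentially])
    then have "(\<lambda>N. of_real (real N powr r) * K) \<longlonglongrightarrow> of_real 0 * K"
      by (intro tendsto_mult tendsto_of_real tendsto_const)
    moreover have "coupling N u = of_real (real N powr r) * K" for N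
    proof -
      have "\<not> tdeg u < 2" using 3 by (simp only: not_less less_imp_le)
      then show ?thesis unfolding coupling_def r_def K_def by (simp only: if_False times_divide_eq_right)
    qed
    ultimately show ?thesis using 3 by (simp only: of_real_0 mult_zero_left less_not_refl2 if_False)
  qed
qed

section \<open>Loop equations of the interacting model\<close>

subsection \<open>The loop derivation on power series\<close>

definition mps_loop_deriv ::
    "nat \<Rightarrow> 'd \<Rightarrow> nat \<Rightarrow> (('d::finite) coords \<Rightarrow> ('d, complex) mps) \<Rightarrow> ('d coords \<Rightarrow> ('d, complex) mps) \<Rightarrow> bool" where
  "mps_loop_deriv N c k F G \<longleftrightarrow>
     (\<forall>e. loop_deriv N c k (\<lambda>X. mps_coeff (F X) e) (\<lambda>X. mps_coeff (G X) e))"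

lemma mps_loop_deriv_const: "mps_loop_deriv N c k (\<lambda>X. h) (\<lambda>X. 0)"
  by (simp add: mps_loop_deriv_def loop_deriv_const)

lemma mps_loop_deriv_scalar:
  assumes "loop_deriv N c k f g"
  shows "mps_loop_deriv N c k (\<lambda>X. mps_const (f X)) (\<lambda>X. mps_const (g X))"
  unfolding mps_loop_deriv_def
proof
  fix e :: "'a \<Rightarrow> nat"
  show "loop_deriv N c k (\<lambda>X. mps_coeff (mps_const (f X)) e) (\<lambda>X. mps_coeff (mps_const (g X)) e)"
    by (cases "e = (\<lambda>_. 0)") (simp_all add: mps_coeff_const assms loop_deriv_const)
qed

lemma mps_loop_deriv_mult:
  assumes "mps_loop_deriv N c k F F'" "mps_loop_deriv N c k G G'"
  shows "mps_loop_deriv N c k (\<lambda>X. F X * G X) (\<lambda>X. F' X * G X + F X * G' X)"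
  unfolding mps_loop_deriv_def
proof
  fix e :: "'a \<Rightarrow> nat"
  have "loop_deriv N c k (\<lambda>X. \<Sum>a\<in>{..e}. mps_coeff (F X) a * mps_coeff (G X) (\<lambda>v. e v - a v))
    (\<lambda>X. \<Sum>a\<in>{..e}. mps_coeff (F' X) a * mps_coeff (G X) (\<lambda>v. e v - a v) +
      mps_coeff (F X) a * mps_coeff (G' X) (\<lambda>v. e v - a v))"
    using assms by (intro loop_deriv_sum loop_deriv_mult) (auto simp: mps_loop_deriv_def)
  then show "loop_deriv N c k (\<lambda>X. mps_coeff (F X * G X) e) (\<lambda>X. mps_coeff (F' X * G X + F X * G' X) e)"
    by (simp add: mps_coeff_mult sum.distrib)
qed

lemma mps_loop_deriv_sum:
  "(\<And>x. x \<in> A \<Longrightarrow> mps_loop_deriv N c k (F x) (F' x)) \<Longrightarrow>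
    mps_loop_deriv N c k (\<lambda>X. \<Sum>x\<in>A. F x X) (\<lambda>X. \<Sum>x\<in>A. F' x X)"
  by (simp add: mps_loop_deriv_def loop_deriv_sum)

lemma mps_loop_deriv_power:
  assumes "mps_loop_deriv N c k F F'"
  shows "mps_loop_deriv N c k (\<lambda>X. F X ^ n) (\<lambda>X. of_nat n * F X ^ (n - 1) * F' X)"
proof (induction n)
  case 0
  show ?case using mps_loop_deriv_const[of N c k 1] by simp
next
  case (Suc n)
  have "F' X * F X ^ n + F X * (of_nat n * F X ^ (n - 1) * F' X) = of_nat (Suc n) * F X ^ (Suc n - 1) * F' X" for X
    by (cases n) (simp_all add: algebra_simps)
  then show ?case
    using mps_loop_deriv_mult[OF assms Suc.IH] by simp
qed

lemma mps_loop_deriv_exp: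
  assumes F: "mps_loop_deriv N c k F F'" and F0: "\<And>X. mps_coeff (F X) (\<lambda>_. 0) = 0"
  shows "mps_loop_deriv N c k (\<lambda>X. mps_exp (F X)) (\<lambda>X. F' X * mps_exp (F X))"
  unfolding mps_loop_deriv_def
proof
  fix e :: "'a \<Rightarrow> nat"
  define M where "M = tdeg e"
  \<comment> \<open>Differentiation removes one power of \<open>F X\<close>, so the partial sum is
    taken one order further than the coefficient at \<open>e\<close> requires.\<close>
  have "mps_loop_deriv N c k (\<lambda>X. \<Sum>n\<le>Suc M. mps_const (1 / fact n) * F X ^ n)
      (\<lambda>X. \<Sum>n\<le>Suc M. 0 * F X ^ n + mps_const (1 / fact n) * (of_nat n * F X ^ (n - 1) * F' X))"
    by (intro mps_loop_deriv_sum mps_loop_deriv_mult mps_loop_deriv_const mps_loop_deriv_power F)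
  then have "loop_deriv N c k (\<lambda>X. mps_coeff (\<Sum>n\<le>Suc M. mps_const (1 / fact n) * F X ^ n) e)
      (\<lambda>X. mps_coeff (\<Sum>n\<le>Suc M. 0 * F X ^ n + mps_const (1 / fact n) * (of_nat n * F X ^ (n - 1) * F' X)) e)"
    unfolding mps_loop_deriv_def by blast
  also have "(\<lambda>X. mps_coeff (\<Sum>n\<le>Suc M. mps_const (1 / fact n) * F X ^ n) e) = (\<lambda>X. mps_coeff (mps_exp (F X)) e)"
    using mps_coeff_exp[OF F0, of e "Suc M"] by (simp add: M_def)
  also have "(\<lambda>X. mps_coeff (\<Sum>n\<le>Suc M. 0 * F X ^ n + mps_const (1 / fact n) * (of_nat n * F X ^ (n - 1) * F' X)) e)
      = (\<lambda>X. mps_coeff (F' X * mps_exp (F X)) e)"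
  proof
    fix X
    have step: "mps_const (1 / fact (Suc n)) * (of_nat (Suc n) * F X ^ n * F' X)
        = F' X * (mps_const (1 / fact n) * F X ^ n)" for n
    proof -
      have "mps_const (1 / fact (Suc n)) * of_nat (Suc n) = (mps_const (1 / fact n) :: ('a, complex) mps)"
        unfolding mps_const_of_nat[symmetric] mps_const_mult[symmetric]
        by (simp add: field_simps del: of_nat_Suc)
      then have "mps_const (1 / fact (Suc n)) * of_nat (Suc n) * (F X ^ n * F' X) = mps_const (1 / fact n) * (F X ^ n * F' X)"
        by (simp only:)
      then show ?thesis by (simp only: mult_ac)
    qed
    have "(\<Sum>n\<le>Suc M. 0 * F X ^ n + mps_const (1 / fact n) * (of_nat n * F X ^ (n - 1) * F' X))
        = (\<Sum>n\<le>M. mps_const (1 / fact (Suc n)) * (of_nat (Suc n) * F X ^ n * F' X))"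
      by (subst sum.atMost_Suc_shift) simp
    also have "\<dots> = F' X * (\<Sum>n\<le>M. mps_const (1 / fact n) * F X ^ n)"
      by (simp only: step sum_distrib_left)
    finally show "mps_coeff (\<Sum>n\<le>Suc M. 0 * F X ^ n + mps_const (1 / fact n) * (of_nat n * F X ^ (n - 1) * F' X)) e
        = mps_coeff (F' X * mps_exp (F X)) e"
      by (simp only:) (intro mps_coeff_mult_cong refl mps_coeff_exp[symmetric] F0,
          simp add: M_def tdeg_mono)
  qed
  finally show "loop_deriv N c k (\<lambda>X. mps_coeff (mps_exp (F X)) e) (\<lambda>X. mps_coeff (F' X * mps_exp (F X)) e)" .
qed

subsection \<open>Products of traces\<close>

text \<open>The Leibniz rule for a product over a multiset in recursive form. It serves the
  derivative of a product of traces as well as the planar covariance.\<close>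

lemma sum_mset_add_mset_remove:
  fixes d x :: "'b \<Rightarrow> 'a::comm_ring_1"
  shows "(\<Sum>v\<in>#add_mset u L. d v * (\<Prod>w\<in>#add_mset u L - {#v#}. x w))
    = d u * (\<Prod>w\<in>#L. x w) + x u * (\<Sum>v\<in>#L. d v * (\<Prod>w\<in>#L - {#v#}. x w))"
proof -
  have "(\<Sum>v\<in>#L. d v * (\<Prod>w\<in>#add_mset u L - {#v#}. x w))
      = (\<Sum>v\<in>#L. x u * (d v * (\<Prod>w\<in>#L - {#v#}. x w)))"
    by (intro arg_cong[where f = sum_mset] image_mset_cong)
       (auto simp: mult.left_commute dest!: multi_member_split)
  then show ?thesis by (simp add: sum_mset_distrib_left)
qed

definition trace_prod :: "nat \<Rightarrow> ('d \<times> nat) multiset \<Rightarrow> ('d::finite) coords \<Rightarrow> complex" where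
  "trace_prod N L X = (\<Prod>v\<in>#L. ntrace N v X)"

lemma trace_prod_empty [simp]: "trace_prod N {#} X = 1"
  and trace_prod_add_mset [simp]: "trace_prod N (add_mset v L) X = ntrace N v X * trace_prod N L X"
  and trace_prod_union: "trace_prod N (L + L') X = trace_prod N L X * trace_prod N L' X"
  by (simp_all add: trace_prod_def)

lemma loop_deriv_trace_prod:
  assumes "N > 0"
  shows "loop_deriv N c k (trace_prod N L)
    (\<lambda>X. \<Sum>v\<in>#L. (if fst v = c then of_nat (snd v) else 0) *
       trace_prod N (add_mset (c, k + snd v - 1) (L - {#v#})) X)"
proof -
  have "loop_deriv N c k (trace_prod N L)
    (\<lambda>X. \<Sum>v\<in>#L. (if fst v = c then of_nat (snd v) * ntrace N (c, k + snd v - 1) X else 0) *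
       (\<Prod>w\<in>#L - {#v#}. ntrace N w X))"
  proof (induction L)
    case empty
    show ?case using loop_deriv_const[of N c k 1] by (simp add: trace_prod_def[abs_def])
  next
    case (add u L)
    obtain b l where u: "u = (b, l)" by (cases u)
    have "loop_deriv N c k (\<lambda>X. ntrace N u X * trace_prod N L X)
      (\<lambda>X. (if fst u = c then of_nat (snd u) * ntrace N (c, k + snd u - 1) X else 0) * trace_prod N L X +
        ntrace N u X * (\<Sum>v\<in>#L. (if fst v = c then of_nat (snd v) * ntrace N (c, k + snd v - 1) X else 0) *
       (\<Prod>w\<in>#L - {#v#}. ntrace N w X)))"
      using loop_deriv_ntrace[OF assms, of c k b l] by (intro loop_deriv_mult add.IH) (simp add: u cong: if_cong)
    then show ?case
      unfolding sum_mset_add_mset_remove by (simp add: trace_prod_def[abs_def])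
  qed
  also have "(\<lambda>X. \<Sum>v\<in>#L. (if fst v = c then of_nat (snd v) * ntrace N (c, k + snd v - 1) X else 0) *
       (\<Prod>w\<in>#L - {#v#}. ntrace N w X))
    = (\<lambda>X. \<Sum>v\<in>#L. (if fst v = c then of_nat (snd v) else 0) *
       trace_prod N (add_mset (c, k + snd v - 1) (L - {#v#})) X)"
    by (intro ext arg_cong[where f = sum_mset] image_mset_cong) (simp add: trace_prod_def)
  finally show ?thesis .
qed

text \<open>The traces in the derivative of the monomial \<open>\<Prod>b. ntrace N (b, u b)\<close> of the interaction.\<close>

definition deriv_mset :: "'d::finite \<Rightarrow> nat \<Rightarrow> ('d \<Rightarrow> nat) \<Rightarrow> ('d \<times> nat) multiset" where
  "deriv_mset c k u = add_mset (c, k + u c - 1) (image_mset (\<lambda>b. (b, u b)) (mset_set (UNIV - {c})))"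

definition interaction_deriv :: "nat \<Rightarrow> 'd \<Rightarrow> nat \<Rightarrow> ('d::finite) coords \<Rightarrow> ('d, complex) mps" where
  "interaction_deriv N c k X =
     Mps (\<lambda>u. (of_nat N)\<^sup>2 * (coupling N u * of_nat (u c)) * trace_prod N (deriv_mset c k u) X)"

lemma mps_loop_deriv_interaction:
  assumes "N > 0"
  shows "mps_loop_deriv N c k (interaction N) (interaction_deriv N c k)"
  unfolding mps_loop_deriv_def
proof
  fix u :: "'a \<Rightarrow> nat"
  have zero: "loop_deriv N c k (\<lambda>X. \<Prod>b\<in>B. ntrace N (b, u b) X) (\<lambda>X. 0)" if "c \<notin> B" for B
    using that
  proof (induction B rule: infinite_finite_induct)
    case (insert b B)
    then have "loop_deriv N c k (\<lambda>X. ntrace N (b, u b) X * (\<Prod>b\<in>B. ntrace N (b, u b) X))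
      (\<lambda>X. (if b = c then of_nat (u b) * ntrace N (c, k + u b - 1) X else 0) * (\<Prod>b\<in>B. ntrace N (b, u b) X) +
        ntrace N (b, u b) X * 0)"
      by (intro loop_deriv_mult loop_deriv_ntrace assms) auto
    moreover have "b \<noteq> c" using insert.prems by auto
    ultimately show ?case using insert.hyps by simp
  qed (auto intro: loop_deriv_const)
  have "loop_deriv N c k (\<lambda>X. (of_nat N)\<^sup>2 * coupling N u *
      (ntrace N (c, u c) X * (\<Prod>b\<in>UNIV - {c}. ntrace N (b, u b) X)))
    (\<lambda>X. (of_nat N)\<^sup>2 * coupling N u *
      ((if c = c then of_nat (u c) * ntrace N (c, k + u c - 1) X else 0) * (\<Prod>b\<in>UNIV - {c}. ntrace N (b, u b) X) +
        ntrace N (c, u c) X * 0))"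
    by (intro loop_deriv_cmult loop_deriv_mult loop_deriv_ntrace assms zero) simp
  moreover have "(\<Prod>b\<in>UNIV - {c}. ntrace N (b, u b) X)
      = trace_prod N (image_mset (\<lambda>b. (b, u b)) (mset_set (UNIV - {c}))) X" for X
    by (simp add: trace_prod_def image_mset.compositionality o_def prod_unfold_prod_mset)
  ultimately show "loop_deriv N c k (\<lambda>X. mps_coeff (interaction N X) u)
      (\<lambda>X. mps_coeff (interaction_deriv N c k X) u)"
    by (simp add: coeff_interaction[OF assms] prod.remove[of UNIV c] interaction_deriv_def
        deriv_mset_def mult.assoc)
qed

subsection \<open>Loop equations\<close>

definition weighted_trace_prod :: "nat \<Rightarrow> ('d \<times> nat) multiset \<Rightarrow> ('d::finite) coords \<Rightarrow> ('d, complex) mps" where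
  "weighted_trace_prod N L X = mps_const (trace_prod N L X) * mps_exp (interaction N X)"

lemma weighted_trace_prod_ntrace:
  "ntrace N v X * mps_coeff (weighted_trace_prod N L X) e = mps_coeff (weighted_trace_prod N (add_mset v L) X) e"
  by (simp add: weighted_trace_prod_def)

lemma mps_loop_deriv_weighted_trace_prod:
  assumes "N > 0"
  shows "mps_loop_deriv N c k (weighted_trace_prod N L)
    (\<lambda>X. mps_const (\<Sum>v\<in>#L. (if fst v = c then of_nat (snd v) else 0) *
       trace_prod N (add_mset (c, k + snd v - 1) (L - {#v#})) X) * mps_exp (interaction N X) +
      mps_const (trace_prod N L X) * (interaction_deriv N c k X * mps_exp (interaction N X)))"
  unfolding weighted_trace_prod_def[abs_def]
  by (intro mps_loop_deriv_mult mps_loop_deriv_scalar loop_deriv_trace_prod mps_loop_deriv_exp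
      mps_loop_deriv_interaction coeff_interaction_0 assms)

lemma gauss_integrable_weighted_trace_prod:
  "N > 0 \<Longrightarrow> gauss_integrable N (\<lambda>X. mps_coeff (weighted_trace_prod N L X) e)"
  using mps_loop_deriv_weighted_trace_prod[of N undefined 0 L]
  unfolding mps_loop_deriv_def by (blast intro: loop_deriv_integrable)

definition gauss_trace_prod :: "nat \<Rightarrow> ('d \<times> nat) multiset \<Rightarrow> ('d::finite, complex) mps" where
  "gauss_trace_prod N L = gauss_expect_mps N (weighted_trace_prod N L)"

lemma coeff_gauss_trace_prod:
  "mps_coeff (gauss_trace_prod N L) e = gauss_expect N (\<lambda>X. mps_coeff (weighted_trace_prod N L X) e)"
  by (simp add: gauss_trace_prod_def gauss_expect_mps_def)

lemma gauss_integrable_cmult: "gauss_integrable N f \<Longrightarrow> gauss_integrable N (\<lambda>X. z * f X)"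
  unfolding gauss_integrable_def mult.left_commute[of _ z] by (rule integrable_mult_right)

lemma mps_coeff_sum_mset: "mps_coeff (\<Sum>x\<in>#M. F x) e = (\<Sum>x\<in>#M. mps_coeff (F x) e)"
  by (induction M) auto

lemma gauss_expect_sum_mset:
  assumes "\<And>x. gauss_integrable N (f x)"
  shows "gauss_integrable N (\<lambda>X. \<Sum>x\<in>#M. f x X)"
    and "gauss_expect N (\<lambda>X. \<Sum>x\<in>#M. f x X) = (\<Sum>x\<in>#M. gauss_expect N (f x))"
proof -
  have "gauss_integrable N (\<lambda>X. \<Sum>x\<in>#M. f x X) \<and>
      gauss_expect N (\<lambda>X. \<Sum>x\<in>#M. f x X) = (\<Sum>x\<in>#M. gauss_expect N (f x))"
  proof (induction M)
    case empty
    then show ?case by (simp add: gauss_integrable_def gauss_expect_def)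
  next
    case (add x M)
    then show ?case using assms by (simp add: gauss_integrable_add gauss_expect_add)
  qed
  then show "gauss_integrable N (\<lambda>X. \<Sum>x\<in>#M. f x X)"
    and "gauss_expect N (\<lambda>X. \<Sum>x\<in>#M. f x X) = (\<Sum>x\<in>#M. gauss_expect N (f x))" by auto
qed

text \<open>Differentiating the weight brings down the derivative of the interaction, whose N^2
  cancels the 1/N^2 of the variation. Couplings thus act at order one, while contractions with the
  other traces in \<open>L\<close> keep the factor 1/N^2.\<close>

lemma gauss_trace_prod_loop_equation:
  assumes N: "N > 0"
  shows "gauss_trace_prod N (add_mset (c, Suc k) L)
    = (\<Sum>p<k. gauss_trace_prod N (add_mset (c, p) (add_mset (c, k - 1 - p) L)))
    + mps_shift (\<lambda>u. coupling N u * of_nat (u c)) (\<lambda>u. gauss_trace_prod N (deriv_mset c k u + L))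
    + mps_const (1 / (of_nat N)\<^sup>2) * (\<Sum>v\<in>#L. mps_const (if fst v = c then of_nat (snd v) else 0) *
        gauss_trace_prod N (add_mset (c, k + snd v - 1) (L - {#v#})))"
proof (rule mps_eqI)
  fix e :: "'a \<Rightarrow> nat"
  define f where "f X = mps_coeff (weighted_trace_prod N L X) e" for X
  define T1 where "T1 X = (\<Sum>v\<in>#L. (if fst v = c then of_nat (snd v) else 0) *
      mps_coeff (weighted_trace_prod N (add_mset (c, k + snd v - 1) (L - {#v#})) X) e)" for X
  define T2 where "T2 X = (\<Sum>u\<in>{..e}. (of_nat N)\<^sup>2 * (coupling N u * of_nat (u c)) *
      mps_coeff (weighted_trace_prod N (deriv_mset c k u + L) X) (\<lambda>v. e v - u v))" for X
  have "loop_deriv N c k f (\<lambda>X. T1 X + T2 X)"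
  proof -
    have "mps_coeff (mps_const (\<Sum>v\<in>#L. (if fst v = c then of_nat (snd v) else 0) *
       trace_prod N (add_mset (c, k + snd v - 1) (L - {#v#})) X) * mps_exp (interaction N X)) e = T1 X" for X
      by (simp add: T1_def weighted_trace_prod_def sum_mset_distrib_right mult.assoc)
    moreover have "mps_coeff (mps_const (trace_prod N L X) * (interaction_deriv N c k X * mps_exp (interaction N X))) e = T2 X" for X
      unfolding T2_def weighted_trace_prod_def mps_coeff_const_mult mps_coeff_mult[of "interaction_deriv N c k X"]
      unfolding interaction_deriv_def mps_coeff_Mps trace_prod_union sum_distrib_left
      by (simp only: mult_ac)
    moreover note mps_loop_deriv_weighted_trace_prod[OF N, of c k L, unfolded mps_loop_deriv_def, THEN spec, of e]
    ultimately show ?thesis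
      unfolding f_def[abs_def] by (simp only: mps_coeff_add)
  qed
  note loop = gauss_loop_equation[OF N this]
  have int1: "gauss_integrable N T1"
    unfolding T1_def by (intro gauss_expect_sum_mset gauss_integrable_cmult gauss_integrable_weighted_trace_prod N)
  have int2: "gauss_integrable N T2"
    unfolding T2_def by (intro gauss_integrable_sum gauss_integrable_cmult gauss_integrable_weighted_trace_prod N)
  have "mps_coeff (gauss_trace_prod N (add_mset (c, Suc k) L)) e = gauss_expect N (\<lambda>X. ntrace N (c, Suc k) X * f X)"
    by (simp add: coeff_gauss_trace_prod f_def weighted_trace_prod_ntrace)
  also have "\<dots> = (\<Sum>p<k. gauss_expect N (\<lambda>X. ntrace N (c, p) X * ntrace N (c, k - 1 - p) X * f X))
        + 1 / (of_nat N)\<^sup>2 * gauss_expect N (\<lambda>X. T1 X + T2 X)"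
    by (rule loop(3))
  also have "(\<Sum>p<k. gauss_expect N (\<lambda>X. ntrace N (c, p) X * ntrace N (c, k - 1 - p) X * f X))
      = mps_coeff (\<Sum>p<k. gauss_trace_prod N (add_mset (c, p) (add_mset (c, k - 1 - p) L))) e"
    by (simp only: mps_coeff_sum coeff_gauss_trace_prod f_def mult.assoc weighted_trace_prod_ntrace)
  also have "gauss_expect N (\<lambda>X. T1 X + T2 X) = gauss_expect N T1 + gauss_expect N T2"
    by (rule gauss_expect_add[OF int1 int2])
  also have "gauss_expect N T1 = mps_coeff (\<Sum>v\<in>#L. mps_const (if fst v = c then of_nat (snd v) else 0) *
        gauss_trace_prod N (add_mset (c, k + snd v - 1) (L - {#v#}))) e"
    unfolding T1_def mps_coeff_sum_mset mps_coeff_const_mult coeff_gauss_trace_prod gauss_expect_cmult[symmetric]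
    by (intro gauss_expect_sum_mset gauss_integrable_cmult gauss_integrable_weighted_trace_prod N)
  also have "gauss_expect N T2 = (of_nat N)\<^sup>2 *
      mps_coeff (mps_shift (\<lambda>u. coupling N u * of_nat (u c)) (\<lambda>u. gauss_trace_prod N (deriv_mset c k u + L))) e"
  proof -
    have "gauss_expect N T2 = (\<Sum>u\<in>{..e}. gauss_expect N (\<lambda>X. (of_nat N)\<^sup>2 * (coupling N u * of_nat (u c)) *
      mps_coeff (weighted_trace_prod N (deriv_mset c k u + L) X) (\<lambda>v. e v - u v)))"
      unfolding T2_def
      by (intro gauss_expect_sum gauss_integrable_cmult gauss_integrable_weighted_trace_prod N)
    then show ?thesis
      by (simp add: gauss_expect_cmult mps_coeff_shift coeff_gauss_trace_prod sum_distrib_left mult.assoc)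
  qed
  finally show "mps_coeff (gauss_trace_prod N (add_mset (c, Suc k) L)) e
    = mps_coeff ((\<Sum>p<k. gauss_trace_prod N (add_mset (c, p) (add_mset (c, k - 1 - p) L)))
    + mps_shift (\<lambda>u. coupling N u * of_nat (u c)) (\<lambda>u. gauss_trace_prod N (deriv_mset c k u + L))
    + mps_const (1 / (of_nat N)\<^sup>2) * (\<Sum>v\<in>#L. mps_const (if fst v = c then of_nat (snd v) else 0) *
        gauss_trace_prod N (add_mset (c, k + snd v - 1) (L - {#v#})))) e"
    using N by (simp only: mps_coeff_add mps_coeff_const_mult) (simp add: field_simps)
qed

section \<open>Normalized moments of the interacting model\<close>

definition moment :: "nat \<Rightarrow> ('d \<times> nat) multiset \<Rightarrow> ('d::finite, complex) mps" where
  "moment N L = model_expect N (trace_prod N L)"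

lemma moment_eq: "moment N L = gauss_trace_prod N L * inverse (gauss_trace_prod N {#})"
proof -
  have "gauss_trace_prod N {#} = gauss_expect_mps N (\<lambda>X. mps_exp (interaction N X))"
    by (simp add: gauss_trace_prod_def weighted_trace_prod_def[abs_def])
  then show ?thesis
    by (simp add: moment_def model_expect_def divide_mps_def gauss_trace_prod_def weighted_trace_prod_def[abs_def])
qed

lemma moment_empty:
  assumes "N > 0"
  shows "moment N ({#} :: ('d::finite \<times> nat) multiset) = 1"
proof -
  have "mps_coeff (gauss_trace_prod N ({#} :: ('d \<times> nat) multiset)) (\<lambda>_. 0) = 1"
    using gauss_expect_one[OF assms]
    by (simp add: coeff_gauss_trace_prod weighted_trace_prod_def mps_exp_def mps_sum_def mps_coeff_one)
  then show ?thesis unfolding moment_eq by (intro mps_unitI) simp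
qed

lemma moment_loop_equation:
  assumes N: "N > 0"
  shows "moment N (add_mset (c, Suc k) L)
    = (\<Sum>p<k. moment N (add_mset (c, p) (add_mset (c, k - 1 - p) L)))
    + mps_shift (\<lambda>u. coupling N u * of_nat (u c)) (\<lambda>u. moment N (deriv_mset c k u + L))
    + mps_const (1 / (of_nat N)\<^sup>2) * (\<Sum>v\<in>#L. mps_const (if fst v = c then of_nat (snd v) else 0) *
        moment N (add_mset (c, k + snd v - 1) (L - {#v#})))"
proof -
  define R where "R = inverse (gauss_trace_prod N ({#} :: ('a \<times> nat) multiset))"
  have R: "moment N L = R * gauss_trace_prod N L" for L :: "('a \<times> nat) multiset"
    by (simp add: moment_eq R_def mult.commute)
  show ?thesis
    unfolding R gauss_trace_prod_loop_equation[OF N, of c k L] distrib_left mult_mps_shift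
      sum_distrib_left mult.left_commute[of R] sum_mset_distrib_left ..
qed

lemma moment_add_mset_0:
  assumes "N > 0"
  shows "moment N (add_mset (b, 0) L) = moment N L"
  using assms by (simp add: moment_def trace_prod_def[abs_def] ntrace_0)

lemma model_expect_cmult: "model_expect N (\<lambda>X. z * f X) = mps_const z * model_expect N f"
  by (simp add: model_expect_def divide_mps_def gauss_expect_mps_def gauss_expect_cmult
      mult.assoc) (simp add: mult.assoc[symmetric] , rule arg_cong2[where f = "(*)"], rule mps_eqI, simp_all)

lemma model_expect_trace_power:
  assumes "N > 0"
  shows "model_expect N (trace_power N v) = mps_const (of_nat N) * moment N {#v#}"
    and "model_expect N (\<lambda>X. trace_power N v X * trace_power N w X)
      = mps_const ((of_nat N)\<^sup>2) * moment N {#v, w#}"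
proof -
  have tr: "trace_power N v = (\<lambda>X. of_nat N * ntrace N v X)" for v :: "'a \<times> nat"
    using assms by (auto simp: ntrace_def)
  show "model_expect N (trace_power N v) = mps_const (of_nat N) * moment N {#v#}"
    unfolding tr model_expect_cmult by (simp add: moment_def trace_prod_def[abs_def])
  have "(\<lambda>X. trace_power N v X * trace_power N w X) = (\<lambda>X. (of_nat N)\<^sup>2 * trace_prod N {#v, w#} X)"
    unfolding tr by (auto simp: trace_prod_def power2_eq_square)
  then show "model_expect N (\<lambda>X. trace_power N v X * trace_power N w X)
      = mps_const ((of_nat N)\<^sup>2) * moment N {#v, w#}"
    by (simp only: model_expect_cmult moment_def)
qed

subsection \<open>Cumulants\<close>

lemma partition_on_singleton: "partition_on {a} P \<longleftrightarrow> P = {{a}}"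
proof
  assume P: "partition_on {a} P"
  have "p = {a}" if "p \<in> P" for p
  proof -
    have "p \<subseteq> {a}" "p \<noteq> {}" using P that by (auto simp: partition_on_def)
    then show ?thesis by auto
  qed
  moreover have "P \<noteq> {}" using P by (auto simp: partition_on_def)
  ultimately show "P = {{a}}" by auto
qed (auto simp: partition_on_def disjoint_def)

lemma partition_on_doubleton:
  assumes "a \<noteq> b"
  shows "partition_on {a, b} P \<longleftrightarrow> P = {{a, b}} \<or> P = {{a}, {b}}"
proof
  assume P: "partition_on {a, b} P"
  then have sub: "p \<subseteq> {a, b}" "p \<noteq> {}" if "p \<in> P" for p
    using that by (auto simp: partition_on_def)
  have disj: "p = q" if "p \<in> P" "q \<in> P" "x \<in> p" "x \<in> q" for p q x
    using P that unfolding partition_on_def disjoint_def by blast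
  obtain p where p: "p \<in> P" "a \<in> p" using P by (auto simp: partition_on_def)
  obtain q where q: "q \<in> P" "b \<in> q" using P by (auto simp: partition_on_def)
  have all: "r = p \<or> r = q" if "r \<in> P" for r
    using sub[OF that] disj[OF that p(1) _ p(2)] disj[OF that q(1) _ q(2)] by blast
  show "P = {{a, b}} \<or> P = {{a}, {b}}"
  proof (cases "b \<in> p")
    case True
    then have "p = {a, b}" "q = p" using sub[OF p(1)] p q disj[OF q(1) p(1) q(2)] by auto
    moreover from this have "P = {p}" using all p(1) by blast
    ultimately show ?thesis by blast
  next
    case False
    then have "p = {a}" using sub[OF p(1)] p by auto
    moreover have "a \<notin> q" using disj[OF p(1) q(1) p(2)] q(2) False by auto
    then have "q = {b}" using sub[OF q(1)] q by auto
    moreover have "P = {p, q}" using all p(1) q(1) by blast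
    ultimately show ?thesis by blast
  qed
qed (use assms in \<open>auto simp: partition_on_def disjoint_def\<close>)

lemma cumulant_single:
  assumes "N > 0"
  shows "cumulant N [v] = mps_const (of_nat N) * moment N {#v#}"
proof -
  have "{P. partition_on {..<length [v]} P} = {{{0}}}"
    using partition_on_singleton[of "0::nat"] by (auto simp: lessThan_Suc)
  then show ?thesis
    unfolding cumulant_def by (simp add: model_expect_trace_power[OF assms])
qed

lemma cumulant_pair:
  assumes "N > 0"
  shows "cumulant N [v, w]
    = mps_const ((of_nat N)\<^sup>2) * (moment N {#v, w#} - moment N {#v#} * moment N {#w#})"
proof -
  have "{..<length [v, w]} = {0, 1}" by auto
  then have P: "{P. partition_on {..<length [v, w]} P} = {{{0, 1}}, {{0}, {1}}}"
    using partition_on_doubleton[of "0::nat" 1] by auto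
  have ne: "{{0::nat, 1}} \<noteq> {{0}, {1}}" by (auto simp: doubleton_eq_iff)
  have "cumulant N [v, w] = model_expect N (\<lambda>X. trace_power N v X * trace_power N w X)
      - model_expect N (trace_power N v) * model_expect N (trace_power N w)"
    unfolding cumulant_def P using ne by (simp add: mps_const_uminus)
  then show ?thesis
    by (simp add: model_expect_trace_power[OF assms] right_diff_distrib power2_eq_square mps_const_mult ac_simps)
qed

section \<open>The planar limit\<close>

subsection \<open>Limits of solutions of the loop equations\<close>

abbreviation weight :: "('d \<times> nat) multiset \<Rightarrow> nat" where
  "weight L \<equiv> \<Sum>v\<in>#L. snd v"

text \<open>
  The loop equation expresses the value at \<open>add_mset (c, Suc k) L\<close> by values which have either
  lower order in the parameters or the same order and lower weight.
\<close>

lemma loop_induct [case_names empty zero step]: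
  fixes e :: "'v::finite \<Rightarrow> nat" and L :: "('d \<times> nat) multiset"
  assumes empty: "\<And>e. P e {#}"
    and zero: "\<And>e b L. P e L \<Longrightarrow> P e (add_mset (b, 0) L)"
    and step: "\<And>e c k L. (\<And>e' L'. tdeg e' < tdeg e \<Longrightarrow> P e' L') \<Longrightarrow>
      (\<And>L'. weight L' < Suc k + weight L \<Longrightarrow> P e L') \<Longrightarrow> P e (add_mset (c, Suc k) L)"
  shows "P e L"
proof (induction "tdeg e" arbitrary: e L rule: less_induct)
  case less
  note order_IH = less
  have base: "P e L" if "weight L = 0" for L
    using that
  proof (induction L)
    case (add v L)
    then show ?case using zero[of e L "fst v"] by (cases v) auto
  qed (rule empty)
  have "\<forall>L. weight L = n \<longrightarrow> P e L" for n
  proof (induction n rule: less_induct)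
    case (less n)
    show ?case
    proof (intro allI impI)
      fix L :: "('d \<times> nat) multiset" assume L: "weight L = n"
      show "P e L"
      proof (cases "\<exists>v\<in>#L. snd v \<noteq> 0")
        case True
        then obtain v L' where v: "L = add_mset v L'" "snd v \<noteq> 0" by (auto dest: multi_member_split)
        then obtain k where "snd v = Suc k" by (auto simp: gr0_conv_Suc)
        then have L': "L = add_mset (fst v, Suc k) L'" using v(1) by (cases v) auto
        show ?thesis
          unfolding L' by (rule step) (use order_IH less L L' in auto)
      qed (use base in \<open>auto simp: sum_mset_0_iff\<close>)
    qed
  qed
  then show ?case by blast
qed

abbreviation limit_coupling :: "('d::finite \<Rightarrow> nat) \<Rightarrow> complex" where
  "limit_coupling u \<equiv> if tdeg u = 2 then 1 / (\<Prod>v\<in>UNIV. fact (u v)) else 0"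

text \<open>The quadratic interaction consists of tr M_c^2 for equal colors and of tr M_c tr M_b for
  different ones. These are the traces that remain after the variation M^k of color c.\<close>

abbreviation quad_mset :: "'d \<Rightarrow> nat \<Rightarrow> 'd \<Rightarrow> ('d \<times> nat) multiset" where
  "quad_mset c k b \<equiv> (if b = c then {#(c, Suc k)#} else {#(c, k), (b, 1)#})"

lemma deriv_mset_quadratic:
  fixes c b :: "'d::finite"
  assumes zero: "\<And>b L. F (add_mset (b, 0) L) = F L"
  shows "F (deriv_mset c k (\<lambda>v. (if v = c then 1 else 0) + (if v = b then 1 else 0)) + L) = F (quad_mset c k b + L)"
proof -
  have zeros: "F (image_mset (\<lambda>x. (x, 0)) M + L) = F L" for M L
    by (induction M) (auto simp: zero)
  show ?thesis
  proof (cases "b = c")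
    case True
    have "image_mset (\<lambda>x. (x, (if x = c then 1 else 0) + (if x = b then 1 else 0))) (mset_set (UNIV - {c}))
        = image_mset (\<lambda>x. (x, 0::nat)) (mset_set (UNIV - {c}))"
      by (rule image_mset_cong) (auto simp: True)
    then show ?thesis
      using zeros[of "mset_set (UNIV - {c})" "add_mset (c, Suc k) L"] by (simp add: deriv_mset_def True)
  next
    case False
    have "mset_set (UNIV - {c}) = add_mset b (mset_set (UNIV - {c} - {b}))"
      using False by (subst mset_set.insert_remove[symmetric]) (auto simp: insert_absorb)
    moreover have "image_mset (\<lambda>x. (x, (if x = c then 1 else 0) + (if x = b then 1 else 0))) (mset_set (UNIV - {c} - {b}))
        = image_mset (\<lambda>x. (x, 0::nat)) (mset_set (UNIV - {c} - {b}))"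
      by (rule image_mset_cong) auto
    ultimately show ?thesis
      using zeros[of "mset_set (UNIV - {c} - {b})" "add_mset (c, k) (add_mset (b, 1) L)"] False
      by (simp add: deriv_mset_def)
  qed
qed

lemma tendsto_sum_mset:
  fixes f :: "'b \<Rightarrow> nat \<Rightarrow> complex"
  assumes "\<And>x. x \<in># M \<Longrightarrow> (f x \<longlonglongrightarrow> g x)"
  shows "(\<lambda>N. \<Sum>x\<in>#M. f x N) \<longlonglongrightarrow> (\<Sum>x\<in>#M. g x)"
  using assms by (induction M) (auto intro!: tendsto_add)

text \<open>The inhomogeneity \<open>R\<close> allows two uses: it is zero for the moments, and for
  the rescaled covariances it consists of moments whose limits are then already known.\<close>

lemma loop_limit:
  fixes F :: "nat \<Rightarrow> ('d::finite \<times> nat) multiset \<Rightarrow> ('d, complex) mps"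
  assumes card: "CARD('d) \<ge> 3"
    and loop: "\<And>N c k L. N > 0 \<Longrightarrow> F N (add_mset (c, Suc k) L)
      = (\<Sum>p<k. F N (add_mset (c, p) (add_mset (c, k - 1 - p) L)))
      + mps_shift (\<lambda>u. coupling N u * of_nat (u c)) (\<lambda>u. F N (deriv_mset c k u + L))
      + mps_const (1 / (of_nat N)\<^sup>2) * (\<Sum>v\<in>#L. mps_const (if fst v = c then of_nat (snd v) else 0) *
          F N (add_mset (c, k + snd v - 1) (L - {#v#})))
      + R N c k L"
    and zero: "\<And>N b L. N > 0 \<Longrightarrow> F N (add_mset (b, 0) L) = F N L"
    and empty: "\<And>N. N > 0 \<Longrightarrow> F N {#} = h"
    and R: "\<And>c k L e. (\<lambda>N. mps_coeff (R N c k L) e) \<longlonglongrightarrow> mps_coeff (R' c k L) e"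
  obtains F' where
    "\<And>L e. (\<lambda>N. mps_coeff (F N L) e) \<longlonglongrightarrow> mps_coeff (F' L) e"
    "\<And>b L. F' (add_mset (b, 0) L) = F' L"
    "F' {#} = h"
    "\<And>c k L. F' (add_mset (c, Suc k) L)
      = (\<Sum>p<k. F' (add_mset (c, p) (add_mset (c, k - 1 - p) L)))
      + (\<Sum>b\<in>UNIV. mps_var c * mps_var b * F' (quad_mset c k b + L))
      + R' c k L"
proof -
  have ev: "\<forall>\<^sub>F N in sequentially. N > (0::nat)" by (rule eventually_gt_at_top)
  define rhs where "rhs N c k L e = (\<Sum>p<k. mps_coeff (F N (add_mset (c, p) (add_mset (c, k - 1 - p) L))) e)
      + (\<Sum>u\<in>{..e}. coupling N u * of_nat (u c) * mps_coeff (F N (deriv_mset c k u + L)) (\<lambda>v. e v - u v))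
      + 1 / (of_nat N)\<^sup>2 * (\<Sum>v\<in>#L. (if fst v = c then of_nat (snd v) else 0) *
          mps_coeff (F N (add_mset (c, k + snd v - 1) (L - {#v#}))) e)
      + mps_coeff (R N c k L) e" for N c k L e
  have rhs: "mps_coeff (F N (add_mset (c, Suc k) L)) e = rhs N c k L e" if "N > 0" for N c k L e
    unfolding loop[OF that] rhs_def
    by (simp only: mps_coeff_add mps_coeff_sum mps_coeff_shift mps_coeff_const_mult mps_coeff_sum_mset)
  have inv_N2: "(\<lambda>N. 1 / (of_nat N)\<^sup>2 :: complex) \<longlonglongrightarrow> 0"
    using tendsto_power[OF lim_inverse_n[where 'a = complex], of 2]
    by (simp add: power_divide inverse_eq_divide)
  have rhs_tendsto: "(\<lambda>N. rhs N c k L e) \<longlonglongrightarrow>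
      (\<Sum>p<k. l e (add_mset (c, p) (add_mset (c, k - 1 - p) L)))
      + (\<Sum>u\<in>{..e}. limit_coupling u * of_nat (u c) * l (\<lambda>v. e v - u v) (deriv_mset c k u + L))
      + mps_coeff (R' c k L) e"
    if order: "\<And>e' L'. tdeg e' < tdeg e \<Longrightarrow> (\<lambda>N. mps_coeff (F N L') e') \<longlonglongrightarrow> l e' L'"
      and weight: "\<And>L'. weight L' < Suc k + weight L \<Longrightarrow> (\<lambda>N. mps_coeff (F N L') e) \<longlonglongrightarrow> l e L'"
    for c k L e and l :: "('d \<Rightarrow> nat) \<Rightarrow> ('d \<times> nat) multiset \<Rightarrow> complex"
  proof -
    have "(\<lambda>N. mps_coeff (F N (add_mset (c, p) (add_mset (c, k - 1 - p) L))) e)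
        \<longlonglongrightarrow> l e (add_mset (c, p) (add_mset (c, k - 1 - p) L))" if "p < k" for p
      using that by (intro weight) simp
    \<comment> \<open>Exponents of degree below two have coupling zero; all others leave a
      coefficient of strictly lower order, whatever the weight of its traces.\<close>
    moreover have "(\<lambda>N. coupling N u * of_nat (u c) * mps_coeff (F N (deriv_mset c k u + L)) (\<lambda>v. e v - u v))
        \<longlonglongrightarrow> limit_coupling u * of_nat (u c) * l (\<lambda>v. e v - u v) (deriv_mset c k u + L)" if "u \<le> e" for u
    proof (cases "tdeg u < 2")
      case True
      then have "coupling N u = 0" for N by (simp only: coupling_def if_True)
      moreover have "tdeg u \<noteq> 2" using True by simp
      ultimately show ?thesis by (simp only: if_False mult_zero_left tendsto_const)
    next
      case False
      have "tdeg (\<lambda>v. e v - u v) < tdeg e" using tdeg_diff[OF that] False by linarith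
      then show ?thesis
        by (intro tendsto_mult tendsto_const coupling_tendsto[OF card] order)
    qed
    moreover have "(\<lambda>N. \<Sum>v\<in>#L. (if fst v = c then of_nat (snd v) else 0) *
          mps_coeff (F N (add_mset (c, k + snd v - 1) (L - {#v#}))) e)
        \<longlonglongrightarrow> (\<Sum>v\<in>#L. (if fst v = c then of_nat (snd v) else 0) *
          l e (add_mset (c, k + snd v - 1) (L - {#v#})))"
    proof (intro tendsto_sum_mset tendsto_mult tendsto_const weight)
      fix v assume "v \<in># L"
      then have "weight L = snd v + weight (L - {#v#})" by (metis insert_DiffM image_mset_add_mset sum_mset.add_mset)
      then show "weight (add_mset (c, k + snd v - 1) (L - {#v#})) < Suc k + weight L" by simp
    qed
    then have "(\<lambda>N. 1 / (of_nat N)\<^sup>2 * (\<Sum>v\<in>#L. (if fst v = c then of_nat (snd v) else 0) *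
          mps_coeff (F N (add_mset (c, k + snd v - 1) (L - {#v#}))) e)) \<longlonglongrightarrow> 0"
      using tendsto_mult[OF inv_N2] by fastforce
    ultimately have "(\<lambda>N. rhs N c k L e) \<longlonglongrightarrow>
      (\<Sum>p<k. l e (add_mset (c, p) (add_mset (c, k - 1 - p) L)))
      + (\<Sum>u\<in>{..e}. limit_coupling u * of_nat (u c) * l (\<lambda>v. e v - u v) (deriv_mset c k u + L))
      + 0 + mps_coeff (R' c k L) e"
      unfolding rhs_def by (intro tendsto_add tendsto_sum R) auto
    then show ?thesis by (simp only: add_0_right)
  qed
  have conv: "convergent (\<lambda>N. mps_coeff (F N L) e)" for L e
  proof (induction e L rule: loop_induct)
    case (empty e)
    have "\<forall>\<^sub>F N in sequentially. mps_coeff (F N {#}) e = mps_coeff h e"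
      using ev by eventually_elim (simp add: assms(4))
    then show ?case by (metis convergentI tendsto_eventually)
  next
    case (zero e b L)
    have "\<forall>\<^sub>F N in sequentially. mps_coeff (F N (add_mset (b, 0) L)) e = mps_coeff (F N L) e"
      using ev by eventually_elim (simp add: assms(3))
    from convergent_cong[OF this] zero show ?case by (simp only:)
  next
    case (step e c k L)
    \<comment> \<open>\<open>l\<close> merely names the limits; for the pairs that occur on the
      right they exist by the induction hypotheses.\<close>
    define l where "l e L = lim (\<lambda>N. mps_coeff (F N L) e)" for e L
    have "(\<lambda>N. mps_coeff (F N L') e') \<longlonglongrightarrow> l e' L'" if "tdeg e' < tdeg e" for e' L'
      using step(1)[OF that] unfolding l_def convergent_LIMSEQ_iff .
    moreover have "(\<lambda>N. mps_coeff (F N L') e) \<longlonglongrightarrow> l e L'" if "weight L' < Suc k + weight L" for L'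
      using step(2)[OF that] unfolding l_def convergent_LIMSEQ_iff .
    ultimately have "convergent (\<lambda>N. rhs N c k L e)"
      by (rule convergentI[OF rhs_tendsto])
    moreover have "\<forall>\<^sub>F N in sequentially. mps_coeff (F N (add_mset (c, Suc k) L)) e = rhs N c k L e"
      using ev by eventually_elim (rule rhs)
    ultimately show ?case by (simp only: convergent_cong)
  qed
  define F' where "F' L = Mps (\<lambda>e. lim (\<lambda>N. mps_coeff (F N L) e))" for L
  have lim: "(\<lambda>N. mps_coeff (F N L) e) \<longlonglongrightarrow> mps_coeff (F' L) e" for L e
    using conv[of L e] by (simp add: F'_def convergent_LIMSEQ_iff)
  have unique: "mps_coeff (F' L) e = x" if "\<And>N. N > 0 \<Longrightarrow> mps_coeff (F N L) e = g N" "g \<longlonglongrightarrow> x" for L e g x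
  proof -
    have "\<forall>\<^sub>F N in sequentially. mps_coeff (F N L) e = g N"
      using ev by eventually_elim (rule that(1))
    then have "(\<lambda>N. mps_coeff (F N L) e) \<longlonglongrightarrow> x" using that(2) by (simp only: tendsto_cong)
    with lim[of L e] show ?thesis by (rule LIMSEQ_unique)
  qed
  have zero': "F' (add_mset (b, 0) L) = F' L" for b L
    by (rule mps_eqI, rule unique[OF _ lim]) (simp add: zero)
  have empty': "F' {#} = h"
    by (rule mps_eqI, rule unique[OF _ tendsto_const]) (simp add: empty)
  have "F' (add_mset (c, Suc k) L)
      = (\<Sum>p<k. F' (add_mset (c, p) (add_mset (c, k - 1 - p) L)))
      + mps_shift (\<lambda>u. limit_coupling u * of_nat (u c)) (\<lambda>u. F' (deriv_mset c k u + L))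
      + R' c k L" for c k L
  proof (rule mps_eqI)
    fix e
    have "mps_coeff (F' (add_mset (c, Suc k) L)) e
      = (\<Sum>p<k. mps_coeff (F' (add_mset (c, p) (add_mset (c, k - 1 - p) L))) e)
      + (\<Sum>u\<in>{..e}. limit_coupling u * of_nat (u c) * mps_coeff (F' (deriv_mset c k u + L)) (\<lambda>v. e v - u v))
      + mps_coeff (R' c k L) e"
      by (rule unique[OF rhs rhs_tendsto]) (auto intro: lim)
    then show "mps_coeff (F' (add_mset (c, Suc k) L)) e
      = mps_coeff ((\<Sum>p<k. F' (add_mset (c, p) (add_mset (c, k - 1 - p) L)))
      + mps_shift (\<lambda>u. limit_coupling u * of_nat (u c)) (\<lambda>u. F' (deriv_mset c k u + L))
      + R' c k L) e"
      by (simp only: mps_coeff_add mps_coeff_sum mps_coeff_shift)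
  qed
  then have loop': "F' (add_mset (c, Suc k) L)
      = (\<Sum>p<k. F' (add_mset (c, p) (add_mset (c, k - 1 - p) L)))
      + (\<Sum>b\<in>UNIV. mps_var c * mps_var b * F' (quad_mset c k b + L))
      + R' c k L" for c k L
    unfolding mps_shift_quadratic[where w = limit_coupling, OF refl]
      deriv_mset_quadratic[where F = F', OF zero'] .
  show ?thesis by (rule that[OF lim zero' empty' loop'])
qed

subsection \<open>Factorization\<close>

text \<open>Without the 1/N^2 term the traces in \<open>L\<close> are spectators, so the product of
  one-trace moments solves the same recursion. The recursion has a unique solution by induction on
  the order and then on the weight.\<close>

lemma limit_moment_factorizes:
  fixes m :: "('d::finite \<times> nat) multiset \<Rightarrow> ('d, complex) mps"
  assumes zero: "\<And>b L. m (add_mset (b, 0) L) = m L" and empty: "m {#} = 1"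
    and loop: "\<And>c k L. m (add_mset (c, Suc k) L)
      = (\<Sum>p<k. m (add_mset (c, p) (add_mset (c, k - 1 - p) L)))
      + (\<Sum>b\<in>UNIV. mps_var c * mps_var b * m (quad_mset c k b + L))"
  shows "m L = (\<Prod>v\<in>#L. m {#v#})"
proof -
  define G where "G L = (\<Prod>v\<in>#L. m {#v#})" for L
  have G_add: "G (add_mset v L) = m {#v#} * G L" and G_union: "G (L + L') = G L * G L'" for v L L'
    by (simp_all add: G_def)
  have "mps_eq_upto n (m L) (G L)" for n L
  proof (induction n arbitrary: L rule: less_induct)
    case (less n)
    note order_IH = less
    show ?case
    proof (induction "weight L" arbitrary: L rule: less_induct)
      case less
      note weight_IH = less
      show ?case
      proof (cases "\<exists>v\<in>#L. snd v \<noteq> 0")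
        case False
        then have "m L = 1 \<and> G L = 1"
        proof (induction L)
          case (add v L)
          then have "m {#v#} = 1" "m (add_mset v L) = m L"
            using zero[of "fst v"] empty by (cases v; simp)+
          then show ?case using add by (simp add: G_add)
        qed (simp add: empty G_def)
        then show ?thesis by simp
      next
        case True
        then obtain v L' where v: "L = add_mset v L'" "snd v \<noteq> 0" by (auto dest: multi_member_split)
        then obtain k where "snd v = Suc k" by (auto simp: gr0_conv_Suc)
        then obtain c where L: "L = add_mset (c, Suc k) L'" using v(1) by (cases v) auto
        have quad: "mps_eq_upto n (mps_var c * mps_var b * m K) (mps_var c * mps_var b * G K)" for b K
          unfolding mult.assoc
          by (intro mps_eq_upto_var_mult mps_eq_upto_mult mps_eq_upto_refl order_IH)
        have "mps_eq_upto n (m L)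
          ((\<Sum>p<k. G (add_mset (c, p) (add_mset (c, k - 1 - p) L')))
          + (\<Sum>b\<in>UNIV. mps_var c * mps_var b * G (quad_mset c k b + L')))"
          unfolding L loop
          by (intro mps_eq_upto_add mps_eq_upto_sum weight_IH quad) (simp add: L)
        also have "(\<Sum>p<k. G (add_mset (c, p) (add_mset (c, k - 1 - p) L')))
          + (\<Sum>b\<in>UNIV. mps_var c * mps_var b * G (quad_mset c k b + L'))
          = ((\<Sum>p<k. G {#(c, p), (c, k - 1 - p)#})
          + (\<Sum>b\<in>UNIV. mps_var c * mps_var b * G (quad_mset c k b))) * G L'"
          unfolding G_union distrib_right sum_distrib_right
          by (simp only: G_add mult.assoc) (simp add: G_def)
        \<comment> \<open>With the spectators factored out, the bracket is led back from
          \<open>G\<close> to \<open>m\<close>, where the equation for a single trace evaluates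
          it.\<close>
        also have "mps_eq_upto n \<dots> (((\<Sum>p<k. m {#(c, p), (c, k - 1 - p)#})
          + (\<Sum>b\<in>UNIV. mps_var c * mps_var b * m (quad_mset c k b))) * G L')"
          by (intro mps_eq_upto_mult mps_eq_upto_add mps_eq_upto_sum mps_eq_upto_refl
              mps_eq_upto_sym[OF quad] mps_eq_upto_sym[OF weight_IH]) (simp add: L)
        also have "(\<Sum>p<k. m {#(c, p), (c, k - 1 - p)#})
          + (\<Sum>b\<in>UNIV. mps_var c * mps_var b * m (quad_mset c k b)) = m {#(c, Suc k)#}"
          using loop[of c k "{#}"] by simp
        finally show ?thesis by (simp add: L G_add)
      qed
    qed
  qed
  then show ?thesis unfolding G_def by (rule mps_eq_upto_all)
qed

text \<open>Linearizing the recursion of the moments around its multiplicative solution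
  \<open>x\<close> gives the recursion of \<open>C\<close>. Hence the Leibniz expression built from
  the one-trace values of \<open>C\<close> is a solution, and the solution is unique as
  before.\<close>

lemma limit_covariance_derivation:
  fixes C :: "('d::finite \<times> nat) multiset \<Rightarrow> ('d, complex) mps" and x :: "'d \<times> nat \<Rightarrow> ('d, complex) mps"
  assumes zero: "\<And>b L. C (add_mset (b, 0) L) = C L" and empty: "C {#} = 0"
    and x0: "\<And>b. x (b, 0) = 1"
    and x: "\<And>c k. x (c, Suc k) = (\<Sum>p<k. x (c, p) * x (c, k - 1 - p))
      + (\<Sum>b\<in>UNIV. mps_var c * mps_var b * (\<Prod>v\<in>#quad_mset c k b. x v))"
    and loop: "\<And>c k L. C (add_mset (c, Suc k) L)
      = (\<Sum>p<k. C (add_mset (c, p) (add_mset (c, k - 1 - p) L)))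
      + (\<Sum>b\<in>UNIV. mps_var c * mps_var b * C (quad_mset c k b + L))
      + r c k * (\<Prod>v\<in>#L. x v)"
  shows "C L = (\<Sum>v\<in>#L. C {#v#} * (\<Prod>w\<in>#L - {#v#}. x w))"
proof -
  define G where "G L = (\<Prod>v\<in>#L. x v)" for L
  have G_add: "G (add_mset v L) = x v * G L" and G_union: "G (L + L') = G L * G L'" for v L L'
    by (simp_all add: G_def)
  define D where "D L = (\<Sum>v\<in>#L. C {#v#} * (\<Prod>w\<in>#L - {#v#}. x w))" for L
  have D_add: "D (add_mset v L) = C {#v#} * G L + x v * D L" for v L
    unfolding D_def G_def by (rule sum_mset_add_mset_remove)
  have D_empty: "D {#} = 0" by (simp add: D_def)
  have D_union: "D (L + L') = D L * G L' + G L * D L'" for L L'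
    by (induction L) (simp_all add: D_empty D_add G_union, simp_all add: G_def algebra_simps)
  have "mps_eq_upto n (C L) (D L)" for n L
  proof (induction n arbitrary: L rule: less_induct)
    case (less n)
    note order_IH = less
    show ?case
    proof (induction "weight L" arbitrary: L rule: less_induct)
      case less
      note weight_IH = less
      show ?case
      proof (cases "\<exists>v\<in>#L. snd v \<noteq> 0")
        case False
        then have "C L = 0 \<and> D L = 0"
        proof (induction L)
          case (add v L)
          then have "C {#v#} = 0" "C (add_mset v L) = C L"
            using zero[of "fst v"] empty by (cases v; simp)+
          then show ?case using add by (simp add: D_add)
        qed (simp add: empty D_empty)
        then show ?thesis by simp
      next
        case True
        then obtain v L' where v: "L = add_mset v L'" "snd v \<noteq> 0" by (auto dest: multi_member_split)
        then obtain k where "snd v = Suc k" by (auto simp: gr0_conv_Suc)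
        then obtain c where L: "L = add_mset (c, Suc k) L'" using v(1) by (cases v) auto
        have quad: "mps_eq_upto n (mps_var c * mps_var b * C K) (mps_var c * mps_var b * D K)" for b K
          unfolding mult.assoc
          by (intro mps_eq_upto_var_mult mps_eq_upto_mult mps_eq_upto_refl order_IH)
        have pair: "add_mset u (add_mset w L') = {#u, w#} + L'" for u w by simp
        have "mps_eq_upto n (C L)
          ((\<Sum>p<k. D (add_mset (c, p) (add_mset (c, k - 1 - p) L')))
          + (\<Sum>b\<in>UNIV. mps_var c * mps_var b * D (quad_mset c k b + L')) + r c k * G L')"
          unfolding L loop G_def
          by (intro mps_eq_upto_add mps_eq_upto_sum weight_IH quad mps_eq_upto_refl) (simp add: L)
        \<comment> \<open>The terms are sorted by whether the derivation falls on the spectators: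
          the coefficient of \<open>G L'\<close> is the one-trace equation of \<open>C\<close>, that
          of \<open>D L'\<close> the one-trace equation of \<open>x\<close>.\<close>
        also have "(\<Sum>p<k. D (add_mset (c, p) (add_mset (c, k - 1 - p) L')))
          + (\<Sum>b\<in>UNIV. mps_var c * mps_var b * D (quad_mset c k b + L')) + r c k * G L'
          = ((\<Sum>p<k. D {#(c, p), (c, k - 1 - p)#})
            + (\<Sum>b\<in>UNIV. mps_var c * mps_var b * D (quad_mset c k b)) + r c k) * G L'
          + ((\<Sum>p<k. G {#(c, p), (c, k - 1 - p)#})
            + (\<Sum>b\<in>UNIV. mps_var c * mps_var b * G (quad_mset c k b))) * D L'"
          unfolding pair D_union distrib_left distrib_right sum.distrib sum_distrib_right
          by (simp only: mult.assoc add_ac)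
        also have "(\<Sum>p<k. G {#(c, p), (c, k - 1 - p)#})
            + (\<Sum>b\<in>UNIV. mps_var c * mps_var b * G (quad_mset c k b)) = x (c, Suc k)"
          unfolding x by (simp only: G_def image_mset_add_mset image_mset_empty prod_mset.add_mset
              prod_mset_empty mult_1_right)
        also have "mps_eq_upto n (((\<Sum>p<k. D {#(c, p), (c, k - 1 - p)#})
            + (\<Sum>b\<in>UNIV. mps_var c * mps_var b * D (quad_mset c k b)) + r c k) * G L' + x (c, Suc k) * D L')
          (((\<Sum>p<k. C {#(c, p), (c, k - 1 - p)#})
            + (\<Sum>b\<in>UNIV. mps_var c * mps_var b * C (quad_mset c k b)) + r c k) * G L' + x (c, Suc k) * D L')"
          by (intro mps_eq_upto_mult mps_eq_upto_add mps_eq_upto_sum mps_eq_upto_refl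
              mps_eq_upto_sym[OF quad] mps_eq_upto_sym[OF weight_IH]) (simp add: L)
        also have "(\<Sum>p<k. C {#(c, p), (c, k - 1 - p)#})
          + (\<Sum>b\<in>UNIV. mps_var c * mps_var b * C (quad_mset c k b)) + r c k = C {#(c, Suc k)#}"
          using loop[of c k "{#}"] by simp
        finally show ?thesis by (simp add: L D_add)
      qed
    qed
  qed
  then show ?thesis unfolding D_def by (rule mps_eq_upto_all)
qed

subsection \<open>Planar moments and covariances\<close>

abbreviation norm2 :: "('d::finite, complex) mps" where
  "norm2 \<equiv> \<Sum>p\<in>UNIV. mps_var p ^ 2"

lemma mps_coeff_var_0: "mps_coeff (mps_var i) (\<lambda>_. 0) = 0"
  using mps_coeff_var_mult[of i 1 "\<lambda>_. 0"] by simp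

lemma coeff_norm2_0: "mps_coeff (norm2 :: ('d::finite, complex) mps) (\<lambda>_. 0) = 0"
proof -
  have "mps_coeff (mps_var p ^ 2 :: ('d, complex) mps) (\<lambda>_. 0) = 0" for p
    by (simp add: power2_eq_square mps_coeff_var_0)
  then show ?thesis by simp
qed

definition planar_moment :: "'d::finite \<Rightarrow> nat \<Rightarrow> ('d, complex) mps" where
  "planar_moment c k = planar_cumulant [(c, k)]"

definition planar_cov :: "'d::finite \<times> nat \<Rightarrow> 'd \<times> nat \<Rightarrow> ('d, complex) mps" where
  "planar_cov v w = planar_cumulant [v, w]"

text \<open>Division by the power of N, nonzero for all N > 0, turns the little-o condition into
  convergence, so uniqueness of limits settles the definite description.\<close>

lemma leading_coeff_eqI:
  assumes "(\<lambda>N. f N / complex_of_real (real N powr r)) \<longlonglongrightarrow> w"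
  shows "leading_coeff r f = w"
proof -
  let ?g = "\<lambda>N. complex_of_real (real N powr r)"
  have nz: "\<forall>\<^sub>F N in sequentially. ?g N \<noteq> 0"
    using eventually_gt_at_top[of 0] by eventually_elim simp
  have iff: "(\<lambda>N. f N - z * ?g N) \<in> o(?g) \<longleftrightarrow> (\<lambda>N. f N / ?g N) \<longlonglongrightarrow> z" for z
  proof -
    have eq: "\<forall>\<^sub>F N in sequentially. (f N - z * ?g N) / ?g N = f N / ?g N - z"
      using nz by eventually_elim (simp add: diff_divide_distrib)
    have "(\<lambda>N. f N - z * ?g N) \<in> o(?g) \<longleftrightarrow> (\<lambda>N. (f N - z * ?g N) / ?g N) \<longlonglongrightarrow> 0"
      by (rule iffI, erule smalloD_tendsto, erule smalloI_tendsto[OF _ nz])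
    also have "\<dots> \<longleftrightarrow> (\<lambda>N. f N / ?g N - z) \<longlonglongrightarrow> 0"
      by (rule tendsto_cong[OF eq])
    also have "\<dots> \<longleftrightarrow> (\<lambda>N. f N / ?g N) \<longlonglongrightarrow> z"
      by (simp add: LIM_zero_iff)
    finally show ?thesis .
  qed
  show ?thesis
    unfolding leading_coeff_def iff using assms by (blast intro: the_equality LIMSEQ_unique)
qed

theorem planar_loop_equations:
  assumes card: "CARD('d::finite) \<ge> 3"
  shows "planar_moment (c::'d) 0 = 1"
    and "planar_moment c (Suc k) = (\<Sum>p<k. planar_moment c p * planar_moment c (k - 1 - p))
      + (\<Sum>b\<in>UNIV. mps_var c * mps_var b * (if b = c then planar_moment c (Suc k)
          else planar_moment c k * planar_moment b 1))"
    and "planar_cov (c, 0) w = 0"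
    and "planar_cov (c, Suc k) w
      = (\<Sum>p<k. planar_cov (c, p) w * planar_moment c (k - 1 - p) + planar_moment c p * planar_cov (c, k - 1 - p) w)
      + (\<Sum>b\<in>UNIV. mps_var c * mps_var b * (if b = c then planar_cov (c, Suc k) w
          else planar_cov (c, k) w * planar_moment b 1 + planar_moment c k * planar_cov (b, 1) w))
      + (if fst w = c then of_nat (snd w) * planar_moment c (k + snd w - 1) else 0)"
proof -
  have empty: "moment N ({#} :: ('d \<times> nat) multiset) = 1" if "N > 0" for N
    using that by (rule moment_empty)
  have loop_m: "moment N (add_mset (c, Suc k) L)
      = (\<Sum>p<k. moment N (add_mset (c, p) (add_mset (c, k - 1 - p) L)))
      + mps_shift (\<lambda>u. coupling N u * of_nat (u c)) (\<lambda>u. moment N (deriv_mset c k u + L))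
      + mps_const (1 / (of_nat N)\<^sup>2) * (\<Sum>v\<in>#L. mps_const (if fst v = c then of_nat (snd v) else 0) *
          moment N (add_mset (c, k + snd v - 1) (L - {#v#})))
      + 0" if "N > 0" for N k L and c :: 'd
    using moment_loop_equation[OF that] by simp
  obtain m where m: "\<And>L e. (\<lambda>N. mps_coeff (moment N L) e) \<longlonglongrightarrow> mps_coeff (m L) e"
    and m_zero: "\<And>(b::'d) L. m (add_mset (b, 0) L) = m L" and m_empty: "m {#} = 1"
    and m_loop: "\<And>c k L. m (add_mset (c, Suc k) L)
      = (\<Sum>p<k. m (add_mset (c, p) (add_mset (c, k - 1 - p) L)))
      + (\<Sum>b\<in>UNIV. mps_var c * mps_var b * m (quad_mset c k b + L)) + 0"
    using loop_limit[where F = moment and R = "\<lambda>_ _ _ _. 0" and R' = "\<lambda>_ _ _. 0",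
        OF card loop_m moment_add_mset_0 empty tendsto_const] by blast
  have m_prod: "m L = (\<Prod>v\<in>#L. m {#v#})" for L
    by (rule limit_moment_factorizes[OF m_zero m_empty]) (simp add: m_loop)
  have planar_m: "planar_moment c k = m {#(c, k)#}" for c k
  proof (rule mps_eqI)
    fix e
    have "(\<lambda>N. mps_coeff (cumulant N [(c, k)]) e / complex_of_real (real N powr 1)) \<longlonglongrightarrow> mps_coeff (m {#(c, k)#}) e"
    proof (rule Lim_transform_eventually[OF m])
      show "\<forall>\<^sub>F N in sequentially. mps_coeff (moment N {#(c, k)#}) e
          = mps_coeff (cumulant N [(c, k)]) e / complex_of_real (real N powr 1)"
        using eventually_gt_at_top[of 0] by eventually_elim (simp add: cumulant_single)
    qed
    from leading_coeff_eqI[OF this] show "mps_coeff (planar_moment c k) e = mps_coeff (m {#(c, k)#}) e"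
      by (simp add: planar_moment_def planar_cumulant_def)
  qed
  define x where "x v = m {#v#}" for v
  have x0: "x (b, 0) = 1" for b by (simp add: x_def m_zero m_empty)
  have x_loop: "x (c, Suc k) = (\<Sum>p<k. x (c, p) * x (c, k - 1 - p))
      + (\<Sum>b\<in>UNIV. mps_var c * mps_var b * (\<Prod>v\<in>#quad_mset c k b. x v))" for c k
  proof -
    have "x (c, Suc k) = (\<Sum>p<k. m {#(c, p), (c, k - 1 - p)#})
      + (\<Sum>b\<in>UNIV. mps_var c * mps_var b * m (quad_mset c k b))"
      using m_loop[of c k "{#}"] by (simp add: x_def)
    then show ?thesis
      unfolding m_prod[of "{#_, _#}"] m_prod[of "quad_mset c k _"] by (simp add: x_def)
  qed
  show "planar_moment c 0 = 1" by (simp add: planar_m m_zero m_empty)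
  show "planar_moment c (Suc k) = (\<Sum>p<k. planar_moment c p * planar_moment c (k - 1 - p))
      + (\<Sum>b\<in>UNIV. mps_var c * mps_var b * (if b = c then planar_moment c (Suc k)
          else planar_moment c k * planar_moment b 1))"
  proof -
    have prod: "(\<Prod>v\<in>#quad_mset c k b. x v) = (if b = c then x (c, Suc k) else x (c, k) * x (b, 1))" for b
      by simp
    show ?thesis
      using x_loop[of c k] unfolding prod unfolding planar_m x_def .
  qed

  define F where "F N L = mps_const ((of_nat N)\<^sup>2) * (moment N (add_mset w L) - moment N {#w#} * moment N L)" for N L
  \<comment> \<open>\<open>r\<close> comes from the contraction with the fixed trace
    \<open>w\<close>. Its 1/N^2 is cancelled by the prefactor of \<open>F\<close>, so it survives as
    the inhomogeneity.\<close>
  define r where "r c = (mps_const (if fst w = c then of_nat (snd w) else 0) :: ('d, complex) mps)" for c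
  have loop_F: "F N (add_mset (c, Suc k) L)
      = (\<Sum>p<k. F N (add_mset (c, p) (add_mset (c, k - 1 - p) L)))
      + mps_shift (\<lambda>u. coupling N u * of_nat (u c)) (\<lambda>u. F N (deriv_mset c k u + L))
      + mps_const (1 / (of_nat N)\<^sup>2) * (\<Sum>v\<in>#L. mps_const (if fst v = c then of_nat (snd v) else 0) *
          F N (add_mset (c, k + snd v - 1) (L - {#v#})))
      + r c * moment N (add_mset (c, k + snd w - 1) L)" if N: "N > 0" for N c k L
  proof -
    define S where "S = mps_const (1 / (of_nat N)\<^sup>2) * (\<Sum>v\<in>#L. mps_const (if fst v = c then of_nat (snd v) else 0) *
          moment N (add_mset (c, k + snd v - 1) (L - {#v#})))"
    define S' where "S' = mps_const (1 / (of_nat N)\<^sup>2) * (\<Sum>v\<in>#L. mps_const (if fst v = c then of_nat (snd v) else 0) *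
          moment N (add_mset w (add_mset (c, k + snd v - 1) (L - {#v#}))))"
    have insert: "(\<Sum>v\<in>#add_mset w L. mps_const (if fst v = c then of_nat (snd v) else 0) *
          moment N (add_mset (c, k + snd v - 1) (add_mset w L - {#v#})))
        = r c * moment N (add_mset (c, k + snd w - 1) L) +
          (\<Sum>v\<in>#L. mps_const (if fst v = c then of_nat (snd v) else 0) *
          moment N (add_mset w (add_mset (c, k + snd v - 1) (L - {#v#}))))"
    proof -
      have "image_mset (\<lambda>v. mps_const (if fst v = c then of_nat (snd v) else 0) *
          moment N (add_mset (c, k + snd v - 1) (add_mset w L - {#v#}))) L
        = image_mset (\<lambda>v. mps_const (if fst v = c then of_nat (snd v) else 0) *
          moment N (add_mset w (add_mset (c, k + snd v - 1) (L - {#v#})))) L"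
        by (rule image_mset_cong) (auto dest!: multi_member_split simp: add_mset_commute)
      then show ?thesis by (simp add: r_def)
    qed
    \<comment> \<open>The loop equation is applied once with \<open>w\<close> among the spectators
      and once without it, multiplied by the moment of \<open>w\<close>. In the difference only the
      contraction with \<open>w\<close> has no counterpart.\<close>
    have 1: "moment N (add_mset w (add_mset (c, Suc k) L))
      = (\<Sum>p<k. moment N (add_mset w (add_mset (c, p) (add_mset (c, k - 1 - p) L))))
      + mps_shift (\<lambda>u. coupling N u * of_nat (u c)) (\<lambda>u. moment N (add_mset w (deriv_mset c k u + L)))
      + mps_const (1 / (of_nat N)\<^sup>2) * (r c * moment N (add_mset (c, k + snd w - 1) L)) + S'"
      unfolding S'_def add_mset_commute[of w "(c, Suc k)"] moment_loop_equation[OF N] insert distrib_left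
      by (simp add: add_mset_commute[of w] add.assoc)
    have 2: "moment N {#w#} * moment N (add_mset (c, Suc k) L)
      = (\<Sum>p<k. moment N {#w#} * moment N (add_mset (c, p) (add_mset (c, k - 1 - p) L)))
      + mps_shift (\<lambda>u. coupling N u * of_nat (u c)) (\<lambda>u. moment N {#w#} * moment N (deriv_mset c k u + L))
      + moment N {#w#} * S"
      unfolding S_def moment_loop_equation[OF N] distrib_left mult_mps_shift sum_distrib_left ..
    have 3: "mps_const ((of_nat N)\<^sup>2) * (S' - moment N {#w#} * S)
      = mps_const (1 / (of_nat N)\<^sup>2) * (\<Sum>v\<in>#L. mps_const (if fst v = c then of_nat (snd v) else 0) *
          F N (add_mset (c, k + snd v - 1) (L - {#v#})))"
    proof -
      have "mps_const ((of_nat N)\<^sup>2) * (mps_const (1 / (of_nat N)\<^sup>2) *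
            (\<Sum>v\<in>#M. d v * y v) - z * (mps_const (1 / (of_nat N)\<^sup>2) * (\<Sum>v\<in>#M. d v * y' v)))
          = mps_const (1 / (of_nat N)\<^sup>2) * (\<Sum>v\<in>#M. d v * (mps_const ((of_nat N)\<^sup>2) * (y v - z * y' v)))"
        for M and d y y' :: "'d \<times> nat \<Rightarrow> ('d, complex) mps" and z
        by (induction M) (simp_all add: algebra_simps)
      then show ?thesis unfolding S_def S'_def F_def .
    qed
    have 4: "mps_const ((of_nat N)\<^sup>2) * (mps_const (1 / (of_nat N)\<^sup>2) * y) = y" for y :: "('d, complex) mps"
      using N by (simp add: mult.assoc[symmetric] mps_const_mult[symmetric])
    have "F N (add_mset (c, Suc k) L) = (\<Sum>p<k. F N (add_mset (c, p) (add_mset (c, k - 1 - p) L)))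
      + mps_const ((of_nat N)\<^sup>2) * (mps_shift (\<lambda>u. coupling N u * of_nat (u c)) (\<lambda>u. moment N (add_mset w (deriv_mset c k u + L)))
        - mps_shift (\<lambda>u. coupling N u * of_nat (u c)) (\<lambda>u. moment N {#w#} * moment N (deriv_mset c k u + L)))
      + mps_const ((of_nat N)\<^sup>2) * (S' - moment N {#w#} * S)
      + mps_const ((of_nat N)\<^sup>2) * (mps_const (1 / (of_nat N)\<^sup>2) * (r c * moment N (add_mset (c, k + snd w - 1) L)))"
      unfolding F_def 1 2 by (simp add: algebra_simps sum_distrib_left sum_subtractf)
    then show ?thesis
      unfolding 3 4 mps_shift_diff mult_mps_shift by (simp only: F_def)
  qed
  have zero_F: "F N (add_mset (b, 0) L) = F N L" if "N > 0" for N b L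
    using that by (simp add: F_def add_mset_commute[of w] moment_add_mset_0)
  have empty_F: "F N {#} = 0" if "N > 0" for N
    using that by (simp add: F_def empty)
  have R: "(\<lambda>N. mps_coeff (r c * moment N (add_mset (c, k + snd w - 1) L)) e)
      \<longlonglongrightarrow> mps_coeff (r c * m (add_mset (c, k + snd w - 1) L)) e" for c k L e
    unfolding r_def mps_coeff_const_mult by (intro tendsto_mult tendsto_const m)
  obtain C where C: "\<And>L e. (\<lambda>N. mps_coeff (F N L) e) \<longlonglongrightarrow> mps_coeff (C L) e"
    and C_zero: "\<And>b L. C (add_mset (b, 0) L) = C L" and C_empty: "C {#} = 0"
    and C_loop: "\<And>c k L. C (add_mset (c, Suc k) L)
      = (\<Sum>p<k. C (add_mset (c, p) (add_mset (c, k - 1 - p) L)))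
      + (\<Sum>b\<in>UNIV. mps_var c * mps_var b * C (quad_mset c k b + L))
      + r c * m (add_mset (c, k + snd w - 1) L)"
    using loop_limit[where F = F and R = "\<lambda>N c k L. r c * moment N (add_mset (c, k + snd w - 1) L)"
        and R' = "\<lambda>c k L. r c * m (add_mset (c, k + snd w - 1) L)",
        OF card loop_F zero_F empty_F R] by blast
  have planar_C: "planar_cov v w = C {#v#}" for v
  proof (rule mps_eqI)
    fix e
    have "(\<lambda>N. mps_coeff (cumulant N [v, w]) e / complex_of_real (real N powr 0)) \<longlonglongrightarrow> mps_coeff (C {#v#}) e"
    proof (rule Lim_transform_eventually[OF C])
      show "\<forall>\<^sub>F N in sequentially. mps_coeff (F N {#v#}) e
          = mps_coeff (cumulant N [v, w]) e / complex_of_real (real N powr 0)"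
        using eventually_gt_at_top[of 0]
        by eventually_elim (simp add: cumulant_pair F_def add_mset_commute[of w] mult.commute)
    qed
    from leading_coeff_eqI[OF this] show "mps_coeff (planar_cov v w) e = mps_coeff (C {#v#}) e"
      by (simp add: planar_cov_def planar_cumulant_def)
  qed
  have C_deriv: "C L = (\<Sum>v\<in>#L. C {#v#} * (\<Prod>w\<in>#L - {#v#}. x w))" for L
  proof (rule limit_covariance_derivation[OF C_zero C_empty x0 x_loop, where r = "\<lambda>c k. r c * x (c, k + snd w - 1)"])
    fix c k L
    have "m (add_mset (c, k + snd w - 1) L) = x (c, k + snd w - 1) * (\<Prod>v\<in>#L. x v)"
      by (subst m_prod) (simp add: x_def[abs_def])
    then show "C (add_mset (c, Suc k) L)
      = (\<Sum>p<k. C (add_mset (c, p) (add_mset (c, k - 1 - p) L)))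
      + (\<Sum>b\<in>UNIV. mps_var c * mps_var b * C (quad_mset c k b + L))
      + r c * x (c, k + snd w - 1) * (\<Prod>v\<in>#L. x v)"
      unfolding C_loop by (simp only: mult.assoc)
  qed
  have C_pair: "C {#u, v#} = C {#u#} * x v + x u * C {#v#}" for u v
    unfolding C_deriv[of "{#u, v#}"] sum_mset_add_mset_remove by simp
  show "planar_cov (c, 0) w = 0" by (simp add: planar_C C_zero C_empty)
  show "planar_cov (c, Suc k) w
      = (\<Sum>p<k. planar_cov (c, p) w * planar_moment c (k - 1 - p) + planar_moment c p * planar_cov (c, k - 1 - p) w)
      + (\<Sum>b\<in>UNIV. mps_var c * mps_var b * (if b = c then planar_cov (c, Suc k) w
          else planar_cov (c, k) w * planar_moment b 1 + planar_moment c k * planar_cov (b, 1) w))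
      + (if fst w = c then of_nat (snd w) * planar_moment c (k + snd w - 1) else 0)"
  proof -
    have quad: "C (quad_mset c k b) = (if b = c then C {#(c, Suc k)#} else C {#(c, k)#} * x (b, 1) + x (c, k) * C {#(b, 1)#})" for b
      by (simp add: C_pair)
    have rest: "r c * y = (if fst w = c then of_nat (snd w) * y else 0)" for y
      by (simp add: r_def mps_const_of_nat)
    have "C {#(c, Suc k)#} = (\<Sum>p<k. C {#(c, p), (c, k - 1 - p)#})
      + (\<Sum>b\<in>UNIV. mps_var c * mps_var b * C (quad_mset c k b))
      + r c * x (c, k + snd w - 1)"
      using C_loop[of c k "{#}"] by (simp add: x_def)
    then show ?thesis
      unfolding quad rest C_pair unfolding planar_C planar_m x_def[symmetric] .
  qed
qed

section \<open>Generating functions\<close>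

unbundle no vec_syntax
unbundle fps_syntax

lemma mps_coeff_numeral: "mps_coeff (numeral n) e = (if e = (\<lambda>_. 0) then numeral n else 0)"
  unfolding mps_const_numeral[symmetric] by (rule mps_coeff_const)

subsection \<open>Units of the rings of Laurent series\<close>

text \<open>The predicate on the lowest coefficient is a parameter so that the notion can be
  iterated: units among the power series give units among the Laurent series in 1/x_1, and these
  give units among the series in 1/x_2.\<close>

definition has_lead :: "('a::zero \<Rightarrow> bool) \<Rightarrow> 'a fls \<Rightarrow> bool" where
  "has_lead P g \<longleftrightarrow> (\<exists>d. (\<forall>n<d. g $$ n = 0) \<and> P (g $$ d))"

lemma has_leadI: "(\<And>n. n < d \<Longrightarrow> g $$ n = 0) \<Longrightarrow> P (g $$ d) \<Longrightarrow> has_lead P g"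
  by (auto simp: has_lead_def)

lemma has_lead_subdegree:
  assumes "has_lead P g" "\<And>x. P x \<Longrightarrow> x \<noteq> 0"
  shows "P (g $$ fls_subdegree g)"
proof -
  obtain d where d: "\<And>n. n < d \<Longrightarrow> g $$ n = 0" "P (g $$ d)" using assms(1) by (auto simp: has_lead_def)
  then have "fls_subdegree g = d" by (intro fls_subdegree_eqI assms(2)) auto
  then show ?thesis using d by simp
qed

lemma has_lead_mult:
  fixes f g :: "'a::comm_ring_1 fls"
  assumes "has_lead P f" "has_lead P g" "\<And>x. P x \<Longrightarrow> x \<noteq> 0" "\<And>x y. P x \<Longrightarrow> P y \<Longrightarrow> P (x * y)"
  shows "has_lead P (f * g)"
proof (rule has_leadI)
  show "P ((f * g) $$ (fls_subdegree f + fls_subdegree g))"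
    using assms by (simp add: has_lead_subdegree)
qed (rule fls_times_nth_eq0)

lemma has_lead_const: "P x \<Longrightarrow> has_lead P (fls_const x)"
  by (rule has_leadI[where d = 0]) auto

text \<open>The second fact gives the quotients of the theorem their ring-theoretic meaning:
  division of Laurent series goes through division of their base factors, which is multiplication by
  \<open>inverse\<close> when the lowest coefficient is nonzero.\<close>

lemma has_lead_unit:
  fixes f g :: "'a::{comm_ring_1,inverse} fls"
  assumes "has_lead P g" "\<And>x. P x \<Longrightarrow> x * inverse x = 1"
  shows "g * inverse g = 1" "f / g = f * inverse g"
proof -
  have nz: "x \<noteq> 0" if "P x" for x using assms(2)[OF that] by auto
  have P: "P (g $$ fls_subdegree g)" by (rule has_lead_subdegree[OF assms(1) nz])
  show "g * inverse g = 1"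
    unfolding fls_inverse_def' by (rule fls_right_inverse[OF assms(2)[OF P]])
  have "f div g = fls_shift (fls_subdegree g - fls_subdegree f)
      (fps_to_fls (fls_base_factor_to_fps f * inverse (fls_base_factor_to_fps g)))"
    unfolding fls_divide_def using nz[OF P] by (subst fps_divide_unit) auto
  also have "\<dots> = fls_shift (- fls_subdegree f) (fps_to_fls (fls_base_factor_to_fps f)) *
      fls_shift (fls_subdegree g) (fps_to_fls (inverse (fls_base_factor_to_fps g)))"
    by (simp add: fls_times_fps_to_fls fls_shifted_times_simps)
  also have "fls_shift (- fls_subdegree f) (fps_to_fls (fls_base_factor_to_fps f)) = f"
    by (rule fls_conv_base_factor_to_fps_shift_subdegree[symmetric])
  finally show "f / g = f * inverse g" by (simp add: fls_inverse_def)
qed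

abbreviation mps_unit :: "('v::finite, complex) mps \<Rightarrow> bool" where
  "mps_unit s \<equiv> mps_coeff s (\<lambda>_. 0) \<noteq> 0"

abbreviation unit1 :: "('d::finite) fun1 \<Rightarrow> bool" where
  "unit1 \<equiv> has_lead mps_unit"

abbreviation unit2 :: "('d::finite) fun2 \<Rightarrow> bool" where
  "unit2 \<equiv> has_lead unit1"

lemma unit1_inverse: "unit1 g \<Longrightarrow> g * inverse g = 1"
  by (erule has_lead_unit) (rule mps_unitI)

lemma unit2_inverse: "unit2 g \<Longrightarrow> g * inverse g = 1"
  by (erule has_lead_unit) (rule unit1_inverse)

lemma unit2_divide: "unit2 g \<Longrightarrow> f / g = f * inverse g"
  by (erule has_lead_unit) (rule unit1_inverse)

lemma unit1_mult: "unit1 f \<Longrightarrow> unit1 g \<Longrightarrow> unit1 (f * g)"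
  by (rule has_lead_mult) auto

lemma unit1_nonzero: "unit1 f \<Longrightarrow> f \<noteq> 0"
  by (auto simp: has_lead_def)

lemma unit2_mult: "unit2 f \<Longrightarrow> unit2 g \<Longrightarrow> unit2 (f * g)"
  by (erule (1) has_lead_mult) (rule unit1_nonzero unit1_mult; assumption)+

lemma unit_cancel:
  fixes y :: "'a::comm_ring_1"
  assumes "y * y' = 1" "y * a = y * b"
  shows "a = b"
proof -
  have "y' * (y * a) = y' * (y * b)" using assms(2) by simp
  then show ?thesis using assms(1) by (simp add: mult.assoc[symmetric] mult.commute[of y'])
qed

subsection \<open>The second variable\<close>

lemma in_x2_nth [simp]: "in_x2 f $$ n = fls_const (f $$ n)"
  unfolding in_x2_def by (rule nth_Abs_fls_lower_bound[where N = "fls_subdegree f"]) auto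

lemma in_x2_diff: "in_x2 (f - g) = in_x2 f - in_x2 g"
  by (rule fls_eqI) (simp add: fls_minus_const)

lemma in_x2_const: "in_x2 (fls_const s) = fls_const (fls_const s)"
  by (rule fls_eqI) auto

lemma in_x2_0 [simp]: "in_x2 0 = 0"
  by (rule fls_eqI) auto

lemma in_x2_X_inv: "in_x2 fls_X_inv = fls_X_inv"
  by (rule fls_eqI) auto

lemma fls_const_sum: "fls_const (sum f A) = (\<Sum>x\<in>A. fls_const (f x))"
  by (induction A rule: infinite_finite_induct) (auto simp: fls_plus_const[symmetric])

lemma in_x2_mult: "in_x2 (f * g) = in_x2 f * in_x2 g"
proof (rule fls_eqI)
  fix n
  have sd: "fls_subdegree (in_x2 f) = fls_subdegree f" for f :: "('a, complex) mps fls"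
  proof (cases "f = 0")
    case False
    then show ?thesis by (intro fls_subdegree_eqI) auto
  qed simp
  show "in_x2 (f * g) $$ n = (in_x2 f * in_x2 g) $$ n"
    by (simp add: fls_times_nth(2) sd fls_const_sum)
qed

subsection \<open>Expansions at infinity\<close>

text \<open>The expansion at infinity of a resolvent with moments \<open>g\<close>; the leading
  factor accounts for the exponent k + 1 in g k / x^(k+1).\<close>

definition gen :: "(nat \<Rightarrow> 'a) \<Rightarrow> 'a::comm_ring_1 fls" where
  "gen g = fls_X * fps_to_fls (Abs_fps g)"

lemma gen_nth: "gen g $$ n = (if n \<ge> 1 then g (nat (n - 1)) else 0)"
  by (simp add: gen_def fls_X_times_conv_shift)

lemma gen_add: "gen (\<lambda>n. g n + h n) = gen g + gen h"
  and gen_diff: "gen (\<lambda>n. g n - h n) = gen g - gen h"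
  and gen_cmult: "gen (\<lambda>n. c * g n) = fls_const c * gen g"
  by (rule fls_eqI; simp add: gen_nth)+

text \<open>The exponents p + 1 and q + 1 add up to k + 1 when q = k - 1 - p, which is the pattern
  of the splitting term in the loop equations.\<close>

lemma gen_mult: "gen g * gen h = gen (\<lambda>k. \<Sum>p<k. g p * h (k - 1 - p))"
proof -
  have "Abs_fps (\<lambda>k. \<Sum>p<k. g p * h (k - 1 - p)) = fps_X * (Abs_fps g * Abs_fps h)"
  proof (rule fps_ext)
    fix n
    show "Abs_fps (\<lambda>k. \<Sum>p<k. g p * h (k - 1 - p)) $ n = (fps_X * (Abs_fps g * Abs_fps h)) $ n"
      by (cases n) (simp_all add: fps_X_mult_nth fps_mult_nth[of "Abs_fps g"] lessThan_Suc_atMost atLeast0AtMost)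
  qed
  then show ?thesis
    by (simp add: gen_def fls_times_fps_to_fls mult_ac)
qed

text \<open>Multiplication by x shifts the moments, which is how the argument \<open>Suc k\<close>
  of a loop equation is produced; the zeroth moment becomes the polynomial part.\<close>

lemma X_inv_mult_gen: "fls_X_inv * gen g = fls_const (g 0) + gen (\<lambda>n. g (Suc n))"
proof (rule fls_eqI)
  fix n :: int
  consider "n < 0" | "n = 0" | "n > 0" by linarith
  then show "(fls_X_inv * gen g) $$ n = (fls_const (g 0) + gen (\<lambda>n. g (Suc n))) $$ n"
  proof cases
    case 3
    then have "Suc (nat (n - 1)) = nat n" by simp
    then show ?thesis using 3 by (simp add: fls_X_inv_times_conv_shift gen_nth)
  qed (simp_all add: fls_X_inv_times_conv_shift gen_nth)
qed

lemma in_x2_gen: "in_x2 (gen h) = gen (\<lambda>l. fls_const (h l))"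
  by (rule fls_eqI) (simp add: gen_nth)

definition gen2 :: "(nat \<Rightarrow> nat \<Rightarrow> ('d::finite, complex) mps) \<Rightarrow> 'd fun2" where
  "gen2 f = gen (\<lambda>l. gen (\<lambda>k. f k l))"

lemma W1_eq: "W1 c = gen (planar_moment c)"
  by (simp add: W1_def gen_def planar_moment_def[abs_def])

lemma W2_eq: "W2 i j = gen2 (\<lambda>k l. planar_cov (i, k) (j, l))"
  by (simp add: W2_def gen2_def gen_def planar_cov_def)

lemma gen2_add: "gen2 (\<lambda>k l. f k l + g k l) = gen2 f + gen2 g"
  and gen2_diff: "gen2 (\<lambda>k l. f k l - g k l) = gen2 f - gen2 g"
  by (simp_all add: gen2_def gen_add gen_diff)

lemma gen2_cmult: "gen2 (\<lambda>k l. s * f k l) = scalar2 s * gen2 f"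
  by (simp add: gen2_def gen_cmult)

lemma gen2_product: "gen2 (\<lambda>k l. g k * h l) = in_x1 (gen g) * in_x2 (gen h)"
proof -
  have "gen (\<lambda>k. g k * h l) = gen g * fls_const (h l)" for l
    by (simp add: mult.commute[of "g _"] mult.commute[of "gen g"] gen_cmult)
  then show ?thesis by (simp add: gen2_def in_x2_gen gen_cmult)
qed

lemma in_x1_gen_mult_gen2: "in_x1 (gen g) * gen2 f = gen2 (\<lambda>k l. \<Sum>p<k. g p * f (k - 1 - p) l)"
  by (simp add: gen2_def gen_cmult[symmetric] gen_mult)

lemma x1_mult_gen2: "in_x1 var_x * gen2 f = in_x2 (gen (f 0)) + gen2 (\<lambda>k l. f (Suc k) l)"
  by (simp add: gen2_def gen_cmult[symmetric] X_inv_mult_gen gen_add in_x2_gen)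

lemma x2_mult_gen2: "in_x2 var_x * gen2 f = in_x1 (gen (\<lambda>k. f k 0)) + gen2 (\<lambda>k l. f k (Suc l))"
  by (simp add: gen2_def in_x2_X_inv X_inv_mult_gen)

subsection \<open>The one-point functions\<close>

text \<open>Completing the square in the quadratic equation, with \<open>b\<close> as the inverse of
  \<open>B\<close>. The first identity exhibits the difference of the two sides as a combination of
  the hypotheses.\<close>

lemma sigma_identities:
  fixes x W B b :: "'a::comm_ring_1"
  assumes "W ^ 2 - B * x * W + B = 0" "B * b = 1"
  shows "(x - 2 * b * W) ^ 2 = x ^ 2 - 4 * b" "B * (x - 2 * b * W) = B * x - 2 * W"
proof -
  have "(x - 2 * b * W) ^ 2 - (x ^ 2 - 4 * b)
      = 4 * b ^ 2 * (W ^ 2 - B * x * W + B) + (4 * b * x * W - 4 * b) * (B * b - 1)"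
    by (simp add: algebra_simps power2_eq_square)
  then show "(x - 2 * b * W) ^ 2 = x ^ 2 - 4 * b" using assms by simp
  have "B * (x - 2 * b * W) = B * x - 2 * (B * b) * W"
    by (simp add: algebra_simps)
  then show "B * (x - 2 * b * W) = B * x - 2 * W" using assms by simp
qed

text \<open>In the application \<open>p\<close> is the covariance of tr M_i^(k+1) with the fixed
  trace, \<open>t\<close> the covariance of the weighted sum of all traces of first powers, and
  \<open>a * t + y\<close> that of tr M_i. The other colors contribute the full sum minus the term
  of color i.\<close>

lemma collect_linear_terms:
  fixes p :: "'a::comm_ring_1"
  assumes "p = q + (a\<^sup>2 * p + a * (m * (t - a * (a * t + y)))) + r"
  shows "(1 - a\<^sup>2) * p = q + a * (1 - a\<^sup>2) * (m * t) + (r - a\<^sup>2 * (m * y))"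
proof -
  have "(1 - a\<^sup>2) * p = p - a\<^sup>2 * p" by (simp add: left_diff_distrib)
  also have "\<dots> = q + a * (m * (t - a * (a * t + y))) + r"
    by (subst (1) assms) simp
  finally show ?thesis by (simp add: algebra_simps power2_eq_square)
qed

text \<open>\<open>D\<close> is the derivative of \<open>W\<close> with respect to z = 1/x, so -
  dW/dx is \<open>z ^ 2 * D\<close>. The first hypothesis is the differentiated quadratic equation,
  in which dx/dz = - x^2.\<close>

lemma sigma_derivative_identity:
  fixes z x W D B s :: "'a::comm_ring_1"
  assumes "2 * W * D - B * (x * D - x ^ 2 * W) = 0" "z * x = 1" "B * s = B * x - 2 * W"
  shows "B * (z ^ 2 * D * s) = B * W"
proof -
  have "B * (z ^ 2 * D * s) - B * W = z ^ 2 * D * (B * s - (B * x - 2 * W))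
      - z ^ 2 * (2 * W * D - B * (x * D - x ^ 2 * W)) + B * W * ((z * x + 1) * (z * x - 1)) "
    by (simp add: algebra_simps power2_eq_square)
  then show ?thesis using assms by simp
qed

context
  assumes card: "CARD('d::finite) \<ge> 3"
begin

abbreviation (input) "al (c :: 'd) \<equiv> (mps_var c :: ('d, complex) mps)"
abbreviation (input) "be (c :: 'd) \<equiv> 1 - (mps_var c :: ('d, complex) mps)\<^sup>2"

lemma unit_be: "mps_unit (be c)"
  by (simp add: mps_coeff_one power2_eq_square mps_coeff_var_0)

lemma be_inverse: "be c * inverse (be c) = 1"
  by (rule mps_unitI[OF unit_be])

lemma unit_norm2: "mps_unit ((norm2 :: ('d, complex) mps) - 1)"
  by (simp only: mps_coeff_diff coeff_norm2_0) (simp add: mps_coeff_one)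

text \<open>At \<open>k = 0\<close> the first moments satisfy a homogeneous linear system of rank
  one: each is \<alpha>_c times the same \<open>t\<close>. Contracting with the parameters gives
  \<open>(norm2 - 1) * t = 0\<close>, and \<open>norm2 - 1\<close> is a unit with constant term
  -1.\<close>

lemma planar_moment_1: "planar_moment (c :: 'd) 1 = 0"
proof -
  define t where "t = (\<Sum>b\<in>UNIV. al b * planar_moment b 1)"
  have m1: "planar_moment c 1 = al c * t" for c :: 'd
  proof -
    have "planar_moment c 1 = (\<Sum>b\<in>UNIV. al c * al b * (if b = c then planar_moment c 1
        else planar_moment b 1))"
      using planar_loop_equations(2)[OF card, of c 0] planar_loop_equations(1)[OF card, of c]
      by (simp cong: if_cong)
    also have "\<dots> = (\<Sum>b\<in>UNIV. al c * (al b * planar_moment b 1))"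
      by (intro sum.cong) (auto simp: mult.assoc)
    finally show ?thesis by (simp add: t_def sum_distrib_left)
  qed
  have "t = (\<Sum>b\<in>UNIV. al b * (al b * t))"
    by (subst t_def) (simp only: m1)
  also have "\<dots> = norm2 * t"
    by (simp add: sum_distrib_right power2_eq_square mult.assoc)
  finally have "norm2 * t = t" by (rule sym)
  then have "(norm2 - 1) * t = (norm2 - 1) * 0"
    by (simp only: left_diff_distrib mult_1_left mult_zero_right diff_self)
  then have "t = 0" by (rule unit_cancel[OF mps_unitI[OF unit_norm2]])
  then show ?thesis by (simp only: m1 mult_zero_right)
qed

lemma sum_split_color:
  fixes f :: "'d \<Rightarrow> ('d, complex) mps"
  shows "(\<Sum>b\<in>UNIV. al c * al b * (if b = c then y else f b))
    = (al c)\<^sup>2 * y + al c * (\<Sum>b\<in>UNIV - {c}. al b * f b)"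
proof -
  have "(\<Sum>b\<in>UNIV - {c}. al c * al b * (if b = c then y else f b)) = (\<Sum>b\<in>UNIV - {c}. al c * (al b * f b))"
    by (rule sum.cong) (auto simp: mult.assoc)
  then show ?thesis by (simp add: sum.remove[of UNIV c] power2_eq_square sum_distrib_left)
qed

text \<open>Vanishing first moments decouple the colors, and the equal-color coupling moves to the
  left. What remains is the semicircle recursion with variance 1 / (1 - \<alpha>_c^2).\<close>

lemma planar_moment_Suc:
  "be c * planar_moment (c :: 'd) (Suc k) = (\<Sum>p<k. planar_moment c p * planar_moment c (k - 1 - p))"
  using planar_loop_equations(2)[OF card, of c k]
  unfolding planar_moment_1 sum_split_color by (simp add: algebra_simps)

lemma W1_quadratic:
  "W1 c ^ 2 - scalar1 (be c) * var_x * W1 c + scalar1 (be c) = 0"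
proof -
  have "var_x * W1 c = 1 + gen (\<lambda>k. planar_moment c (Suc k))"
    using planar_loop_equations(1)[OF card, of c] by (simp add: W1_eq X_inv_mult_gen)
  then have "scalar1 (be c) * (var_x * W1 c) = scalar1 (be c) + gen (\<lambda>k. be c * planar_moment c (Suc k))"
    by (simp only: distrib_left mult_1_right gen_cmult)
  also have "gen (\<lambda>k. be c * planar_moment c (Suc k)) = W1 c ^ 2"
    by (simp only: planar_moment_Suc W1_eq power2_eq_square[of "gen _"] gen_mult)
  finally show ?thesis by (simp add: mult.assoc)
qed

lemma sigma_eq: "sigma c = var_x - scalar1 (2 * inverse (be c)) * W1 c"
proof -
  define s where "s = var_x - scalar1 (2 * inverse (be c)) * W1 c"
  define b where "b = inverse (be c)"
  have b: "scalar1 (be c) * scalar1 b = 1"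
    by (simp only: fls_const_mult_const b_def be_inverse fls_const_1)
  have four: "scalar1 (4 / (be c)) = 4 * scalar1 b" and two: "scalar1 (2 * inverse (be c)) = 2 * scalar1 b"
    by (simp_all add: divide_mps_def b_def fls_const_mult_const[symmetric] del: fls_const_mult_const)
  have sq: "s ^ 2 = var_x ^ 2 - scalar1 (4 / be c)"
    unfolding s_def four two by (rule sigma_identities(1)[OF W1_quadratic b])
  have lead: "\<forall>n < -1. s $$ n = 0" "s $$ (-1) = 1"
    by (auto simp: s_def W1_eq gen_nth)
  \<comment> \<open>Two roots with leading term x have a sum with leading coefficient 2, a unit, so
    their difference vanishes.\<close>
  have uniq: "t = s" if t: "t ^ 2 = var_x ^ 2 - scalar1 (4 / be c)" "\<forall>n < -1. t $$ n = 0" "t $$ (-1) = 1" for t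
  proof -
    have "unit1 (s + t)"
      by (rule has_leadI[where d = "-1"]) (use lead t in \<open>auto simp: mps_coeff_numeral\<close>)
    moreover have "(s + t) * t = (s + t) * s"
    proof -
      have "s ^ 2 = t ^ 2" using sq t(1) by simp
      then show ?thesis by (simp add: algebra_simps power2_eq_square)
    qed
    ultimately show ?thesis by (rule unit_cancel[OF unit1_inverse])
  qed
  have "sigma c = s"
    unfolding sigma_def by (rule the_equality) (use sq lead uniq in blast)+
  then show ?thesis by (simp add: s_def)
qed

lemma sigma_sq: "sigma (c :: 'd) ^ 2 = var_x ^ 2 - scalar1 (4 * inverse (be c))"
proof -
  have b: "scalar1 (be c) * scalar1 (inverse (be c)) = 1"
    by (simp only: fls_const_mult_const be_inverse fls_const_1)
  have two: "scalar1 (2 * inverse (be c)) = 2 * scalar1 (inverse (be c))"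
    and four: "scalar1 (4 * inverse (be c)) = 4 * scalar1 (inverse (be c))"
    by (simp_all add: fls_const_mult_const[symmetric] del: fls_const_mult_const)
  show ?thesis unfolding sigma_eq two four by (rule sigma_identities(1)[OF W1_quadratic b])
qed

lemma scalar_mult_sigma: "scalar1 (be c) * sigma c = scalar1 (be c) * var_x - 2 * W1 c"
proof -
  have b: "scalar1 (be c) * scalar1 (inverse (be c)) = 1"
    by (simp only: fls_const_mult_const be_inverse fls_const_1)
  have two: "scalar1 (2 * inverse (be c)) = 2 * scalar1 (inverse (be c))"
    by (simp_all add: fls_const_mult_const[symmetric] del: fls_const_mult_const)
  show ?thesis unfolding sigma_eq two by (rule sigma_identities(2)[OF W1_quadratic b])
qed

lemma W1_explicit: "W1 c = scalar1 (be c / 2) * (var_x - sigma c)"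
proof -
  have "be c / 2 * (2 * inverse (be c)) = (be c * inverse (be c)) * (2 * inverse 2)"
    by (simp only: divide_mps_def mult_ac)
  also have "\<dots> = 1"
    using mps_unitI[of "2 :: ('d, complex) mps"]
    by (simp only: be_inverse) (simp add: mps_const_numeral[symmetric] mps_coeff_const)
  finally have "scalar1 (be c / 2) * scalar1 (2 * inverse (be c)) = 1"
    by (simp only: fls_const_mult_const fls_const_1)
  then show ?thesis by (simp only: sigma_eq diff_diff_eq2 add_diff_cancel_left' mult.assoc[symmetric]) simp
qed

lemma unit1_sigma: "unit1 (sigma (c :: 'd))"
  by (rule has_leadI[where d = "-1"]) (auto simp: sigma_eq W1_eq gen_nth mps_coeff_one)

text \<open>The series \<open>- W1'\<close>, the derivative being taken with respect to \<open>x\<close>.\<close>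

definition neg_deriv :: "'d \<Rightarrow> 'd fun1" where
  "neg_deriv c = gen (\<lambda>l. of_nat l * planar_moment c (l - 1))"

lemma neg_deriv_sigma: "neg_deriv c * sigma c = W1 c"
proof -
  define D where "D = fls_deriv (W1 c)"
  \<comment> \<open>\<open>fls_deriv\<close> differentiates with respect to 1/x; the factor
    \<open>fls_X ^ 2\<close> is the chain rule.\<close>
  have V: "neg_deriv c = fls_X ^ 2 * D"
  proof (rule fls_eqI)
    fix n :: int
    consider "n \<le> 0" | "n = 1" | "n \<ge> 2" by linarith
    then show "neg_deriv c $$ n = (fls_X ^ 2 * D) $$ n"
    proof cases
      case 3
      then have "nat (n - 1) - 1 = nat (n - 2)" by simp
      moreover have "(of_nat (nat (n - 1)) :: ('d, complex) mps) = of_int (n - 1)"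
        using 3 by (simp add: of_nat_nat)
      ultimately show ?thesis using 3
        by (simp add: neg_deriv_def D_def W1_eq gen_nth fls_X_power_times_conv_shift)
    qed (auto simp: neg_deriv_def D_def W1_eq gen_nth fls_X_power_times_conv_shift)
  qed
  have X: "fls_X * fls_X_inv = (1 :: 'd fun1)" by (simp add: fls_X_times_conv_shift)
  have "fls_deriv (W1 c ^ 2 - scalar1 (be c) * var_x * W1 c + scalar1 (be c)) = 0"
    by (simp only: W1_quadratic fls_deriv_zero)
  then have "2 * W1 c * D - scalar1 (be c) * (var_x * D - var_x ^ 2 * W1 c) = 0"
    by (simp add: D_def power2_eq_square algebra_simps)
  then have "scalar1 (be c) * (neg_deriv c * sigma c) = scalar1 (be c) * W1 c"
    unfolding V by (rule sigma_derivative_identity[OF _ X scalar_mult_sigma])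
  moreover have "scalar1 (be c) * scalar1 (inverse (be c)) = 1"
    by (simp only: fls_const_mult_const be_inverse fls_const_1)
  ultimately show ?thesis by (metis unit_cancel)
qed

subsection \<open>The two-point functions\<close>

text \<open>The derivative with respect to x_2 of the divided difference (W(x_1) - W(x_2)) / (x_1 -
  x_2): the generating function of the contraction with the fixed trace.\<close>

definition kernel :: "'d \<Rightarrow> 'd fun2" where
  "kernel c = gen2 (\<lambda>k l. of_nat l * planar_moment c (k + l - 1))"

text \<open>The Hankel series \<open>H\<close> of the moments at k + l is changed by x_1 and by x_2
  in the same way up to boundary terms, so x_1 - x_2 reduces it to one-variable functions. The
  kernel is reduced to \<open>H\<close> likewise, which explains the square.\<close>

lemma kernel_eq:
  "(in_x1 var_x - in_x2 var_x) ^ 2 * kernel c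
    = in_x1 (W1 c) - in_x2 (W1 c) + (in_x1 var_x - in_x2 var_x) * in_x2 (neg_deriv c)"
proof -
  define H where "H = gen2 (\<lambda>k l. planar_moment c (k + l))"
  have "(in_x1 var_x - in_x2 var_x) * H = in_x2 (W1 c) - in_x1 (W1 c)"
    unfolding H_def left_diff_distrib x1_mult_gen2 x2_mult_gen2 W1_eq by simp
  moreover have "(in_x1 var_x - in_x2 var_x) * kernel c = in_x2 (neg_deriv c) - H"
  proof -
    have "gen2 (\<lambda>k l. of_nat l * planar_moment c (k + l)) - gen2 (\<lambda>k l. of_nat (Suc l) * planar_moment c (k + l)) = - H"
      unfolding gen2_diff[symmetric] H_def
      by (simp add: gen2_def distrib_right) (rule fls_eqI, simp add: gen_nth, rule impI, rule fls_eqI, simp add: gen_nth)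
    moreover have "gen (\<lambda>k. 0 * f k) = (0 :: ('d, complex) mps fls)" for f :: "nat \<Rightarrow> ('d, complex) mps"
      by (rule fls_eqI) (simp add: gen_nth)
    ultimately show ?thesis
      unfolding kernel_def left_diff_distrib x1_mult_gen2 x2_mult_gen2 neg_deriv_def by (simp add: algebra_simps)
  qed
  ultimately have "(in_x1 var_x - in_x2 var_x) * ((in_x1 var_x - in_x2 var_x) * kernel c)
      = (in_x1 var_x - in_x2 var_x) * in_x2 (neg_deriv c) - (in_x2 (W1 c) - in_x1 (W1 c))"
    by (simp only: right_diff_distrib)
  then show ?thesis by (simp add: power2_eq_square mult.assoc)
qed

text \<open>Other colors enter only through \<open>T l\<close>, the covariance of the sum of the
  \<alpha>_b tr M_b with tr M_j^l. The case \<open>k = 0\<close> expresses the individual terms by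
  \<open>T l\<close>, and summing them gives a scalar equation for it.\<close>

lemma planar_cov_Suc:
  fixes i j :: 'd
  defines "T \<equiv> \<lambda>l. \<Sum>b\<in>UNIV. al b * planar_cov (b, 1) (j, l)"
  defines "v \<equiv> \<lambda>l. of_nat l * planar_moment j (l - 1)"
  shows "be i * planar_cov (i, Suc k) (j, l)
    = 2 * (\<Sum>p<k. planar_moment i p * planar_cov (i, k - 1 - p) (j, l))
    + (al i * be i) * (planar_moment i k * T l)
    + (if i = j then of_nat l * planar_moment i (k + l - 1) - (al i)\<^sup>2 * (planar_moment i k * v l) else 0)"
    and "(norm2 - 1) * T l = - (al j * v l)"
proof -
  have eq: "planar_cov (i, Suc k) (j, l)
      = (\<Sum>p<k. planar_cov (i, p) (j, l) * planar_moment i (k - 1 - p) + planar_moment i p * planar_cov (i, k - 1 - p) (j, l))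
      + ((al i)\<^sup>2 * planar_cov (i, Suc k) (j, l) + al i * (\<Sum>b\<in>UNIV - {i}. al b * (planar_moment i k * planar_cov (b, 1) (j, l))))
      + (if i = j then of_nat l * planar_moment i (k + l - 1) else 0)" for i k
    using planar_loop_equations(4)[OF card, of i k "(j, l)"]
    unfolding planar_moment_1 mult_zero_right add_0_left sum_split_color fst_conv snd_conv
    by (simp only: eq_commute[of j i])
  have others: "(\<Sum>b\<in>UNIV - {i}. al b * planar_cov (b, 1) (j, l)) = T l - al i * planar_cov (i, 1) (j, l)" for i
    by (simp add: T_def sum.remove[of UNIV i])
  \<comment> \<open>The equal-color coupling cancels against the term subtracted from
    \<open>T l\<close> in \<open>others\<close>, so no division is required.\<close>
  have one: "planar_cov (i, 1) (j, l) = al i * T l + (if i = j then v l else 0)" for i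
    using eq[of i 0] planar_loop_equations(1)[OF card, of i]
    by (simp add: others[of i, simplified] v_def power2_eq_square algebra_simps)
  show "(norm2 - 1) * T l = - (al j * v l)"
  proof -
    have "T l = (\<Sum>b\<in>UNIV. al b ^ 2 * T l + (if b = j then al j * v l else 0))"
    proof (subst T_def, rule sum.cong[OF refl])
      fix b
      show "al b * planar_cov (b, 1) (j, l) = al b ^ 2 * T l + (if b = j then al j * v l else 0)"
        by (cases "b = j")
           (simp_all only: one if_True if_False refl distrib_left power2_eq_square mult.assoc add_0_right)
    qed
    also have "\<dots> = norm2 * T l + al j * v l"
      by (simp add: sum.distrib sum_distrib_right)
    finally have "T l - norm2 * T l = al j * v l"
      by (simp only: diff_eq_eq add.commute)
    then show ?thesis
      by (simp only: left_diff_distrib mult_1_left) (simp only: minus_diff_eq[of "T l", symmetric])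
  qed
  \<comment> \<open>Both halves of the Leibniz rule agree after reversing the sum, whence the factor
    2.\<close>
  have "(\<Sum>p<k. planar_cov (i, p) (j, l) * planar_moment i (k - 1 - p))
      = (\<Sum>p<k. planar_moment i p * planar_cov (i, k - 1 - p) (j, l))"
    by (rule sum.reindex_bij_witness[where i = "\<lambda>p. k - 1 - p" and j = "\<lambda>p. k - 1 - p"]) (auto simp: mult.commute)
  then have sum2: "(\<Sum>p<k. planar_cov (i, p) (j, l) * planar_moment i (k - 1 - p) + planar_moment i p * planar_cov (i, k - 1 - p) (j, l))
      = 2 * (\<Sum>p<k. planar_moment i p * planar_cov (i, k - 1 - p) (j, l))"
    by (simp add: sum.distrib)
  have "(\<Sum>b\<in>UNIV - {i}. al b * (planar_moment i k * planar_cov (b, 1) (j, l)))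
      = planar_moment i k * (T l - al i * (al i * T l + (if i = j then v l else 0)))"
    unfolding one[symmetric] others[symmetric] by (simp add: sum_distrib_left mult_ac)
  note eq[of i k, unfolded sum2 this]
  from collect_linear_terms[OF this] show "be i * planar_cov (i, Suc k) (j, l)
    = 2 * (\<Sum>p<k. planar_moment i p * planar_cov (i, k - 1 - p) (j, l))
    + (al i * be i) * (planar_moment i k * T l)
    + (if i = j then of_nat l * planar_moment i (k + l - 1) - (al i)\<^sup>2 * (planar_moment i k * v l) else 0)"
    by (cases "i = j") (simp_all only: if_True if_False refl mult_zero_right diff_zero)
qed

text \<open>The splitting term is 2 W_i(x_1) W_ij. Together with the factor (1 - \<alpha>_i^2) x_1
  on the left it forms (1 - \<alpha>_i^2) \<sigma>_i(x_1), by the quadratic equation of the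
  one-point function.\<close>

lemma W2_equation:
  fixes i j :: 'd
  obtains T where
    "scalar2 (be i) * in_x1 (sigma i) * W2 i j
      = scalar2 (al i * be i) * (in_x1 (W1 i) * in_x2 T)
      + (if i = j then kernel i - scalar2 ((al i)\<^sup>2) * (in_x1 (W1 i) * in_x2 (neg_deriv i)) else 0)"
    "scalar2 (norm2 - 1) * in_x2 T = - (scalar2 (al j) * in_x2 (neg_deriv j))"
proof -
  define t where "t l = (\<Sum>b\<in>UNIV. al b * planar_cov (b, 1) (j, l))" for l
  define K where "K k l = planar_cov (i, k) (j, l)" for k l
  have K0: "gen (K 0) = 0"
    using planar_loop_equations(3)[OF card, of i] by (auto intro!: fls_eqI simp: gen_nth K_def)
  have W: "W2 i j = gen2 K" by (simp add: W2_eq K_def[abs_def])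
  have "scalar2 (be i) * (in_x1 var_x * W2 i j) = gen2 (\<lambda>k l. be i * K (Suc k) l)"
    unfolding W x1_mult_gen2 K0 gen2_cmult by simp
  also have "(\<lambda>k l. be i * K (Suc k) l) = (\<lambda>k l. 2 * (\<Sum>p<k. planar_moment i p * K (k - 1 - p) l)
    + (al i * be i) * (planar_moment i k * t l)
    + (if i = j then of_nat l * planar_moment i (k + l - 1) - (al i)\<^sup>2 * (planar_moment i k * (of_nat l * planar_moment j (l - 1))) else 0))"
    unfolding K_def t_def by (intro ext) (rule planar_cov_Suc(1))
  also have "gen2 \<dots> = scalar2 2 * (in_x1 (W1 i) * W2 i j) + scalar2 (al i * be i) * (in_x1 (W1 i) * in_x2 (gen t))
      + (if i = j then kernel i - scalar2 ((al i)\<^sup>2) * (in_x1 (W1 i) * in_x2 (neg_deriv i)) else 0)"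
  proof -
    have zero: "gen2 (\<lambda>k l. 0) = (0 :: 'd fun2)"
      using gen2_cmult[of 0] by simp
    have "gen2 (\<lambda>k l. if i = j then of_nat l * planar_moment i (k + l - 1) -
        (al i)\<^sup>2 * (planar_moment i k * (of_nat l * planar_moment j (l - 1))) else 0)
      = (if i = j then kernel i - scalar2 ((al i)\<^sup>2) * (in_x1 (W1 i) * in_x2 (neg_deriv i)) else 0)"
      by (cases "i = j") (simp_all only: if_True if_False refl zero gen2_diff gen2_cmult gen2_product W1_eq neg_deriv_def kernel_def)
    then show ?thesis
      by (simp only: gen2_add gen2_cmult gen2_product in_x1_gen_mult_gen2 W W1_eq)
  qed
  finally have 1: "scalar2 (be i) * (in_x1 var_x * W2 i j) = scalar2 2 * (in_x1 (W1 i) * W2 i j) + scalar2 (al i * be i) * (in_x1 (W1 i) * in_x2 (gen t))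
      + (if i = j then kernel i - scalar2 ((al i)\<^sup>2) * (in_x1 (W1 i) * in_x2 (neg_deriv i)) else 0)" .
  have "scalar2 (be i) * in_x1 (sigma i) = in_x1 (scalar1 (be i) * var_x - 2 * W1 i)"
    by (simp only: fls_const_mult_const scalar_mult_sigma)
  also have "\<dots> = scalar2 (be i) * in_x1 var_x - scalar2 2 * in_x1 (W1 i)"
    by (simp add: fls_minus_const[symmetric] fls_const_mult_const[symmetric] del: fls_const_mult_const)
  finally have 2: "scalar2 (be i) * in_x1 (sigma i) * W2 i j
      = scalar2 (be i) * (in_x1 var_x * W2 i j) - scalar2 2 * (in_x1 (W1 i) * W2 i j)"
    by (simp only: left_diff_distrib mult.assoc)
  have 3: "scalar2 (norm2 - 1) * in_x2 (gen t) = - (scalar2 (al j) * in_x2 (neg_deriv j))"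
  proof -
    have "fls_const (norm2 - 1) * gen t = gen (\<lambda>l. - (al j * (of_nat l * planar_moment j (l - 1))))"
      unfolding gen_cmult[symmetric] t_def by (simp only: planar_cov_Suc(2))
    also have "\<dots> = 0 - fls_const (al j) * neg_deriv j"
      unfolding neg_deriv_def gen_cmult[symmetric] by (rule fls_eqI) (simp add: gen_nth)
    finally have "in_x2 (fls_const (norm2 - 1) * gen t) = in_x2 (0 - fls_const (al j) * neg_deriv j)"
      by (rule arg_cong)
    then show ?thesis unfolding in_x2_mult in_x2_diff in_x2_const by simp
  qed
  show ?thesis
    by (rule that[OF _ 3]) (simp only: 2 1 add_diff_cancel_left' add.assoc)
qed

end

text \<open>\<open>P\<close> stands for W_ij, \<open>t\<close> for the unknown total covariance and
  \<open>N\<close> for \<open>norm2 - 1\<close>. Multiplying by \<open>N * s2\<close> makes the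
  equations for \<open>t\<close> and for the derivative \<open>v\<close> applicable.\<close>

lemma two_point_offdiagonal:
  fixes P :: "'a::comm_ring_1"
  assumes B: "B * b = 1" and u: "N * u = 1" and h: "s1 * s2 * h = 1"
    and P: "B * s1 * P = a * B * (w1 * t)" and t: "N * t = - (a' * v)" and v: "v * s2 = w2"
  shows "P = - (a * a' * u) * (w1 * w2 * h)"
proof (rule unit_cancel)
  have "(B * (s1 * s2) * N) * (b * h * u) = (B * b) * (N * u) * (s1 * s2 * h)" by (simp only: mult_ac)
  then show "(B * (s1 * s2) * N) * (b * h * u) = 1" using B u h by simp
  have "(B * (s1 * s2) * N) * P = N * s2 * (B * s1 * P)" by (simp only: mult_ac)
  also have "\<dots> = a * B * w1 * s2 * (N * t)" unfolding P by (simp only: mult_ac)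
  also have "\<dots> = - (a * a' * B * w1 * (v * s2))" unfolding t by (simp add: mult_ac)
  also have "\<dots> = - (a * a' * B * w1 * w2) * (N * u) * (s1 * s2 * h)" unfolding u v h by simp
  also have "\<dots> = (B * (s1 * s2) * N) * (- (a * a' * u) * (w1 * w2 * h))" by (simp add: mult_ac)
  finally show "(B * (s1 * s2) * N) * P = (B * (s1 * s2) * N) * (- (a * a' * u) * (w1 * w2 * h))" .
qed

text \<open>As in the off-diagonal case, with the kernel \<open>Q\<close> as additional term. The
  kernel alone gives the first summand; the total covariance and the self-contraction term, both
  multiples of \<open>w1 * v\<close>, combine to the second.\<close>

lemma two_point_diagonal:
  fixes P :: "'a::comm_ring_1"
  assumes B: "B * b = 1" "B = 1 - a\<^sup>2" and u: "(n - 1) * u = 1"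
    and g: "2 * (x1 - x2)\<^sup>2 * s1 * s2 * g = 1" and h: "B * s1 * s2 * h = 1"
    and P: "B * s1 * P = a * B * (w1 * t) + (Q - a\<^sup>2 * (w1 * v))"
    and t: "(n - 1) * t = - (a * v)" and v: "v * s2 = w2"
    and Q: "(x1 - x2)\<^sup>2 * Q = w1 - w2 + (x1 - x2) * v"
    and s: "B * s1 = B * x1 - 2 * w1" "B * s2 = B * x2 - 2 * w2" "s2\<^sup>2 = x2\<^sup>2 - 4 * b"
  shows "P = (x1 * x2 - s1 * s2 - 4 * b) * g - (a\<^sup>2 * (n - a\<^sup>2) * u) * (w1 * w2 * h)"
proof (rule unit_cancel)
  define d where "d = x1 - x2"
  define N where "N = n - 1"
  define A where "A = x1 * x2 - s1 * s2 - 4 * b"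
  define Y where "Y = 2 * d\<^sup>2 * s1 * s2 * B * N"
  have "Y * (g * b * u) = (2 * d\<^sup>2 * s1 * s2 * g) * (B * b) * (N * u)"
    unfolding Y_def by (simp only: mult_ac)
  then show "Y * (g * b * u) = 1" using B u g by (simp add: d_def N_def)
  \<comment> \<open>The one-point functions are traded for roots by 2 w = B (x - s), and the square
    of \<open>s2\<close> brings in the constant \<open>4 * b\<close>.\<close>
  have A: "2 * s2 * (w1 - w2 + d * v) = B * A"
  proof -
    have "2 * s2 * (w1 - w2 + d * v) = s2 * (2 * w1) - s2 * (2 * w2) + d * (2 * (v * s2))"
      by (simp add: algebra_simps)
    also have "\<dots> = s2 * (B * x1 - B * s1) - s2 * (B * x2 - B * s2) + d * (B * x2 - B * s2)"
      unfolding v s(1,2) by simp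
    also have "\<dots> = B * (x1 * x2 - s1 * s2 + (s2\<^sup>2 - x2\<^sup>2))"
      by (simp add: d_def algebra_simps power2_eq_square)
    finally show ?thesis unfolding s(3) A_def by simp
  qed
  have "Y * P = 2 * d\<^sup>2 * N * s2 * (B * s1 * P)" unfolding Y_def by (simp only: mult_ac)
  also have "\<dots> = 2 * d\<^sup>2 * (a * B * w1 * s2 * (N * t) - N * a\<^sup>2 * w1 * (v * s2)) + N * (2 * s2 * (d\<^sup>2 * Q))"
    unfolding P by (simp add: algebra_simps)
  also have "d\<^sup>2 * Q = w1 - w2 + d * v" using Q by (simp add: d_def)
  also have "N * t = - (a * v)" using t by (simp add: N_def)
  also have "2 * d\<^sup>2 * (a * B * w1 * s2 * - (a * v) - N * a\<^sup>2 * w1 * (v * s2)) + N * (2 * s2 * (w1 - w2 + d * v))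
      = N * (B * A) - 2 * d\<^sup>2 * a\<^sup>2 * (B + N) * (w1 * (v * s2))"
    unfolding A by (simp add: algebra_simps power2_eq_square)
  \<comment> \<open>This is the sum of the \<alpha>_p^2 over the colors other than i, the origin of
    the restricted sum in the numerator.\<close>
  also have "B + N = n - a\<^sup>2" by (simp add: B(2) N_def)
  also have "v * s2 = w2" by (rule v)
  also have "N * (B * A) - 2 * d\<^sup>2 * a\<^sup>2 * (n - a\<^sup>2) * (w1 * w2)
      = N * B * A * (2 * d\<^sup>2 * s1 * s2 * g) - 2 * d\<^sup>2 * (a\<^sup>2 * (n - a\<^sup>2)) * (w1 * w2) * ((n - 1) * u) * (B * s1 * s2 * h)"
    unfolding u h g[folded d_def] by (simp add: mult_ac)
  also have "\<dots> = Y * (A * g) - Y * ((a\<^sup>2 * (n - a\<^sup>2) * u) * (w1 * w2 * h))"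
    unfolding Y_def N_def[symmetric] by (simp only: mult_ac)
  finally show "Y * P = Y * ((x1 * x2 - s1 * s2 - 4 * b) * g - (a\<^sup>2 * (n - a\<^sup>2) * u) * (w1 * w2 * h))"
    unfolding A_def by (simp only: right_diff_distrib)
qed

section \<open>Invertibility of the denominators\<close>

lemma unit2_in_x1: "unit1 f \<Longrightarrow> unit2 (in_x1 f)"
  by (rule has_lead_const)

lemma unit2_in_x2:
  assumes "unit1 f"
  shows "unit2 (in_x2 f)"
proof -
  obtain d where "\<And>n. n < d \<Longrightarrow> f $$ n = 0" "mps_unit (f $$ d)"
    using assms by (auto simp: has_lead_def)
  then show ?thesis
    by (intro has_leadI[where d = d and P = unit1]) (simp, simp only: in_x2_nth, rule has_lead_const)
qed

lemma unit2_scalar: "mps_unit s \<Longrightarrow> unit2 (scalar2 s)"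
  by (intro has_lead_const)

text \<open>The outer variable is 1/x_2, so x_1 - x_2 starts with - x_2 and its inverse is expanded
  for x_2 large compared with x_1.\<close>

lemma unit2_diff: "unit2 (in_x1 var_x - in_x2 var_x)"
proof (rule has_leadI[where d = "-1"])
  have "unit1 (fls_const (- 1) :: 'a fun1)"
    by (intro has_lead_const) (simp add: mps_coeff_one)
  then show "unit1 ((in_x1 var_x - in_x2 var_x) $$ - 1 :: 'a fun1)" by simp
qed auto

lemma unit2_two: "unit2 2"
proof -
  have "mps_unit (2 :: ('a::finite, complex) mps)" by (simp add: mps_coeff_numeral)
  then have "unit2 (scalar2 (2 :: ('a, complex) mps))" by (rule unit2_scalar)
  then show ?thesis by simp
qed

lemma scalar2_mult: "scalar2 (s * t) = scalar2 s * scalar2 t"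
  by simp

section \<open>Closed forms of the two-point functions\<close>

context
  assumes card: "CARD('d::finite) \<ge> 3"
begin

lemma scalar2_be_inverse:
  "scalar2 (1 - (mps_var (c :: 'd))\<^sup>2) * scalar2 (inverse (1 - (mps_var c)\<^sup>2)) = 1"
  by (simp only: fls_const_mult_const be_inverse[OF card] fls_const_1)

lemma scalar2_norm2_inverse:
  "scalar2 (norm2 - 1 :: ('d, complex) mps) * scalar2 (inverse (norm2 - 1)) = 1"
  by (simp only: fls_const_mult_const mps_unitI[OF unit_norm2[OF card]] fls_const_1)

lemma W2_offdiagonal:
  fixes i j :: 'd
  assumes "i \<noteq> j"
  shows "W2 i j = - scalar2 (mps_var i * mps_var j / (norm2 - 1)) *
    (in_x1 (W1 i) * in_x2 (W1 j) / (in_x1 (sigma i) * in_x2 (sigma j)))"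
proof -
  obtain T where T: "scalar2 (1 - (mps_var i)\<^sup>2) * in_x1 (sigma i) * W2 i j
      = scalar2 (mps_var i * (1 - (mps_var i)\<^sup>2)) * (in_x1 (W1 i) * in_x2 T)"
    "scalar2 (norm2 - 1) * in_x2 T = - (scalar2 (mps_var j) * in_x2 (neg_deriv j))"
    using W2_equation[OF card, of i j] assms by auto
  have unit: "unit2 (in_x1 (sigma i) * in_x2 (sigma j))"
    by (intro unit2_mult unit2_in_x1 unit2_in_x2 unit1_sigma[OF card])
  show ?thesis
    unfolding unit2_divide[OF unit] divide_mps_def scalar2_mult
  proof (rule two_point_offdiagonal[OF scalar2_be_inverse[of i] scalar2_norm2_inverse unit2_inverse[OF unit] _ T(2)])
    show "in_x2 (neg_deriv j) * in_x2 (sigma j) = in_x2 (W1 j)"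
      by (simp only: in_x2_mult[symmetric] neg_deriv_sigma[OF card])
  qed (simp only: T(1) scalar2_mult)
qed

lemma W2_diagonal:
  fixes i :: 'd
  shows "W2 i i = (in_x1 var_x * in_x2 var_x - in_x1 (sigma i) * in_x2 (sigma i)
      - scalar2 (4 / (1 - mps_var i ^ 2))) /
      (2 * (in_x1 var_x - in_x2 var_x) ^ 2 * in_x1 (sigma i) * in_x2 (sigma i))
    - scalar2 ((\<Sum>p\<in>UNIV - {i}. (mps_var i * mps_var p) ^ 2) / (norm2 - 1)) *
      (in_x1 (W1 i) * in_x2 (W1 i) / (scalar2 (1 - mps_var i ^ 2) * in_x1 (sigma i) * in_x2 (sigma i)))"
proof -
  obtain T where T: "scalar2 (1 - (mps_var i)\<^sup>2) * in_x1 (sigma i) * W2 i i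
      = scalar2 (mps_var i * (1 - (mps_var i)\<^sup>2)) * (in_x1 (W1 i) * in_x2 T)
      + (kernel i - scalar2 ((mps_var i)\<^sup>2) * (in_x1 (W1 i) * in_x2 (neg_deriv i)))"
    "scalar2 (norm2 - 1) * in_x2 T = - (scalar2 (mps_var i) * in_x2 (neg_deriv i))"
    using W2_equation[OF card, of i i] by auto
  have unit_g: "unit2 (2 * (in_x1 var_x - in_x2 var_x) ^ 2 * in_x1 (sigma i) * in_x2 (sigma i))"
    unfolding power2_eq_square
    by (intro unit2_mult unit2_in_x1 unit2_in_x2 unit1_sigma[OF card] unit2_diff unit2_two)
  have unit_h: "unit2 (scalar2 (1 - mps_var i ^ 2) * in_x1 (sigma i) * in_x2 (sigma i))"
    by (intro unit2_mult unit2_in_x1 unit2_in_x2 unit1_sigma[OF card] unit2_scalar unit_be[OF card])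
  have S: "(\<Sum>p\<in>UNIV - {i}. (mps_var i * mps_var p) ^ 2) = mps_var i ^ 2 * (norm2 - mps_var i ^ 2)"
    by (simp add: sum.remove[of UNIV i] power_mult_distrib sum_distrib_left)
  have sc: "scalar2 (1 - s) = 1 - scalar2 s" "scalar2 (s - 1) = scalar2 s - 1" "scalar2 (s ^ 2) = scalar2 s ^ 2"
    "scalar2 (s - r) = scalar2 s - scalar2 r" "scalar2 (4 * s) = 4 * scalar2 s"
    for s r :: "('d, complex) mps"
    by (simp_all add: power2_eq_square fls_minus_const[symmetric] fls_const_mult_const[symmetric] del: fls_const_mult_const)
  have c1: "scalar2 (4 / (1 - mps_var i ^ 2)) = 4 * scalar2 (inverse (1 - mps_var i ^ 2))"
    by (simp only: divide_mps_def sc(5))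
  have c2: "scalar2 ((\<Sum>p\<in>UNIV - {i}. (mps_var i * mps_var p) ^ 2) / (norm2 - 1))
      = (scalar2 (mps_var i))\<^sup>2 * (scalar2 norm2 - (scalar2 (mps_var i))\<^sup>2) * scalar2 (inverse (norm2 - 1))"
    by (simp only: S divide_mps_def scalar2_mult sc(3,4))
  show ?thesis
    unfolding unit2_divide[OF unit_g] unit2_divide[OF unit_h] c1 c2
  proof (rule two_point_diagonal)
    show "scalar2 (1 - (mps_var i)\<^sup>2) * scalar2 (inverse (1 - (mps_var i)\<^sup>2)) = 1"
      by (rule scalar2_be_inverse)
    show "scalar2 (1 - (mps_var i)\<^sup>2) = 1 - (scalar2 (mps_var i))\<^sup>2" by (simp only: sc fls_const_1)
    show "(scalar2 (norm2 :: ('d, complex) mps) - 1) * scalar2 (inverse (norm2 - 1)) = 1"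
      by (rule scalar2_norm2_inverse[unfolded sc(2)])
    show "2 * (in_x1 var_x - in_x2 var_x)\<^sup>2 * in_x1 (sigma i) * in_x2 (sigma i) *
        inverse (2 * (in_x1 var_x - in_x2 var_x)\<^sup>2 * in_x1 (sigma i) * in_x2 (sigma i)) = 1"
      by (rule unit2_inverse[OF unit_g])
    show "scalar2 (1 - (mps_var i)\<^sup>2) * in_x1 (sigma i) * in_x2 (sigma i) *
        inverse (scalar2 (1 - (mps_var i)\<^sup>2) * in_x1 (sigma i) * in_x2 (sigma i)) = 1"
      by (rule unit2_inverse[OF unit_h])
    show "scalar2 (1 - (mps_var i)\<^sup>2) * in_x1 (sigma i) * W2 i i
      = scalar2 (mps_var i) * scalar2 (1 - (mps_var i)\<^sup>2) * (in_x1 (W1 i) * in_x2 T)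
      + (kernel i - (scalar2 (mps_var i))\<^sup>2 * (in_x1 (W1 i) * in_x2 (neg_deriv i)))"
      unfolding T(1) scalar2_mult sc(3) ..
    show "(scalar2 norm2 - 1) * in_x2 T = - (scalar2 (mps_var i) * in_x2 (neg_deriv i))"
      by (rule T(2)[unfolded sc(2)])
    show "in_x2 (neg_deriv i) * in_x2 (sigma i) = in_x2 (W1 i)"
      by (simp only: in_x2_mult[symmetric] neg_deriv_sigma[OF card])
    show "(in_x1 var_x - in_x2 var_x)\<^sup>2 * kernel i
        = in_x1 (W1 i) - in_x2 (W1 i) + (in_x1 var_x - in_x2 var_x) * in_x2 (neg_deriv i)"
      by (rule kernel_eq[OF card])
    have two: "2 * W1 i = scalar1 2 * W1 i" by simp
    show "scalar2 (1 - (mps_var i)\<^sup>2) * in_x1 (sigma i) = scalar2 (1 - (mps_var i)\<^sup>2) * in_x1 var_x - 2 * in_x1 (W1 i)"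
    proof -
      have "in_x1 (scalar1 (1 - (mps_var i)\<^sup>2) * sigma i) = in_x1 (scalar1 (1 - (mps_var i)\<^sup>2) * var_x - scalar1 2 * W1 i)"
        using scalar_mult_sigma[OF card, of i] by (simp only: two)
      then show ?thesis
        by (simp only: fls_minus_const[symmetric] fls_const_mult_const[symmetric]) simp
    qed
    show "scalar2 (1 - (mps_var i)\<^sup>2) * in_x2 (sigma i) = scalar2 (1 - (mps_var i)\<^sup>2) * in_x2 var_x - 2 * in_x2 (W1 i)"
    proof -
      have "in_x2 (scalar1 (1 - (mps_var i)\<^sup>2) * sigma i) = in_x2 (scalar1 (1 - (mps_var i)\<^sup>2) * var_x - scalar1 2 * W1 i)"
        using scalar_mult_sigma[OF card, of i] by (simp only: two)
      then show ?thesis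
        unfolding in_x2_mult in_x2_diff in_x2_const by simp
    qed
    show "(in_x2 (sigma i))\<^sup>2 = (in_x2 var_x)\<^sup>2 - 4 * scalar2 (inverse (1 - (mps_var i)\<^sup>2))"
    proof -
      have "in_x2 (sigma i ^ 2) = in_x2 (var_x ^ 2 - scalar1 (4 * inverse (1 - (mps_var i)\<^sup>2)))"
        by (simp only: sigma_sq[OF card])
      then show ?thesis
        unfolding power2_eq_square in_x2_mult in_x2_diff in_x2_const sc(5) by simp
    qed
  qed
qed

end

section \<open>Analytic continuation of the one-point function\<close>

subsection \<open>Catalan numbers\<close>

text \<open>Minus one half of a coefficient of sqrt(1 - 4z). This form fits both the convolution
  recursion and the binomial expansion of the complex square root.\<close>

definition catalan :: "nat \<Rightarrow> complex" where
  "catalan m = - (1 / 2) * (1 / 2 gchoose Suc m) * (- 4) ^ Suc m"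

lemma catalan_0: "catalan 0 = 1"
  by (simp add: catalan_def)

text \<open>The square of sqrt(1 - 4z) is linear, so the Vandermonde sum for 1/2 + 1/2 vanishes at
  \<open>m + 2\<close>; its two extreme terms give the left side.\<close>

lemma catalan_Suc: "catalan (Suc m) = (\<Sum>i\<le>m. catalan i * catalan (m - i))"
proof -
  let ?g = "\<lambda>n. (1 / 2 :: complex) gchoose n"
  have "0 = (1 / 2 + 1 / 2 :: complex) gchoose (m + 2)"
    using binomial_gbinomial[of 1 "m + 2", where 'a = complex] by (simp add: binomial_eq_0)
  also have "\<dots> = (\<Sum>k\<le>Suc (Suc m). ?g k * ?g (m + 2 - k))"
    unfolding gbinomial_Vandermonde[symmetric] by (simp add: atLeast0AtMost)
  also have "\<dots> = ?g (m + 2) + (\<Sum>k\<le>m. ?g (Suc k) * ?g (m + 1 - k)) + ?g (m + 2)"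
    unfolding sum.atMost_Suc_shift[of _ "Suc m"] by (simp add: algebra_simps)
  finally have eq: "(\<Sum>k\<le>m. ?g (Suc k) * ?g (m + 1 - k)) = - 2 * ?g (m + 2)"
    by (simp add: eq_neg_iff_add_eq_0 algebra_simps)
  have "catalan i * catalan (m - i) = 1 / 4 * (- 4) ^ (m + 2) * (?g (Suc i) * ?g (m + 1 - i))" if "i \<le> m" for i
  proof -
    have "(- 4) ^ Suc i * (- 4) ^ Suc (m - i) = ((- 4) ^ (m + 2) :: complex)"
      unfolding power_add[symmetric] using that by simp
    moreover have "Suc (m - i) = m + 1 - i" using that by simp
    moreover have "catalan i * catalan (m - i)
        = 1 / 4 * ((- 4) ^ Suc i * (- 4) ^ Suc (m - i)) * (?g (Suc i) * ?g (Suc (m - i)))"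
      unfolding catalan_def by (simp del: power_Suc)
    ultimately show ?thesis by (simp only:)
  qed
  then have "(\<Sum>i\<le>m. catalan i * catalan (m - i)) = 1 / 4 * (- 4) ^ (m + 2) * (- 2 * ?g (m + 2))"
    by (simp add: sum_distrib_left[symmetric] eq[simplified])
  then show ?thesis by (simp add: catalan_def)
qed

text \<open>Both sides solve the semicircle recursion, in which 1 - \<alpha>_c^2 can be cancelled.
  The closed form makes it possible to evaluate each coefficient of the one-point function at real
  parameters.\<close>

lemma planar_moment_catalan:
  fixes c :: "'d::finite"
  assumes card: "CARD('d) \<ge> 3"
  shows "planar_moment c k
    = (if even k then mps_const (catalan (k div 2)) * inverse (1 - (mps_var c)\<^sup>2) ^ (k div 2) else 0)"
proof -
  define b where "b = inverse (1 - (mps_var c :: ('d, complex) mps)\<^sup>2)"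
  define Y where "Y k = (if even k then mps_const (catalan (k div 2)) * b ^ (k div 2) else 0)" for k
  have b: "(1 - (mps_var c)\<^sup>2) * b = 1" unfolding b_def by (rule be_inverse[OF card])
  have Y0: "Y 0 = 1" by (simp add: Y_def catalan_0)
  have YSuc: "(1 - (mps_var c)\<^sup>2) * Y (Suc k) = (\<Sum>p<k. Y p * Y (k - 1 - p))" for k
  proof (cases "even k")
    case True
    have "Y p * Y (k - 1 - p) = 0" if "p < k" for p
      using True that by (simp add: Y_def)
    then show ?thesis using True by (simp add: Y_def)
  next
    case False
    then obtain m where k: "k = 2 * m + 1" by (auto elim: oddE)
    have "(\<Sum>p<k. Y p * Y (k - 1 - p)) = (\<Sum>p\<in>(\<lambda>i. 2 * i) ` {..m}. Y p * Y (k - 1 - p))"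
      by (rule sum.mono_neutral_right) (auto simp: k Y_def elim!: evenE)
    also have "\<dots> = (\<Sum>i\<le>m. Y (2 * i) * Y (2 * (m - i)))"
      by (subst sum.reindex) (auto simp: inj_on_def k right_diff_distrib')
    also have "\<dots> = (\<Sum>i\<le>m. mps_const (catalan i * catalan (m - i)) * b ^ m)"
    proof (rule sum.cong[OF refl])
      fix i assume "i \<in> {..m}"
      then have "b ^ i * b ^ (m - i) = b ^ m" by (simp add: power_add[symmetric])
      then have "mps_const (catalan i * catalan (m - i)) * (b ^ i * b ^ (m - i)) = mps_const (catalan i * catalan (m - i)) * b ^ m"
        by simp
      then show "Y (2 * i) * Y (2 * (m - i)) = mps_const (catalan i * catalan (m - i)) * b ^ m"
        by (simp add: Y_def mps_const_mult mult_ac)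
    qed
    also have "\<dots> = mps_const (catalan (Suc m)) * b ^ m"
      unfolding catalan_Suc sum_distrib_right[symmetric]
      by (rule arg_cong[where f = "\<lambda>x. x * _"], rule mps_eqI) (simp add: mps_coeff_const)
    also have "\<dots> = ((1 - (mps_var c)\<^sup>2) * b) * (mps_const (catalan (Suc m)) * b ^ m)"
      unfolding b by simp
    also have "\<dots> = (1 - (mps_var c)\<^sup>2) * (mps_const (catalan (Suc m)) * b ^ Suc m)"
      by (simp only: power_Suc mult_ac)
    also have "\<dots> = (1 - (mps_var c)\<^sup>2) * Y (Suc k)"
    proof -
      have "Y (Suc k) = mps_const (catalan (Suc m)) * b ^ Suc m"
        by (simp add: Y_def k del: power_Suc)
      then show ?thesis by simp
    qed
    finally show ?thesis by (rule sym)
  qed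
  have "planar_moment c k = Y k"
  proof (induction k rule: less_induct)
    case (less k)
    show ?case
    proof (cases k)
      case 0
      then show ?thesis using planar_loop_equations(1)[OF card] Y0 by simp
    next
      case (Suc n)
      have "(1 - (mps_var c)\<^sup>2) * planar_moment c k = (\<Sum>p<n. planar_moment c p * planar_moment c (n - 1 - p))"
        unfolding Suc by (rule planar_moment_Suc[OF card])
      also have "\<dots> = (\<Sum>p<n. Y p * Y (n - 1 - p))"
        by (intro sum.cong refl) (simp add: less Suc)
      also have "\<dots> = (1 - (mps_var c)\<^sup>2) * Y k" unfolding Suc by (rule YSuc[symmetric])
      finally show ?thesis by (rule unit_cancel[OF b])
    qed
  qed
  then show ?thesis by (simp add: Y_def b_def)
qed

subsection \<open>Values of power series in one parameter\<close>

text \<open>The planar moments of color c involve the parameter \<alpha>_c alone; through this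
  embedding their convergence follows from the theory of one-variable series.\<close>

definition mps_of_fps :: "'v \<Rightarrow> complex fps \<Rightarrow> ('v::finite, complex) mps" where
  "mps_of_fps c f = Mps (\<lambda>e. if \<forall>v. v \<noteq> c \<longrightarrow> e v = 0 then f $ (e c) else 0)"

lemma coeff_mps_of_fps:
  "mps_coeff (mps_of_fps c f) e = (if \<forall>v. v \<noteq> c \<longrightarrow> e v = 0 then f $ (e c) else 0)"
  by (simp add: mps_of_fps_def)

lemma mps_of_fps_mult: "mps_of_fps c (f * g) = mps_of_fps c f * mps_of_fps c g"
proof (rule mps_eqI)
  fix e :: "'a \<Rightarrow> nat"
  show "mps_coeff (mps_of_fps c (f * g)) e = mps_coeff (mps_of_fps c f * mps_of_fps c g) e"
  proof (cases "\<forall>v. v \<noteq> c \<longrightarrow> e v = 0")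
    case True
    have img: "{..e} = (\<lambda>k. (\<lambda>_. 0)(c := k)) ` {..e c}"
    proof (intro equalityI subsetI)
      fix a assume "a \<in> {..e}"
      then have le: "a v \<le> e v" for v by (simp add: le_fun_def)
      have "a = (\<lambda>_. 0)(c := a c)"
      proof
        fix v show "a v = ((\<lambda>_. 0)(c := a c)) v" using le[of v] True by auto
      qed
      then show "a \<in> (\<lambda>k. (\<lambda>_. 0)(c := k)) ` {..e c}" using le[of c] by blast
    qed (auto simp: le_fun_def)
    have inj: "inj_on (\<lambda>k. (\<lambda>_. 0)(c := k)) {..e c}"
      by (rule inj_onI) (metis fun_upd_same)
    show ?thesis
      using True by (simp add: mps_coeff_mult img sum.reindex[OF inj] coeff_mps_of_fps fps_mult_nth atLeast0AtMost)
  next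
    case False
    then obtain v where v: "v \<noteq> c" "e v \<noteq> 0" by blast
    have "mps_coeff (mps_of_fps c f) a * mps_coeff (mps_of_fps c g) (\<lambda>v. e v - a v) = 0" for a
    proof (cases "a v = 0")
      case True
      then have "mps_coeff (mps_of_fps c g) (\<lambda>v. e v - a v) = 0" using v by (auto simp: coeff_mps_of_fps)
      then show ?thesis by simp
    next
      case False
      then have "mps_coeff (mps_of_fps c f) a = 0" using v by (auto simp: coeff_mps_of_fps)
      then show ?thesis by simp
    qed
    then have "mps_coeff (mps_of_fps c f * mps_of_fps c g) e = 0"
      unfolding mps_coeff_mult by (intro sum.neutral ballI)
    then show ?thesis unfolding coeff_mps_of_fps[of c "f * g"] if_not_P[OF False] by (rule sym)
  qed
qed

lemma supported_exponent:
  "(\<forall>v. v \<noteq> c \<longrightarrow> e v = 0) \<longleftrightarrow> e = (\<lambda>_. 0)(c := e c)"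
proof
  assume *: "\<forall>v. v \<noteq> c \<longrightarrow> e v = 0"
  show "e = (\<lambda>_. 0)(c := e c)"
  proof
    fix v show "e v = ((\<lambda>_. 0)(c := e c)) v" using * by (cases "v = c") simp_all
  qed
next
  assume *: "e = (\<lambda>_. 0)(c := e c)"
  show "\<forall>v. v \<noteq> c \<longrightarrow> e v = 0" by (subst *) simp
qed

lemma mps_of_fps_1: "mps_of_fps c 1 = 1"
proof (rule mps_eqI)
  fix e :: "'a \<Rightarrow> nat"
  have "e = (\<lambda>_. 0) \<longleftrightarrow> (\<forall>v. v \<noteq> c \<longrightarrow> e v = 0) \<and> e c = 0" by (metis (full_types))
  then show "mps_coeff (mps_of_fps c 1) e = mps_coeff 1 e"
    unfolding coeff_mps_of_fps mps_coeff_one fps_one_nth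
    by (cases "\<forall>v. v \<noteq> c \<longrightarrow> e v = 0"; cases "e c = 0") (simp_all only: if_True if_False simp_thms if_cancel)
qed

lemma mps_of_fps_power: "mps_of_fps c (f ^ n) = mps_of_fps c f ^ n"
  by (induction n) (simp_all add: mps_of_fps_1 mps_of_fps_mult)

lemma mps_of_fps_X: "mps_of_fps c fps_X = mps_var c"
proof (rule mps_eqI)
  fix e :: "'a \<Rightarrow> nat"
  have "(\<forall>v. v \<noteq> c \<longrightarrow> e v = 0) \<and> e c = 1 \<longleftrightarrow> e = (\<lambda>_. 0)(c := 1)"
    by (auto simp: fun_eq_iff)
  then show "mps_coeff (mps_of_fps c fps_X) e = mps_coeff (mps_var c) e"
    unfolding coeff_mps_of_fps mps_coeff_var by auto
qed

lemma mps_of_fps_diff: "mps_of_fps c (f - g) = mps_of_fps c f - mps_of_fps c g"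
proof (rule mps_eqI)
  fix e :: "'a \<Rightarrow> nat"
  have "(if P then x - y else 0) = (if P then x else 0) - (if P then y else 0)" for P and x y :: complex
    by simp
  then show "mps_coeff (mps_of_fps c (f - g)) e = mps_coeff (mps_of_fps c f - mps_of_fps c g) e"
    unfolding coeff_mps_of_fps mps_coeff_diff fps_sub_nth .
qed

text \<open>Inside the disc of convergence the one-variable series converges absolutely, hence
  unconditionally, and it is carried over to the exponents supported at \<open>c\<close>.\<close>

lemma mps_has_value_of_fps:
  assumes "ereal \<bar>a c\<bar> < fps_conv_radius f"
  shows "mps_has_value (mps_of_fps c f) a (eval_fps f (of_real (a c)))"
proof -
  let ?h = "\<lambda>k. (\<lambda>_. 0)(c := k)"
  have conv: "ereal (norm (complex_of_real (a c))) < fps_conv_radius f" using assms by simp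
  have "(\<lambda>k. f $ k * complex_of_real (a c) ^ k) sums eval_fps f (of_real (a c))"
    using summable_fps[OF conv] unfolding eval_fps_def by (rule summable_sums)
  moreover have "summable (\<lambda>k. norm (f $ k * complex_of_real (a c) ^ k))"
    using conv unfolding fps_conv_radius_def by (rule abs_summable_in_conv_radius)
  ultimately have "((\<lambda>k. f $ k * complex_of_real (a c) ^ k) has_sum eval_fps f (of_real (a c))) UNIV"
    by (intro norm_summable_imp_has_sum)
  also have "(\<lambda>k. f $ k * complex_of_real (a c) ^ k)
      = (\<lambda>e. mps_coeff (mps_of_fps c f) e * (\<Prod>v\<in>UNIV. complex_of_real (a v) ^ e v)) \<circ> ?h"
  proof
    fix k
    have "(\<Prod>v\<in>UNIV. complex_of_real (a v) ^ (?h k v)) = complex_of_real (a c) ^ k"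
      by (simp add: prod.remove[of UNIV c])
    then show "f $ k * complex_of_real (a c) ^ k
      = ((\<lambda>e. mps_coeff (mps_of_fps c f) e * (\<Prod>v\<in>UNIV. complex_of_real (a v) ^ e v)) \<circ> ?h) k"
      by (simp add: coeff_mps_of_fps)
  qed
  also have "(\<dots> has_sum eval_fps f (of_real (a c))) UNIV \<longleftrightarrow>
      ((\<lambda>e. mps_coeff (mps_of_fps c f) e * (\<Prod>v\<in>UNIV. complex_of_real (a v) ^ e v)) has_sum eval_fps f (of_real (a c))) (range ?h)"
    by (rule has_sum_reindex[symmetric]) (auto intro!: injI dest: fun_cong[of _ _ c])
  also have "\<dots> \<longleftrightarrow> mps_has_value (mps_of_fps c f) a (eval_fps f (of_real (a c)))"
    unfolding mps_has_value_def
  proof (rule has_sum_cong_neutral)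
    fix e :: "'a \<Rightarrow> nat" assume "e \<in> UNIV - range ?h"
    then have "e \<noteq> ?h (e c)" by auto
    then have "\<not> (\<forall>v. v \<noteq> c \<longrightarrow> e v = 0)" unfolding supported_exponent[symmetric] .
    then have "mps_coeff (mps_of_fps c f) e = 0" unfolding coeff_mps_of_fps by (rule if_not_P)
    then show "mps_coeff (mps_of_fps c f) e * (\<Prod>v\<in>UNIV. complex_of_real (a v) ^ e v) = 0" by simp
  qed auto
  finally show ?thesis .
qed

lemma mps_has_value_inverse_power:
  assumes "\<bar>a c\<bar> < 1"
  shows "mps_has_value (mps_const z * inverse (1 - (mps_var c)\<^sup>2) ^ n) a (z * of_real (1 / (1 - (a c)\<^sup>2) ^ n))"
proof -
  \<comment> \<open>The geometric series of 1 / (1 - X^2); its coefficients are bounded by one, so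
    its radius is at least one.\<close>
  define G :: "complex fps" where "G = Abs_fps (\<lambda>n. if even n then 1 else 0)"
  have G: "(1 - fps_X\<^sup>2) * G = 1"
  proof (rule fps_ext)
    fix n
    show "((1 - fps_X\<^sup>2) * G) $ n = 1 $ n"
      by (cases "n < 2") (auto simp: left_diff_distrib fps_X_power_mult_nth G_def less_2_cases_iff)
  qed
  have rad: "fps_conv_radius G \<ge> 1"
    unfolding fps_conv_radius_def
  proof (rule conv_radius_geI_ex)
    fix r :: real assume r: "0 < r" "ereal r < 1"
    have "summable (\<lambda>n. G $ n * complex_of_real r ^ n)"
    proof (rule summable_comparison_test'[where N = 0])
      show "summable (\<lambda>n. r ^ n)" using r by (intro summable_geometric) simp
      show "norm (G $ n * complex_of_real r ^ n) \<le> r ^ n" for n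
        using r by (simp add: G_def norm_mult norm_power)
    qed
    then show "\<exists>z. norm z = r \<and> summable (\<lambda>n. G $ n * z ^ n)"
      using r by (intro exI[of _ "complex_of_real r"]) simp
  qed
  have "(1 - (mps_var c)\<^sup>2) * mps_of_fps c G = 1"
  proof -
    have "(1 - (mps_var c)\<^sup>2) = mps_of_fps c (1 - fps_X\<^sup>2)"
      by (simp add: mps_of_fps_diff mps_of_fps_1 mps_of_fps_power mps_of_fps_X)
    then show ?thesis by (simp only: mps_of_fps_mult[symmetric] G mps_of_fps_1)
  qed
  then have inv: "inverse (1 - (mps_var c)\<^sup>2) ^ n = mps_of_fps c (G ^ n)"
    by (simp add: mps_inverse_eqI mps_of_fps_power)
  have conv: "ereal \<bar>a c\<bar> < fps_conv_radius G"
    using assms rad by (metis ereal_less(3) less_le_trans)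
  have "eval_fps (G ^ n) (of_real (a c)) = eval_fps G (of_real (a c)) ^ n"
    using conv
  proof (induction n)
    case (Suc n)
    have "ereal \<bar>a c\<bar> < fps_conv_radius (G ^ n)"
      using conv fps_conv_radius_power[of G n] by (rule less_le_trans)
    then show ?case using Suc by (simp add: eval_fps_mult)
  qed simp
  also have "eval_fps G (of_real (a c)) = of_real (1 / (1 - (a c)\<^sup>2))"
  proof -
    have ne: "1 - (a c)\<^sup>2 \<noteq> 0" using assms by (simp add: abs_square_eq_1 power2_eq_1_iff)
    have rad1: "fps_conv_radius (1 - fps_X\<^sup>2 :: complex fps) = \<infinity>"
      using fps_conv_radius_diff[of "1 :: complex fps" "fps_X\<^sup>2"] by simp
    have "eval_fps ((1 - fps_X\<^sup>2) * G) (of_real (a c)) = 1" unfolding G by simp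
    moreover have "eval_fps ((1 - fps_X\<^sup>2) * G) (of_real (a c))
        = eval_fps (1 - fps_X\<^sup>2) (of_real (a c)) * eval_fps G (of_real (a c))"
      using conv rad1 by (intro eval_fps_mult) auto
    moreover have "eval_fps (1 - fps_X\<^sup>2 :: complex fps) (of_real (a c)) = of_real (1 - (a c)\<^sup>2)"
      by (subst eval_fps_diff) auto
    ultimately have "of_real (1 - (a c)\<^sup>2) * eval_fps G (of_real (a c)) = 1" by simp
    moreover have "complex_of_real (1 - (a c)\<^sup>2) \<noteq> 0" using ne by (simp only: of_real_eq_0_iff not_False_eq_True)
    ultimately show ?thesis by (simp add: field_simps del: of_real_diff of_real_power)
  qed
  finally have "mps_has_value (mps_of_fps c (G ^ n)) a (of_real (1 / (1 - (a c)\<^sup>2)) ^ n)"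
    using mps_has_value_of_fps[of a c "G ^ n"] conv fps_conv_radius_power[of G n]
    by (metis less_le_trans)
  then have "mps_has_value (inverse (1 - (mps_var c)\<^sup>2) ^ n) a (of_real (1 / (1 - (a c)\<^sup>2) ^ n))"
    unfolding inv by (simp add: power_one_over)
  then show ?thesis
    unfolding mps_has_value_def mps_coeff_const_mult mult.assoc by (rule has_sum_cmult_right)
qed

subsection \<open>The cut\<close>

text \<open>If 1 - r^2/x^2 = u \<le> 0 then x^2 = r^2 / (1 - u) lies between 0 and r^2, so x is on
  the segment. Off the segment the principal root is therefore holomorphic.\<close>

lemma sqrt_cut_nonpos:
  assumes "x \<notin> complex_of_real ` {- r..r}" "r > 0"
  shows "1 - (of_real r)\<^sup>2 / x\<^sup>2 \<notin> \<real>\<^sub>\<le>\<^sub>0"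
proof
  assume "1 - (of_real r)\<^sup>2 / x\<^sup>2 \<in> \<real>\<^sub>\<le>\<^sub>0"
  then obtain u where u: "1 - (of_real r)\<^sup>2 / x\<^sup>2 = of_real u" "u \<le> 0"
    by (auto elim!: nonpos_Reals_cases)
  have x: "x \<noteq> 0" using assms by (auto simp: image_iff intro!: bexI[of _ 0])
  define t where "t = r / sqrt (1 - u)"
  have "(of_real r)\<^sup>2 / x\<^sup>2 = 1 - of_real u" using u by (simp add: algebra_simps)
  then have "(of_real r)\<^sup>2 = of_real (1 - u) * x\<^sup>2" using x by (simp add: field_simps)
  moreover have "of_real (1 - u) \<noteq> (0::complex)" using u(2) by (simp only: of_real_eq_0_iff)
  ultimately have "x\<^sup>2 = (of_real r)\<^sup>2 / of_real (1 - u)" by (simp add: field_simps)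
  also have "\<dots> = (of_real t)\<^sup>2"
    using u(2) unfolding of_real_power[symmetric] of_real_divide[symmetric] t_def by (simp add: power_divide)
  finally have "x = of_real t \<or> x = - of_real t" by (simp add: power2_eq_iff)
  moreover have "0 \<le> t" "t \<le> r"
    using assms(2) u(2) by (auto simp: t_def divide_le_eq)
  ultimately show False using assms by (auto simp: image_iff dest: bspec[of _ _ t] bspec[of _ _ "- t"])
qed

lemma abs_less_imp_square_less: "\<bar>t\<bar> < r \<Longrightarrow> t\<^sup>2 < r\<^sup>2" for t r :: real
  using abs_le_square_iff[of r t] by linarith

text \<open>The root of r^2 - x^2 is continuous across the open interval, so this form isolates the
  jump in the sign of \<open>h\<close>.\<close>

lemma csqrt_near_cut:
  assumes "\<bar>t\<bar> < r" "h \<noteq> 0" "x = Complex t h"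
  shows "x * csqrt (1 - (of_real r)\<^sup>2 / x\<^sup>2) = of_real (sgn h) * \<i> * csqrt ((of_real r)\<^sup>2 - x\<^sup>2)"
proof -
  define q where "q = csqrt ((of_real r)\<^sup>2 - x\<^sup>2)"
  have x: "x \<noteq> 0" using assms by (auto simp: complex_eq_iff)
  have q2: "q\<^sup>2 = (of_real r)\<^sup>2 - x\<^sup>2" by (simp add: q_def)
  have "t\<^sup>2 < r\<^sup>2" using assms(1) by (simp add: abs_less_imp_square_less)
  have re: "(Re q)\<^sup>2 - (Im q)\<^sup>2 = r\<^sup>2 - t\<^sup>2 + h\<^sup>2" and im: "2 * Re q * Im q = - 2 * t * h"
    using arg_cong[OF q2, of Re] arg_cong[OF q2, of Im] assms(3)
    by (simp_all add: power2_eq_square)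
  have "(Re q)\<^sup>2 > 0" using re \<open>t\<^sup>2 < r\<^sup>2\<close> by (smt (verit) zero_le_power2)
  moreover have "Re q \<ge> 0" unfolding q_def by (rule Re_csqrt)
  ultimately have q_pos: "Re q > 0" by (simp add: order_less_le)
  define w where "w = of_real (sgn h) * \<i> * q / x"
  have "sgn h * sgn h = 1" using assms(2) by (simp add: sgn_if)
  then have sgn2: "complex_of_real (sgn h) * of_real (sgn h) = 1" by (metis of_real_1 of_real_mult)
  have "w\<^sup>2 = (of_real (sgn h) * of_real (sgn h)) * (\<i> * \<i>) * q\<^sup>2 / x\<^sup>2"
    by (simp add: w_def power2_eq_square mult_ac)
  also have "\<dots> = 1 - (of_real r)\<^sup>2 / x\<^sup>2"
    unfolding sgn2 q2 using x by (simp add: field_simps)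
  finally have "w\<^sup>2 = 1 - (of_real r)\<^sup>2 / x\<^sup>2" .
  \<comment> \<open>The principal root is identified by its square and its positive real part. With
    \<open>Im q = - t * h / Re q\<close> both contributions to the real part of \<open>w\<close>
    acquire the sign of \<open>h\<close>, which \<open>sgn h\<close> compensates.\<close>
  moreover have "0 < Re w"
  proof -
    have "Re w = sgn h * (Re q * h - Im q * t) / (t\<^sup>2 + h\<^sup>2)"
      unfolding w_def assms(3) by (simp add: Re_divide field_simps)
    moreover have "Im q = - t * h / Re q" using im q_pos by (simp add: field_simps)
    then have "Re q * h - Im q * t = h * (Re q + t\<^sup>2 / Re q)"
      by (simp add: power2_eq_square algebra_simps)
    then have "sgn h * (Re q * h - Im q * t) = \<bar>h\<bar> * (Re q + t\<^sup>2 / Re q)"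
      by (simp add: abs_sgn mult_ac)
    moreover have "\<bar>h\<bar> * (Re q + t\<^sup>2 / Re q) > 0"
      using assms(2) q_pos by (intro mult_pos_pos add_pos_nonneg) auto
    moreover have "t\<^sup>2 + h\<^sup>2 > 0" using assms(2) by (simp add: sum_power2_gt_zero_iff)
    ultimately show ?thesis by simp
  qed
  ultimately have "csqrt (1 - (of_real r)\<^sup>2 / x\<^sup>2) = w" by (intro csqrt_unique) auto
  then show ?thesis using x by (simp add: w_def q_def)
qed

lemma has_cut_sqrt:
  assumes "B \<noteq> 0" "r > 0"
  shows "has_cut (\<lambda>x. B * (x * (1 - csqrt (1 - (of_real r)\<^sup>2 / x\<^sup>2)))) (- r) r"
  unfolding has_cut_def
proof (intro conjI ballI)
  have "x \<noteq> 0" if "x \<in> - complex_of_real ` {- r..r}" for x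
    using that assms by (auto simp: image_iff intro!: bexI[of _ 0])
  then show "(\<lambda>x. B * (x * (1 - csqrt (1 - (of_real r)\<^sup>2 / x\<^sup>2)))) holomorphic_on - complex_of_real ` {- r..r}"
    by (intro holomorphic_intros sqrt_cut_nonpos assms) auto
next
  fix t assume t: "t \<in> {- r<..<r}"
  then have tr: "\<bar>t\<bar> < r" by auto
  let ?F = "\<lambda>x. B * (x * (1 - csqrt (1 - (of_real r)\<^sup>2 / x\<^sup>2)))"
  define s where "s = sqrt (r\<^sup>2 - t\<^sup>2)"
  have pos: "r\<^sup>2 - t\<^sup>2 > 0" using tr by (simp add: abs_less_imp_square_less)
  \<comment> \<open>Here \<open>e\<close> is the sign of \<open>h\<close> on the side from which the
    limit is taken.\<close>
  have lim: "((\<lambda>h. B * (Complex t h - of_real e * \<i> * csqrt ((of_real r)\<^sup>2 - (Complex t h)\<^sup>2)))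
      \<longlongrightarrow> B * (of_real t - of_real e * \<i> * of_real s)) (at 0 within S)" for e S
  proof -
    have C: "((\<lambda>h. Complex t h) \<longlongrightarrow> of_real t) (at 0 within S)"
      unfolding complex_of_real_def by (intro tendsto_intros)
    have "((\<lambda>h. (of_real r)\<^sup>2 - (Complex t h)\<^sup>2) \<longlongrightarrow> (of_real r)\<^sup>2 - (of_real t)\<^sup>2) (at 0 within S)"
      by (intro tendsto_intros C)
    moreover have "(of_real r)\<^sup>2 - (of_real t)\<^sup>2 = complex_of_real (r\<^sup>2 - t\<^sup>2)" by simp
    moreover have "isCont csqrt (complex_of_real (r\<^sup>2 - t\<^sup>2))"
      using pos by (intro continuous_at_csqrt) (simp only: nonpos_Reals_of_real_iff not_le)
    ultimately have "((\<lambda>h. csqrt ((of_real r)\<^sup>2 - (Complex t h)\<^sup>2)) \<longlongrightarrow> csqrt (complex_of_real (r\<^sup>2 - t\<^sup>2))) (at 0 within S)"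
      using isCont_tendsto_compose by metis
    moreover have "csqrt (complex_of_real (r\<^sup>2 - t\<^sup>2)) = of_real s"
      using pos unfolding s_def by (subst csqrt_of_real_nonneg) auto
    ultimately show ?thesis by (intro tendsto_intros C) simp_all
  qed
  have eq: "?F (Complex t h) = B * (Complex t h - of_real (sgn h) * \<i> * csqrt ((of_real r)\<^sup>2 - (Complex t h)\<^sup>2))"
    if "h \<noteq> 0" for h
    unfolding csqrt_near_cut[OF tr that refl, symmetric] by (simp add: right_diff_distrib)
  have "((\<lambda>h. ?F (Complex t h)) \<longlongrightarrow> B * (of_real t - of_real 1 * \<i> * of_real s)) (at_right 0)"
  proof (rule Lim_transform_eventually[OF lim])
    show "\<forall>\<^sub>F h in at_right 0. B * (Complex t h - of_real 1 * \<i> * csqrt ((of_real r)\<^sup>2 - (Complex t h)\<^sup>2)) = ?F (Complex t h)"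
      using eventually_at_right_less[of "0::real"] by eventually_elim (simp add: eq)
  qed
  moreover have "((\<lambda>h. ?F (Complex t h)) \<longlongrightarrow> B * (of_real t - of_real (- 1) * \<i> * of_real s)) (at_left 0)"
  proof (rule Lim_transform_eventually[OF lim])
    have "\<forall>\<^sub>F h in at_left 0. h < (0::real)" by (simp add: eventually_at_filter)
    then show "\<forall>\<^sub>F h in at_left 0. B * (Complex t h - of_real (- 1) * \<i> * csqrt ((of_real r)\<^sup>2 - (Complex t h)\<^sup>2)) = ?F (Complex t h)"
      by eventually_elim (simp add: eq)
  qed
  moreover have "B * (of_real t - of_real 1 * \<i> * of_real s) \<noteq> B * (of_real t - of_real (- 1) * \<i> * of_real s)"
  proof -
    have "s > 0" using pos by (simp add: s_def)
    then show ?thesis using assms(1) by (auto simp: complex_eq_iff)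
  qed
  ultimately show "\<exists>l m. ((\<lambda>h. ?F (Complex t h)) \<longlongrightarrow> l) (at_right 0) \<and>
      ((\<lambda>h. ?F (Complex t h)) \<longlongrightarrow> m) (at_left 0) \<and> l \<noteq> m"
    by blast
qed

lemma W1_has_cut:
  fixes c :: "'d::finite"
  assumes card: "CARD('d) \<ge> 3" and a: "\<bar>a c\<bar> < 1"
  shows "\<exists>F. has_expansion (W1 c) a (2 / sqrt (1 - (a c)\<^sup>2)) F \<and>
    has_cut F (- 2 / sqrt (1 - (a c)\<^sup>2)) (2 / sqrt (1 - (a c)\<^sup>2))"
proof -
  define \<beta> where "\<beta> = 1 - (a c)\<^sup>2"
  have \<beta>: "\<beta> > 0" using a by (simp add: \<beta>_def abs_square_less_1)
  define r where "r = 2 / sqrt \<beta>"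
  have r: "r > 0" "r\<^sup>2 = 4 / \<beta>" using \<beta> by (simp_all add: r_def power_divide)
  \<comment> \<open>The closed form of the one-point function at parameters \<open>a\<close>, with
    \<sigma> written as x times a principal root so that its only cut is the segment and it behaves
    like x at infinity.\<close>
  define F where "F x = complex_of_real (\<beta> / 2) * (x * (1 - csqrt (1 - (of_real r)\<^sup>2 / x\<^sup>2)))" for x
  define w where "w n = (if odd n then catalan (n div 2) * of_real (1 / \<beta> ^ (n div 2)) else 0)" for n
  have coeff_value: "mps_has_value (W1 c $$ int n) a (w n)" for n
  proof (cases "odd n")
    case True
    then have "W1 c $$ int n = mps_const (catalan (n div 2)) * inverse (1 - (mps_var c)\<^sup>2) ^ (n div 2)"
      by (auto simp: W1_eq gen_nth planar_moment_catalan[OF card] nat_diff_distrib' elim!: oddE)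
    then show ?thesis
      using mps_has_value_inverse_power[of a c, OF a] True by (simp add: w_def \<beta>_def)
  next
    case False
    then have "W1 c $$ int n = 0"
      by (cases n) (auto simp: W1_eq gen_nth planar_moment_catalan[OF card])
    then show ?thesis using False by (simp add: w_def mps_has_value_def)
  qed
  have expansion: "(\<lambda>n. w n / x ^ n) sums F x" if x: "norm x > r" for x
  proof -
    have x0: "x \<noteq> 0" using x r by auto
    \<comment> \<open>The binomial series of the root of 1 + y converges exactly where it is needed:
      norm x > r means norm y < 1.\<close>
    define y where "y = - (of_real r)\<^sup>2 / x\<^sup>2"
    have y1: "norm y < 1"
    proof -
      have "r\<^sup>2 < (norm x)\<^sup>2" using x r(1) by (intro power_strict_mono) auto
      then show ?thesis using x0 r(1) by (simp add: y_def norm_divide norm_power)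
    qed
    have y: "y = - 4 / (of_real \<beta> * x\<^sup>2)"
      using r(2) by (simp add: y_def flip: of_real_power)
    have "(\<lambda>n. (1 / 2 gchoose n) * y ^ n) sums csqrt (1 + y)"
      using gen_binomial_complex[OF y1, of "1 / 2"] by (simp add: csqrt_conv_powr)
    then have "(\<lambda>n. (1 / 2 gchoose Suc n) * y ^ Suc n) sums (csqrt (1 + y) - 1)"
      by (subst sums_Suc_iff) simp
    then have "(\<lambda>n. - (of_real (\<beta> / 2) * x) * ((1 / 2 gchoose Suc n) * y ^ Suc n)) sums (- (of_real (\<beta> / 2) * x) * (csqrt (1 + y) - 1))"
      by (rule sums_mult)
    also have "- (of_real (\<beta> / 2) * x) * (csqrt (1 + y) - 1) = F x"
      by (simp add: F_def y_def algebra_simps)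
    also have "(\<lambda>n. - (of_real (\<beta> / 2) * x) * ((1 / 2 gchoose Suc n) * y ^ Suc n)) = (\<lambda>n. w (2 * n + 1) / x ^ (2 * n + 1))"
    proof
      fix n
      have "y ^ Suc n = (- 4) ^ Suc n / (of_real \<beta> ^ Suc n * x ^ (2 * n + 2))"
        unfolding y power_divide power_mult_distrib power_mult[symmetric] by simp
      define G :: complex where "G = (1 / 2 gchoose Suc n) * (- 4) ^ Suc n"
      define b where "b = complex_of_real \<beta>"
      have b: "b \<noteq> 0" using \<beta> by (simp add: b_def)
      have "w (2 * n + 1) = - (1 / 2) * G / b ^ n"
        unfolding w_def catalan_def G_def b_def by simp
      moreover have "- (of_real (\<beta> / 2) * x) * ((1 / 2 gchoose Suc n) * y ^ Suc n)
          = - (b / 2 * x) * (G / (b ^ Suc n * x ^ (2 * n + 2)))"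
        unfolding \<open>y ^ Suc n = _\<close> G_def b_def by simp
      moreover have "- (b / 2 * x) * (G / (b ^ Suc n * x ^ (2 * n + 2))) = - (1 / 2) * G / b ^ n / x ^ (2 * n + 1)"
        using x0 b by (simp add: field_simps)
      ultimately show "- (of_real (\<beta> / 2) * x) * ((1 / 2 gchoose Suc n) * y ^ Suc n) = w (2 * n + 1) / x ^ (2 * n + 1)"
        by (simp only:)
    qed
    \<comment> \<open>Only odd powers of 1/x occur, since the odd moments vanish and the expansion
      is shifted by one.\<close>
    also have "(\<lambda>n. w (2 * n + 1) / x ^ (2 * n + 1)) sums F x \<longleftrightarrow> (\<lambda>n. w n / x ^ n) sums F x"
    proof (rule sums_mono_reindex[where f = "\<lambda>n. w n / x ^ n"])
      show "strict_mono (\<lambda>n::nat. 2 * n + 1)" by (rule strict_monoI) simp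
      show "w n / x ^ n = 0" if "n \<notin> range (\<lambda>n. 2 * n + 1)" for n
        using that by (auto simp: w_def elim!: oddE)
    qed
    finally show ?thesis .
  qed
  have "has_expansion (W1 c) a r F"
    unfolding has_expansion_def
  proof (intro conjI)
    show "\<forall>n<0. W1 c $$ n = 0" by (simp add: W1_eq gen_nth)
  qed (use coeff_value expansion in blast)
  moreover have "has_cut F (- r) r"
    unfolding F_def using \<beta> r(1) by (intro has_cut_sqrt) auto
  ultimately show ?thesis
    unfolding r_def \<beta>_def minus_divide_left by blast
qed

theorem mainTheorem4:
  assumes "CARD('d::finite) \<ge> 3"
  shows
    "(\<forall>c::'d.
        W1 c ^ 2 - scalar1 (1 - mps_var c ^ 2) * var_x * W1 c + scalar1 (1 - mps_var c ^ 2) = 0 \<and>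
        W1 c = scalar1 ((1 - mps_var c ^ 2) / 2) * (var_x - sigma c) \<and>
        (\<forall>a :: 'd \<Rightarrow> real. \<bar>a c\<bar> < 1 \<longrightarrow>
           (\<exists>F. has_expansion (W1 c) a (2 / sqrt (1 - (a c)\<^sup>2)) F \<and>
                has_cut F (- 2 / sqrt (1 - (a c)\<^sup>2)) (2 / sqrt (1 - (a c)\<^sup>2))))) \<and>
     (\<forall>i::'d.
        W2 i i =
          (in_x1 var_x * in_x2 var_x - in_x1 (sigma i) * in_x2 (sigma i)
             - scalar2 (4 / (1 - mps_var i ^ 2))) /
          (2 * (in_x1 var_x - in_x2 var_x) ^ 2 * in_x1 (sigma i) * in_x2 (sigma i))
          - scalar2 ((\<Sum>p\<in>UNIV - {i}. (mps_var i * mps_var p) ^ 2) /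
                     ((\<Sum>p\<in>UNIV. mps_var p ^ 2) - 1)) *
            (in_x1 (W1 i) * in_x2 (W1 i) /
             (scalar2 (1 - mps_var i ^ 2) * in_x1 (sigma i) * in_x2 (sigma i)))) \<and>
     (\<forall>i j::'d. i \<noteq> j \<longrightarrow>
        W2 i j =
          - scalar2 (mps_var i * mps_var j / ((\<Sum>p\<in>UNIV. mps_var p ^ 2) - 1)) *
            (in_x1 (W1 i) * in_x2 (W1 j) / (in_x1 (sigma i) * in_x2 (sigma j))))"
proof (intro conjI allI impI)
  fix c :: 'd and a :: "'d \<Rightarrow> real"
  show "W1 c ^ 2 - scalar1 (1 - mps_var c ^ 2) * var_x * W1 c + scalar1 (1 - mps_var c ^ 2) = 0"
    by (rule W1_quadratic[OF assms])
  show "W1 c = scalar1 ((1 - mps_var c ^ 2) / 2) * (var_x - sigma c)"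
    by (rule W1_explicit[OF assms])
  show "\<exists>F. has_expansion (W1 c) a (2 / sqrt (1 - (a c)\<^sup>2)) F \<and>
      has_cut F (- 2 / sqrt (1 - (a c)\<^sup>2)) (2 / sqrt (1 - (a c)\<^sup>2))" if "\<bar>a c\<bar> < 1"
    by (rule W1_has_cut[of a c, OF assms that])
qed (rule W2_diagonal[OF assms] W2_offdiagonal[OF assms]; assumption?)+

end
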